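(* Let $\kappa>0$, $R>0$, and let $\boldsymbol J$ be a (complex vector-valued) source for Maxwell's equation $\nabla(\nabla\cdot\boldsymbol E)-(\Delta\boldsymbol E+\kappa^2\boldsymbol E)=\boldsymbol J$, with compact support contained in $B_R$. The following hold: (i) If $\boldsymbol J\in (L^2(B_R))^3$, then $\boldsymbol J$ is nonradiating if and only if $\beta_n^m=\alpha_n^m+\gamma_n^m=0$ for all $n=0,1,\dots$ and $m=-n,\dots,n$. (ii) If $\boldsymbol J\in H_0(\mathrm{div};B_R)$, then $\boldsymbol J$ is nonradiating if and only if $\beta_n^m=\alpha_n^m+\zeta_n^m=0$ for all $n=0,1,\dots$ and $m=-n,\dots,n$. (iii) If $\boldsymbol J\in H(\mathrm{div};\mathrm{grad};B_R)$, then $\boldsymbol J$ is nonradiating if and only if $\alpha_n^m+\eta_n^m=0$ for all $n=0,1,\dots$ and $m=-n,\dots,n$.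
   Context: $B_R=\{x\in\mathbb R^3:|x|<R\}$, $\kappa>0$ is the wavenumber, $g(x,y)=\frac{e^{\mathrm i\kappa|x-y|}}{4\pi|x-y|}$, and $\boldsymbol G(x,y)=[\boldsymbol I+\kappa^{-2}\nabla\nabla]g(x,y)$ is the $3\times3$ dyadic Green's tensor, with $\boldsymbol I$ the identity matrix and $\nabla\nabla$ the Hessian (taken in $x$, equivalently in $y$). The electric field generated by $\boldsymbol J$ is $\boldsymbol E(x)=\int_{B_R}\boldsymbol G(x,y)\boldsymbol J(y)\,\mathrm dy$, the solution of $\nabla\times(\nabla\times\boldsymbol E)-\kappa^2\boldsymbol E=\boldsymbol J$ satisfying the Silver--Müller radiation condition. A source $\boldsymbol J$ with compact support contained in $B_R$ is called nonradiating if this $\boldsymbol E$ is identically zero outside $B_R$. Function spaces: $H(\mathrm{div};B_R)=\{\boldsymbol\Psi\in(L^2(B_R))^3:\nabla\cdot\boldsymbol\Psi\in L^2(B_R)\}$; $H_0(\mathrm{div};B_R)=\{\boldsymbol\Psi\in H(\mathrm{div};B_R):(\boldsymbol\Psi\cdot\boldsymbol n)|_{\partial B_R}=0\}$, $\boldsymbol n$ the outward unit normal; $H(\mathrm{div};\mathrm{grad};B_R)=\{\boldsymbol\Psi\in(L^2(B_R))^3:\nabla(\nabla\cdot\boldsymbol\Psi)\in(L^2(B_R))^3\}$. Let $j_n$ be the spherical Bessel function of order $n$, $\{Y_n^m\}$ the orthonormal spherical harmonics on the unit sphere (a complete orthonormal system in $L^2$ of the sphere), $\hat y=y/|y|$.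 The vectors in $\mathbb C^3$ are $\alpha_n^m=\int_{B_R}j_n(\kappa|y|)\overline{Y_n^m(\hat y)}\boldsymbol J(y)\,\mathrm dy$, $\gamma_n^m=\kappa^{-2}\int_{B_R}\big(\nabla_y\nabla_y\,[j_n(\kappa|y|)\overline{Y_n^m(\hat y)}]\big)\boldsymbol J(y)\,\mathrm dy$ (Hessian matrix applied to $\boldsymbol J$), $\beta_n^m=\int_{B_R}\big((\boldsymbol I+\kappa^{-2}\nabla_y\nabla_y)[j_n(\kappa|y|)\overline{Y_n^m(\hat y)}]\big)\boldsymbol J(y)\,\mathrm dy=\alpha_n^m+\gamma_n^m$, $\zeta_n^m=-\kappa^{-2}\int_{B_R}\big(\nabla_y[j_n(\kappa|y|)\overline{Y_n^m(\hat y)}]\big)(\nabla\cdot\boldsymbol J(y))\,\mathrm dy$, $\eta_n^m=\kappa^{-2}\int_{B_R}j_n(\kappa|y|)\overline{Y_n^m(\hat y)}\,\nabla(\nabla\cdot\boldsymbol J(y))\,\mathrm dy$. *)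

theory Defs
  imports "HOL-Analysis.Analysis" "HOL-Computational_Algebra.Polynomial"
begin

section \<open>Classical differential operators\<close>

definition pd :: "3 \<Rightarrow> (real^3 \<Rightarrow> complex) \<Rightarrow> real^3 \<Rightarrow> complex" where
  "pd i f x = vector_derivative (\<lambda>t. f (x + t *\<^sub>R axis i 1)) (at 0)"

definition grad :: "(real^3 \<Rightarrow> complex) \<Rightarrow> real^3 \<Rightarrow> complex^3" where
  "grad f x = (\<chi> i. pd i f x)"

definition hessian :: "(real^3 \<Rightarrow> complex) \<Rightarrow> real^3 \<Rightarrow> complex^3^3" where
  "hessian f x = (\<chi> i j. pd i (pd j f) x)"

text \<open>The matrix \<open>[I + \<kappa>\<^sup>-\<^sup>2 \<nabla>\<nabla>] f\<close>; \<^const>\<open>mat\<close> gives multiples of the identity matrix.\<close>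

definition dyadic :: "real \<Rightarrow> (real^3 \<Rightarrow> complex) \<Rightarrow> real^3 \<Rightarrow> complex^3^3" where
  "dyadic \<kappa> f x = mat (f x) + (1 / \<kappa>\<^sup>2) *\<^sub>R hessian f x"

text \<open>The bilinear product on \<open>\<complex>\<^sup>3\<close>, without conjugation.\<close>

definition cdot :: "complex^3 \<Rightarrow> complex^3 \<Rightarrow> complex" where
  "cdot u v = (\<Sum>i\<in>UNIV. u $ i * v $ i)"

section \<open>Radiated field and nonradiating sources\<close>

definition green :: "real \<Rightarrow> real^3 \<Rightarrow> real^3 \<Rightarrow> complex" where
  "green \<kappa> x y = exp (\<i> * of_real (\<kappa> * norm (x - y))) / of_real (4 * pi * norm (x - y))"

text \<open>The derivatives are taken with respect to the first argument.\<close>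

definition green_tensor :: "real \<Rightarrow> real^3 \<Rightarrow> real^3 \<Rightarrow> complex^3^3" where
  "green_tensor \<kappa> x y = dyadic \<kappa> (\<lambda>z. green \<kappa> z y) x"

text \<open>Only the values off the support of \<open>J\<close> are used below; there the kernel is smooth and the
  integral converges absolutely for \<open>J\<close> in \<open>L\<^sup>2\<close>. On the support the kernel is not integrable.\<close>

definition electric_field :: "real \<Rightarrow> real \<Rightarrow> (real^3 \<Rightarrow> complex^3) \<Rightarrow> real^3 \<Rightarrow> complex^3" where
  "electric_field \<kappa> R J x = (LINT y:ball 0 R|lebesgue. green_tensor \<kappa> x y *v J y)"

definition nonradiating :: "real \<Rightarrow> real \<Rightarrow> (real^3 \<Rightarrow> complex^3) \<Rightarrow> bool" where
  "nonradiating \<kappa> R J \<longleftrightarrow> (\<forall>x. x \<notin> ball 0 R \<longrightarrow> electric_field \<kappa> R J x = 0)"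

text \<open>The support of a function that is only given up to null sets: the complement of the largest
  open set on which it vanishes almost everywhere.\<close>

definition ess_support :: "(real^3 \<Rightarrow> complex^3) \<Rightarrow> (real^3) set" where
  "ess_support J = - \<Union>{U. open U \<and> (AE x in lebesgue. x \<in> U \<longrightarrow> J x = 0)}"

section \<open>Function spaces\<close>

definition L2 :: "'a::euclidean_space set \<Rightarrow> ('a \<Rightarrow> 'b::euclidean_space) set" where
  "L2 S = {f. f \<in> borel_measurable (lebesgue_on S) \<and>
              integrable (lebesgue_on S) (\<lambda>x. (norm (f x))\<^sup>2)}"

primrec Ck :: "nat \<Rightarrow> (real^3 \<Rightarrow> complex) \<Rightarrow> bool" where
  "Ck 0 f \<longleftrightarrow> continuous_on UNIV f"
| "Ck (Suc k) f \<longleftrightarrow> f differentiable_on UNIV \<and> (\<forall>i. Ck k (pd i f))"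

definition Cinf :: "(real^3 \<Rightarrow> complex) set" where
  "Cinf = {f. \<forall>k. Ck k f}"

definition test_functions :: "real \<Rightarrow> (real^3 \<Rightarrow> complex) set" where
  "test_functions R = {\<phi> \<in> Cinf. closure {x. \<phi> x \<noteq> 0} \<subseteq> ball 0 R}"

text \<open>\<open>d\<close> represents the distributional divergence of \<open>\<Psi>\<close> on the ball of radius \<open>R\<close>.\<close>

definition is_weak_div :: "real \<Rightarrow> (real^3 \<Rightarrow> complex^3) \<Rightarrow> (real^3 \<Rightarrow> complex) \<Rightarrow> bool" where
  "is_weak_div R \<Psi> d \<longleftrightarrow> (\<forall>\<phi>\<in>test_functions R.
     (LINT x:ball 0 R|lebesgue. cdot (\<Psi> x) (grad \<phi> x)) =
     - (LINT x:ball 0 R|lebesgue. d x * \<phi> x))"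

definition Hdiv :: "real \<Rightarrow> (real^3 \<Rightarrow> complex^3) set" where
  "Hdiv R = {\<Psi> \<in> L2 (ball 0 R). \<exists>d\<in>L2 (ball 0 R). is_weak_div R \<Psi> d}"

text \<open>Any choice of the \<open>L\<^sup>2\<close> representative will do: it is unique up to a null set.\<close>

definition weak_div :: "real \<Rightarrow> (real^3 \<Rightarrow> complex^3) \<Rightarrow> real^3 \<Rightarrow> complex" where
  "weak_div R \<Psi> = (SOME d. d \<in> L2 (ball 0 R) \<and> is_weak_div R \<Psi> d)"

text \<open>The pairing of the normal trace \<open>\<Psi> \<bullet> n\<close>, an element of \<open>H\<^sup>-\<^sup>1\<^sup>/\<^sup>2\<close> of the boundary sphere, with the
  boundary values of \<open>\<phi>\<close>, as defined by Green's formula for \<open>\<Psi>\<close> in \<open>H(div)\<close>. The functions \<open>\<phi>\<close>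
  smooth up to the boundary are dense in \<open>H\<^sup>1\<close> of the ball, hence suffice to test for zero trace.\<close>

definition normal_trace :: "real \<Rightarrow> (real^3 \<Rightarrow> complex^3) \<Rightarrow> (real^3 \<Rightarrow> complex) \<Rightarrow> complex" where
  "normal_trace R \<Psi> \<phi> =
     (LINT x:ball 0 R|lebesgue. cdot (\<Psi> x) (grad \<phi> x) + weak_div R \<Psi> x * \<phi> x)"

definition H0div :: "real \<Rightarrow> (real^3 \<Rightarrow> complex^3) set" where
  "H0div R = {\<Psi> \<in> Hdiv R. \<forall>\<phi>\<in>Cinf. normal_trace R \<Psi> \<phi> = 0}"

text \<open>\<open>g\<close> represents the distribution \<open>\<nabla>(\<nabla> \<bullet> \<Psi>)\<close>. Both derivatives fall on the test function
  (two sign changes), as the divergence itself is not assumed to be a function.\<close>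

definition is_weak_grad_div :: "real \<Rightarrow> (real^3 \<Rightarrow> complex^3) \<Rightarrow> (real^3 \<Rightarrow> complex^3) \<Rightarrow> bool" where
  "is_weak_grad_div R \<Psi> g \<longleftrightarrow> (\<forall>\<phi>\<in>test_functions R. \<forall>i.
     (LINT x:ball 0 R|lebesgue. cdot (\<Psi> x) (grad (pd i \<phi>) x)) =
     (LINT x:ball 0 R|lebesgue. g x $ i * \<phi> x))"

definition Hdivgrad :: "real \<Rightarrow> (real^3 \<Rightarrow> complex^3) set" where
  "Hdivgrad R = {\<Psi> \<in> L2 (ball 0 R). \<exists>g\<in>L2 (ball 0 R). is_weak_grad_div R \<Psi> g}"

definition weak_grad_div :: "real \<Rightarrow> (real^3 \<Rightarrow> complex^3) \<Rightarrow> real^3 \<Rightarrow> complex^3" where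
  "weak_grad_div R \<Psi> = (SOME g. g \<in> L2 (ball 0 R) \<and> is_weak_grad_div R \<Psi> g)"

section \<open>Spherical Bessel functions and spherical harmonics\<close>

text \<open>\<open>j\<^sub>n(t) = \<Sum>\<^sub>k (-1)\<^sup>k t\<^sup>n\<^sup>+\<^sup>2\<^sup>k / (2\<^sup>k k! (1 \<cdot> 3 \<cdot> \<dots> \<cdot> (2n+2k+1)))\<close>, which also covers \<open>t = 0\<close>.\<close>

definition spherical_bessel :: "nat \<Rightarrow> real \<Rightarrow> real" where
  "spherical_bessel n t =
     (\<Sum>k. (-1) ^ k * t ^ (n + 2 * k) / (2 ^ k * fact k * (\<Prod>i\<le>n + k. 2 * real i + 1)))"

text \<open>Rodrigues' formula: \<open>[:-1, 0, 1:]\<close> is the polynomial \<open>X\<^sup>2 - 1\<close>.\<close>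

definition legendre :: "nat \<Rightarrow> real poly" where
  "legendre n = smult (1 / (2 ^ n * fact n)) ((pderiv ^^ n) ([:-1, 0, 1:] ^ n))"

text \<open>Without the Condon--Shortley phase.\<close>

definition assoc_legendre :: "nat \<Rightarrow> nat \<Rightarrow> real \<Rightarrow> real" where
  "assoc_legendre n m t = sqrt (1 - t\<^sup>2) ^ m * poly ((pderiv ^^ m) (legendre n)) t"

text \<open>For a unit vector \<open>x = (sin \<theta> cos \<phi>, sin \<theta> sin \<phi>, cos \<theta>)\<close> the polar angle enters through
  \<open>cos \<theta> = x\<^sub>3\<close> and the azimuth is the argument of \<open>x\<^sub>1 + i x\<^sub>2\<close>. At the poles the azimuth is
  immaterial: the associated Legendre factor vanishes unless \<open>m = 0\<close>.\<close>

definition sph_harm :: "nat \<Rightarrow> int \<Rightarrow> real^3 \<Rightarrow> complex" where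
  "sph_harm n m x =
     of_real (sqrt ((2 * real n + 1) / (4 * pi) * fact (n - nat \<bar>m\<bar>) / fact (n + nat \<bar>m\<bar>))
              * assoc_legendre n (nat \<bar>m\<bar>) (x $ 3))
     * cis (of_int m * Arg (Complex (x $ 1) (x $ 2)))"

text \<open>\<open>j\<^sub>n(\<kappa>|y|)\<close> times the conjugate of \<open>Y\<^sub>n\<^sup>m(y/|y|)\<close>.\<close>

definition wave :: "real \<Rightarrow> nat \<Rightarrow> int \<Rightarrow> real^3 \<Rightarrow> complex" where
  "wave \<kappa> n m y = of_real (spherical_bessel n (\<kappa> * norm y)) * cnj (sph_harm n m (sgn y))"

section \<open>The moment vectors\<close>

definition alpha :: "real \<Rightarrow> real \<Rightarrow> (real^3 \<Rightarrow> complex^3) \<Rightarrow> nat \<Rightarrow> int \<Rightarrow> complex^3" where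
  "alpha \<kappa> R J n m = (LINT y:ball 0 R|lebesgue. wave \<kappa> n m y *s J y)"

definition gamma :: "real \<Rightarrow> real \<Rightarrow> (real^3 \<Rightarrow> complex^3) \<Rightarrow> nat \<Rightarrow> int \<Rightarrow> complex^3" where
  "gamma \<kappa> R J n m =
     (1 / \<kappa>\<^sup>2) *\<^sub>R (LINT y:ball 0 R|lebesgue. hessian (wave \<kappa> n m) y *v J y)"

definition beta :: "real \<Rightarrow> real \<Rightarrow> (real^3 \<Rightarrow> complex^3) \<Rightarrow> nat \<Rightarrow> int \<Rightarrow> complex^3" where
  "beta \<kappa> R J n m = (LINT y:ball 0 R|lebesgue. dyadic \<kappa> (wave \<kappa> n m) y *v J y)"

definition zeta :: "real \<Rightarrow> real \<Rightarrow> (real^3 \<Rightarrow> complex^3) \<Rightarrow> nat \<Rightarrow> int \<Rightarrow> complex^3" where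
  "zeta \<kappa> R J n m =
     - ((1 / \<kappa>\<^sup>2) *\<^sub>R (LINT y:ball 0 R|lebesgue. weak_div R J y *s grad (wave \<kappa> n m) y))"

definition eta :: "real \<Rightarrow> real \<Rightarrow> (real^3 \<Rightarrow> complex^3) \<Rightarrow> nat \<Rightarrow> int \<Rightarrow> complex^3" where
  "eta \<kappa> R J n m =
     (1 / \<kappa>\<^sup>2) *\<^sub>R (LINT y:ball 0 R|lebesgue. wave \<kappa> n m y *s weak_grad_div R J y)"

end

theory Submission
  imports Defs
begin

text \<open>The proof rests on one identity, lemma \<open>field_moment\<close>: integrating the \<open>i\<close>-th component of the electric field over the
  sphere of radius \<open>\<rho> \<ge> R\<close> against a spherical harmonic of degree \<open>n\<close> gives
  \<open>c\<^sub>n(\<rho>)\<close> times the moment of \<open>J\<close> against the corresponding regular wave \<open>j\<^sub>n(\<kappa>|y|) Y(y/|y|)\<close>, where the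
  numbers \<open>c\<^sub>n(\<rho>)\<close> are, up to nonzero factors, the outgoing Hankel functions \<open>h\<^sub>n(\<kappa>\<rho>)\<close>. If \<open>J\<close> is nonradiating, a radius
  with \<open>c\<^sub>n(\<rho>) \<noteq> 0\<close> shows that the moments vanish. If all moments vanish, the field on each
  exterior sphere is orthogonal to all spherical harmonics and vanishes by completeness.

  By Fubini's theorem the identity reduces to one about the scalar Green's function: for \<open>|y| < \<rho>\<close>, the integral of
  \<open>g(\<rho>d, y)\<close> against a spherical harmonic over unit vectors \<open>d\<close> is \<open>c\<^sub>n(\<rho>)\<close> times the regular wave
  at \<open>y\<close> (lemma \<open>point_source_moment\<close>). It is enough to prove this for the harmonic polynomials \<open>(\<zeta> \<cdot> d)\<^sup>n\<close> with
  null vectors \<open>\<zeta> \<cdot> \<zeta> = 0\<close>, since those with \<open>\<zeta> = (1 - z\<^sup>2, \<minusplus>i(1 + z\<^sup>2), 2z)\<close> generate the spherical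
  harmonics as coefficients of powers of \<open>z\<close>; completing the square in \<open>z\<close> gives Rodrigues' formula
  (lemma \<open>coeff_null_power\<close>). For null powers there is a simple Funk--Hecke formula
  (theorem \<open>funk_hecke_null\<close>): the integral of \<open>F(d \<bullet> y) (\<zeta> \<cdot> d)\<^sup>n\<close> is \<open>(\<zeta> \<cdot> y)\<^sup>n\<close> times a weighted integral of
  the \<open>n\<close>-th derivative of \<open>F\<close> over \<open>[-|y|, |y|]\<close>. It starts from Archimedes' hat-box theorem and proceeds by
  differentiating in the direction \<open>\<zeta>\<close>, for which \<open>\<zeta> \<cdot> y\<close> is constant.

  Applied to the Green's function, the weighted integral is a function of \<open>|y|\<close> that satisfies the
  radial Helmholtz equation in dimension \<open>2n + 3\<close> and is regular at the origin. By uniqueness at the singular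
  point (lemma \<open>singular_ode_unique\<close>) it is a multiple of \<open>j\<^sub>n(\<kappa>|y|)/|y|\<^sup>n\<close>, and the factor is a derivative of the kernel,
  which does not vanish at large distances (lemma \<open>radial_kernel_nonzero_far\<close>).

  The forms of the moments for more regular sources follow by moving derivatives from the wave to \<open>J\<close>: for
  vanishing normal trace by its definition (lemma \<open>gamma_eq_zeta\<close>), and for a weak gradient of the divergence
  with cutoff functions that are \<open>1\<close> near the support of \<open>J\<close> (lemma \<open>gamma_eq_eta\<close>).\<close>

section \<open>The rotation invariant measure on the unit sphere\<close>

text \<open>The image of Lebesgue measure on the punctured unit ball under radial projection. Rotation invariance
  is inherited from Lebesgue measure, and the carrier is the sphere itself, so that every function
  that is continuous there is integrable. The total mass is \<open>4\<pi>/3\<close>.\<close>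

definition sphere_measure :: "(real^3) measure" where
  "sphere_measure =
     distr (restrict_space lborel (ball 0 1 - {0})) (restrict_space borel (sphere 0 1)) sgn"

lemma continuous_on_sgn_punctured: "continuous_on (- {0}) (sgn :: real^3 \<Rightarrow> real^3)"
  unfolding sgn_div_norm by (intro continuous_intros) auto

lemma sgn_measurable_punctured_ball [measurable]:
  "sgn \<in> measurable (restrict_space lborel (ball 0 1 - {0 :: real^3})) (restrict_space borel (sphere 0 1))"
proof (rule measurable_restrict_space2)
  show "sgn \<in> space (restrict_space lborel (ball 0 1 - {0 :: real^3})) \<rightarrow> sphere 0 1"
    by (auto simp: space_restrict_space norm_sgn)
  have "continuous_on (ball 0 1 - {0}) (sgn :: real^3 \<Rightarrow> real^3)"
    by (rule continuous_on_subset[OF continuous_on_sgn_punctured]) auto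
  from borel_measurable_continuous_on_restrict[OF this]
  show "sgn \<in> borel_measurable (restrict_space lborel (ball 0 1 - {0 :: real^3}))"
    by (simp cong: measurable_cong_sets add: sets_restrict_space)
qed

lemma space_sphere_measure [simp]: "space sphere_measure = sphere 0 1"
  by (simp add: sphere_measure_def space_restrict_space)

lemma sets_sphere_measure [measurable_cong]:
  "sets sphere_measure = sets (restrict_space borel (sphere 0 1))"
  by (simp add: sphere_measure_def)

lemma finite_measure_sphere: "finite_measure sphere_measure"
proof -
  have "emeasure lborel (ball 0 1 - {0 :: real^3}) \<le> emeasure lborel (ball 0 1 :: (real^3) set)"
    by (rule emeasure_mono) auto
  also have "\<dots> < \<infinity>" by (rule emeasure_bounded_finite) auto
  finally have "finite_measure (restrict_space lborel (ball 0 1 - {0 :: real^3}))"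
    by (intro finite_measureI) (simp add: space_restrict_space emeasure_restrict_space)
  then interpret finite_measure "restrict_space lborel (ball 0 1 - {0 :: real^3})" .
  show ?thesis unfolding sphere_measure_def
    by (rule finite_measure_distr) measurable
qed

lemma borel_measurable_sphere:
  fixes f :: "real^3 \<Rightarrow> 'b :: real_normed_vector"
  assumes "continuous_on (sphere 0 1) f"
  shows "f \<in> borel_measurable sphere_measure"
  using borel_measurable_continuous_on_restrict[OF assms]
  by (simp cong: measurable_cong_sets add: sets_sphere_measure)

lemma integrable_sphere:
  fixes f :: "real^3 \<Rightarrow> 'b :: euclidean_space"
  assumes f: "continuous_on (sphere 0 1) f"
  shows "integrable sphere_measure f"
proof -
  interpret finite_measure sphere_measure by (rule finite_measure_sphere)
  have "bounded (f ` sphere 0 1)"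
    by (intro compact_imp_bounded compact_continuous_image f) auto
  then obtain B where "\<forall>x\<in>sphere 0 1. norm (f x) \<le> B"
    unfolding bounded_iff by auto
  then show ?thesis
    by (intro integrable_const_bound[of _ B] borel_measurable_sphere f AE_I2) auto
qed

text \<open>It is enough to compare boxes, and orthogonal images of measurable sets have the same measure.\<close>

lemma lborel_distr_orthogonal:
  fixes T :: "real^3 \<Rightarrow> real^3"
  assumes T: "orthogonal_transformation T"
  shows "distr lborel borel T = lborel"
proof (rule lborel_eqI[symmetric])
  have Tm: "T \<in> borel_measurable borel"
    by (intro borel_measurable_continuous_onI linear_continuous_on)
       (use T in \<open>simp add: orthogonal_transformation_linear linear_conv_bounded_linear[symmetric]\<close>)
  fix l u :: "real^3" assume lu: "\<And>b. b \<in> Basis \<Longrightarrow> l \<bullet> b \<le> u \<bullet> b"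
  have vi: "T -` box l u = inv T ` box l u"
    using bij_vimage_eq_inv_image[OF orthogonal_transformation_bij[OF T]] .
  have m: "inv T ` box l u \<in> lmeasurable"
    and e: "measure lebesgue (inv T ` box l u) = measure lebesgue (box l u)"
    using measurable_orthogonal_image[OF orthogonal_transformation_inv[OF T], of "box l u"]
      measure_orthogonal_image[OF orthogonal_transformation_inv[OF T], of "box l u"] by auto
  have b: "T -` box l u \<in> sets borel"
    using measurable_sets[OF Tm, of "box l u"] by simp
  have "emeasure (distr lborel borel T) (box l u) = emeasure lborel (T -` box l u)"
    using Tm by (simp add: emeasure_distr)
  also have "\<dots> = emeasure lebesgue (T -` box l u)"
    using b by simp
  also have "\<dots> = ennreal (measure lebesgue (box l u))"
    using m e by (simp add: vi emeasure_eq_measure2)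
  also have "\<dots> = (\<Prod>b\<in>Basis. (u - l) \<bullet> b)"
    using lu by (simp add: measure_def)
  finally show "emeasure (distr lborel borel T) (box l u) = (\<Prod>b\<in>Basis. (u - l) \<bullet> b)" .
qed simp

lemma sphere_integral_eq:
  fixes f :: "real^3 \<Rightarrow> 'b :: {banach, second_countable_topology}"
  assumes f: "f \<in> borel_measurable sphere_measure"
  shows "integral\<^sup>L sphere_measure f =
         (LINT x|lborel. indicator (ball 0 1 - {0}) x *\<^sub>R f (sgn x))"
  unfolding sphere_measure_def
  by (subst integral_distr)
     (use f in \<open>auto simp: integral_restrict_space sets_sphere_measure cong: measurable_cong_sets\<close>)

text \<open>Lebesgue measure, the punctured ball and \<^const>\<open>sgn\<close> all commute with rotations.\<close>

lemma sphere_integral_rotate: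
  fixes f :: "real^3 \<Rightarrow> 'b :: euclidean_space"
  assumes T: "orthogonal_transformation T" and f: "continuous_on (sphere 0 1) f"
  shows "(LINT d|sphere_measure. f (T d)) = integral\<^sup>L sphere_measure f"
proof -
  have lin: "linear T" using T by (rule orthogonal_transformation_linear)
  have cT: "continuous_on S T" for S
    using lin by (simp add: linear_continuous_on linear_conv_bounded_linear[symmetric])
  have nT: "norm (T x) = norm x" for x
    using T orthogonal_transformation_norm by blast
  have T0: "T x = 0 \<longleftrightarrow> x = 0" for x
    using nT[of x] by (metis norm_eq_zero)
  have sT: "T (sgn x) = sgn (T x)" for x
    by (simp add: sgn_div_norm linear_cmul[OF lin] nT)
  have Tm: "T \<in> borel_measurable borel"
    by (intro borel_measurable_continuous_onI cT)
  have cf: "continuous_on (sphere 0 1) (\<lambda>d. f (T d))"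
    by (rule continuous_on_compose2[OF f cT]) (auto simp: nT)
  have cfs: "continuous_on (ball 0 1 - {0}) (\<lambda>x. f (sgn x))"
    by (rule continuous_on_compose2[OF f continuous_on_subset[OF continuous_on_sgn_punctured]])
       (auto simp: norm_sgn split: if_splits)
  let ?g = "\<lambda>x. indicator (ball 0 1 - {0}) x *\<^sub>R f (sgn x)"
  have gm: "?g \<in> borel_measurable borel"
    by (rule borel_measurable_continuous_on_indicator[OF _ cfs]) auto
  have "(LINT d|sphere_measure. f (T d)) = (LINT x|lborel. ?g (T x))"
    by (subst sphere_integral_eq[OF borel_measurable_sphere[OF cf]])
       (auto intro!: Bochner_Integration.integral_cong simp: sT indicator_def nT T0)
  also have "\<dots> = integral\<^sup>L (distr lborel borel T) ?g"
    by (subst integral_distr) (use Tm gm in auto)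
  also have "\<dots> = integral\<^sup>L sphere_measure f"
    by (simp add: lborel_distr_orthogonal[OF T] sphere_integral_eq[OF borel_measurable_sphere[OF f]])
  finally show ?thesis .
qed

text \<open>The measure charges every nonempty relatively open subset of the sphere: the cone over such a set
  contains an open subset of the ball.\<close>

lemma sphere_integral_zero_imp_zero:
  fixes f :: "real^3 \<Rightarrow> real"
  assumes f: "continuous_on (sphere 0 1) f" and pos: "\<And>d. norm d = 1 \<Longrightarrow> f d \<ge> 0"
    and int: "integral\<^sup>L sphere_measure f = 0" and d: "norm d = 1"
  shows "f d = 0"
proof (rule ccontr)
  assume nz: "f d \<noteq> 0"
  have cfs: "continuous_on (ball 0 1 - {0}) (\<lambda>x. f (sgn x))"
    by (rule continuous_on_compose2[OF f continuous_on_subset[OF continuous_on_sgn_punctured]])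
       (auto simp: norm_sgn split: if_splits)
  have "AE x in sphere_measure. f x = 0"
  proof -
    have "AE x in sphere_measure. 0 \<le> f x" by (rule AE_I2) (use pos in auto)
    then show ?thesis
      using integral_nonneg_eq_0_iff_AE[OF integrable_sphere[OF f]] int by auto
  qed
  then have "AE x in restrict_space lborel (ball 0 1 - {0}). f (sgn x) = 0"
    unfolding sphere_measure_def
    by (rule AE_distrD[OF sgn_measurable_punctured_ball])
  then have ae: "AE x in lborel. x \<in> ball 0 1 - {0} \<longrightarrow> f (sgn x) = 0"
    by (subst (asm) AE_restrict_space_iff) auto
  define U where "U = {x \<in> ball 0 1 - {0}. f (sgn x) \<in> - {0}}"
  have oU: "open U"
    unfolding U_def by (rule continuous_open_preimage[OF cfs, of "- {0}", unfolded vimage_def Int_def mem_Collect_eq]) auto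
  have "AE x in lborel. x \<notin> U" using ae by eventually_elim (auto simp: U_def)
  then have "emeasure lborel U = 0"
    using oU by (subst (asm) AE_iff_measurable[where N=U]) auto
  then have "negligible U"
    using oU by (simp add: negligible_iff_null_sets null_sets_def null_sets_completion_iff2)
  moreover have "(1/2) *\<^sub>R d \<in> U"
    using nz d by (auto simp: U_def sgn_div_norm)
  ultimately show False using open_not_negligible[OF oU] by auto
qed

section \<open>Differentiation under the sphere integral\<close>

text \<open>The difference quotients are dominated by a bound for \<open>\<phi>'\<close> on a compact neighbourhood, by the mean
  value theorem.\<close>

lemma sphere_integral_leibniz:
  fixes \<phi> :: "real \<Rightarrow> real^3 \<Rightarrow> 'b :: euclidean_space"
  assumes e: "e > 0"
    and der: "\<And>\<tau> d. \<bar>\<tau> - a\<bar> < e \<Longrightarrow> norm d = 1 \<Longrightarrow>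
                ((\<lambda>\<tau>. \<phi> \<tau> d) has_vector_derivative \<phi>' \<tau> d) (at \<tau>)"
    and c: "\<And>\<tau>. \<bar>\<tau> - a\<bar> < e \<Longrightarrow> continuous_on (sphere 0 1) (\<phi> \<tau>)"
    and c': "continuous_on ({a - e<..<a + e} \<times> sphere 0 1) (\<lambda>(\<tau>, d). \<phi>' \<tau> d)"
  shows "((\<lambda>\<tau>. LINT d|sphere_measure. \<phi> \<tau> d) has_vector_derivative
          (LINT d|sphere_measure. \<phi>' a d)) (at a)"
proof -
  have cpt: "compact ({a - e/2..a + e/2} \<times> sphere (0 :: real^3) 1)"
    by (intro compact_Times) auto
  have "bounded ((\<lambda>(\<tau>, d). \<phi>' \<tau> d) ` ({a - e/2..a + e/2} \<times> sphere 0 1))"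
    by (intro compact_imp_bounded compact_continuous_image cpt continuous_on_subset[OF c'])
       (use e in auto)
  then obtain B where B0: "\<forall>z\<in>{a - e/2..a + e/2} \<times> sphere 0 1. norm (case z of (\<tau>, d) \<Rightarrow> \<phi>' \<tau> d) \<le> B"
    unfolding bounded_iff by blast
  have B: "norm (\<phi>' \<tau> d) \<le> B" if "\<bar>\<tau> - a\<bar> \<le> e/2" "norm d = 1" for \<tau> d
  proof -
    have "a - e/2 \<le> \<tau>" "\<tau> \<le> a + e/2" using that(1) by linarith+
    then show ?thesis using bspec[OF B0, of "(\<tau>, d)"] that(2) by simp
  qed
  have ca: "continuous_on (sphere 0 1) (\<phi>' a)"
  proof -
    have "continuous_on (sphere 0 1) (\<lambda>d. case (a, d) of (\<tau>, d) \<Rightarrow> \<phi>' \<tau> d)"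
      by (rule continuous_on_compose2[OF c']) (use e in \<open>auto intro!: continuous_intros\<close>)
    then show ?thesis by simp
  qed
  let ?I = "\<lambda>\<tau>. LINT d|sphere_measure. \<phi> \<tau> d"
  let ?D = "LINT d|sphere_measure. \<phi>' a d"
  let ?q = "\<lambda>y d. (1 / norm (y - a)) *\<^sub>R (\<phi> y d - (\<phi> a d + (y - a) *\<^sub>R \<phi>' a d))"
  have scale: "(1 / n) * X \<le> 2 * B" if "X \<le> 2 * B * n" "n > 0" for X n :: real
    using that by (simp add: field_simps)
  have bnd: "norm (?q y d) \<le> 2 * B" if y: "\<bar>y - a\<bar> < e/2" and d: "norm d = 1" for y d
  proof (cases "y = a")
    case True
    have "norm (\<phi>' a d) \<le> B" using B[of a d] d e by auto
    with True show ?thesis by (smt (verit) norm_ge_zero norm_zero div_0 add.right_neutral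
        cancel_comm_monoid_add_class.diff_cancel scaleR_zero_left scaleR_zero_right)
  next
    case False
    have yI: "a - e/2 \<le> y" "y \<le> a + e/2" using y by linarith+
    have "norm (\<phi> y d - \<phi> a d) \<le> B * norm (y - a)"
    proof (rule differentiable_bound[where S="{a - e/2..a + e/2}" and f'="\<lambda>\<tau> h. h *\<^sub>R \<phi>' \<tau> d"])
      fix x assume x: "x \<in> {a - e/2..a + e/2}"
      then have "a - e/2 \<le> x" "x \<le> a + e/2" by auto
      then have x': "\<bar>x - a\<bar> \<le> e/2" by linarith
      show "((\<lambda>\<tau>. \<phi> \<tau> d) has_derivative (\<lambda>h. h *\<^sub>R \<phi>' x d)) (at x within {a - e/2..a + e/2})"
        using der[of x d] x' e d
        by (auto simp: has_vector_derivative_def intro: has_derivative_at_withinI)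
      show "onorm (\<lambda>h. h *\<^sub>R \<phi>' x d) \<le> B"
        by (rule onorm_le) (use mult_left_mono[OF B[OF x' d] abs_ge_zero] in \<open>simp add: mult.commute\<close>)
    qed (use yI e in auto)
    moreover have "norm ((y - a) *\<^sub>R \<phi>' a d) \<le> B * norm (y - a)"
      using mult_left_mono[OF B[of a d] abs_ge_zero[of "y - a"]] d e by (simp add: mult.commute)
    ultimately have "norm (\<phi> y d - (\<phi> a d + (y - a) *\<^sub>R \<phi>' a d)) \<le> 2 * B * norm (y - a)"
      using norm_triangle_ineq4[of "\<phi> y d - \<phi> a d" "(y - a) *\<^sub>R \<phi>' a d"] by (simp add: diff_diff_eq)
    from scale[OF this] show ?thesis using False by (simp only: norm_scaleR) simp
  qed
  have "((\<lambda>y. (1 / norm (y - a)) *\<^sub>R (?I y - (?I a + (y - a) *\<^sub>R ?D))) \<longlongrightarrow> 0) (at a)"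
    unfolding tendsto_at_iff_sequentially
  proof (intro allI impI)
    fix X :: "nat \<Rightarrow> real" assume X: "\<forall>i. X i \<in> UNIV - {a}" "X \<longlonglongrightarrow> a"
    have "eventually (\<lambda>i. \<bar>X i - a\<bar> < e/2) sequentially"
      using X(2) e unfolding tendsto_iff dist_real_def by (metis half_gt_zero)
    then obtain N where N: "\<And>i. i \<ge> N \<Longrightarrow> \<bar>X i - a\<bar> < e/2"
      unfolding eventually_sequentially by blast
    let ?Y = "\<lambda>i. X (i + N)"
    have Y: "\<bar>?Y i - a\<bar> < e/2" for i using N by simp
    have eq: "(1 / norm (y - a)) *\<^sub>R (?I y - (?I a + (y - a) *\<^sub>R ?D)) = (LINT d|sphere_measure. ?q y d)"
      if "\<bar>y - a\<bar> < e/2" for y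
      using that e
      by (simp add: integrable_sphere c ca)
    have cq: "continuous_on (sphere 0 1) (?q y)" if "\<bar>y - a\<bar> < e/2" for y
      by (intro continuous_intros c ca) (use that e in auto)
    have "(\<lambda>i. LINT d|sphere_measure. ?q (?Y i) d) \<longlonglongrightarrow> (LINT d|sphere_measure. 0)"
    proof (rule integral_dominated_convergence[where w="\<lambda>_. 2 * B"])
      show "(\<lambda>_. 0) \<in> borel_measurable sphere_measure" by simp
      show "?q (?Y i) \<in> borel_measurable sphere_measure" for i
        by (intro borel_measurable_sphere cq Y)
      show "integrable sphere_measure (\<lambda>_. 2 * B)" by (intro integrable_sphere continuous_intros)
      show "AE d in sphere_measure. (\<lambda>i. ?q (?Y i) d) \<longlonglongrightarrow> 0"
      proof (rule AE_I2)
        fix d :: "real^3" assume "d \<in> space sphere_measure"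
        then have d: "norm d = 1" by simp
        have "((\<lambda>y. ?q y d) \<longlongrightarrow> 0) (at a)"
          using der[of a d] d e by (simp add: has_vector_derivative_def has_derivative_within)
        moreover have "?Y \<longlonglongrightarrow> a" using X(2) by (rule LIMSEQ_ignore_initial_segment)
        ultimately show "(\<lambda>i. ?q (?Y i) d) \<longlonglongrightarrow> 0"
          using X(1) unfolding tendsto_at_iff_sequentially comp_def by auto
      qed
      show "AE d in sphere_measure. norm (?q (?Y i) d) \<le> 2 * B" for i
        by (rule AE_I2) (use bnd[OF Y] in auto)
    qed
    then have "(\<lambda>i. ((\<lambda>y. (1 / norm (y - a)) *\<^sub>R (?I y - (?I a + (y - a) *\<^sub>R ?D))) \<circ> X) (i + N)) \<longlonglongrightarrow> 0"
      by (simp only: o_def eq[OF Y]) simp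
    then show "((\<lambda>y. (1 / norm (y - a)) *\<^sub>R (?I y - (?I a + (y - a) *\<^sub>R ?D))) \<circ> X) \<longlonglongrightarrow> 0"
      by (rule LIMSEQ_offset)
  qed
  then show ?thesis
    by (simp add: has_vector_derivative_def has_derivative_within bounded_linear_scaleR_left)
qed

section \<open>Distribution of a coordinate on the sphere\<close>

lemma orthogonal_rotation_plane:
  fixes i j :: 3
  assumes "i \<noteq> j"
  shows "orthogonal_transformation (\<lambda>d :: real^3. \<chi> k. if k = i then cos \<tau> * d$i + sin \<tau> * d$j
           else if k = j then cos \<tau> * d$j - sin \<tau> * d$i else d$k)"
  (is "orthogonal_transformation ?T")
  unfolding orthogonal_transformation
proof (intro conjI allI)
  show "linear ?T" by (rule linearI) (auto simp: vec_eq_iff algebra_simps)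
  fix v :: "real^3"
  have s: "(cos \<tau> * x + sin \<tau> * y)\<^sup>2 + (cos \<tau> * y - sin \<tau> * x)\<^sup>2 = x\<^sup>2 + y\<^sup>2" for x y :: real
  proof -
    have "(cos \<tau> * x + sin \<tau> * y)\<^sup>2 + (cos \<tau> * y - sin \<tau> * x)\<^sup>2
        = ((cos \<tau>)\<^sup>2 + (sin \<tau>)\<^sup>2) * (x\<^sup>2 + y\<^sup>2)" by algebra
    then show ?thesis by simp
  qed
  have "(\<Sum>k\<in>UNIV. (?T v $ k)\<^sup>2) = (\<Sum>k\<in>UNIV. (v $ k)\<^sup>2)"
  proof -
    have "(i = 1 \<or> i = 2 \<or> i = 3) \<and> (j = 1 \<or> j = 2 \<or> j = 3)"
      using exhaust_3[of i] exhaust_3[of j] by blast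
    then show ?thesis using s[of "v$i" "v$j"] assms
      by (elim conjE disjE) (simp_all add: sum_3)
  qed
  then show "norm (?T v) = norm v" by (simp add: norm_vec_def L2_set_def)
qed

text \<open>An infinitesimal rotation annihilates the sphere integral. Here the rotation in the plane of the
  axes \<open>3\<close> and \<open>i\<close> is applied to \<open>d\<^sub>3\<^bsup>j+1\<^esup> d\<^sub>i\<close>, whose derivative is
  \<open>(j+1) d\<^sub>3\<^sup>j d\<^sub>i\<^sup>2 - d\<^sub>3\<^bsup>j+2\<^esup>\<close>.\<close>

lemma sphere_moment_step:
  fixes i :: 3 assumes i: "i \<noteq> 3"
  shows "(LINT d|sphere_measure. real (Suc j) * d$3 ^ j * (d$i)\<^sup>2) = (LINT d|sphere_measure. d$3 ^ (j + 2))"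
proof -
  let ?T = "\<lambda>\<tau> d :: real^3. (\<chi> k. if k = 3 then cos \<tau> * d$3 + sin \<tau> * d$i
           else if k = i then cos \<tau> * d$i - sin \<tau> * d$3 else d$k) :: real^3"
  let ?F = "\<lambda>d :: real^3. d$3 ^ Suc j * d$i"
  let ?f = "\<lambda>\<tau> d :: real^3. (cos \<tau> * d$3 + sin \<tau> * d$i) ^ Suc j * (cos \<tau> * d$i - sin \<tau> * d$3)"
  let ?f' = "\<lambda>\<tau> d :: real^3. (cos \<tau> * d$3 + sin \<tau> * d$i) ^ Suc j * (- sin \<tau> * d$i - cos \<tau> * d$3)
     + real (Suc j) * (- sin \<tau> * d$3 + cos \<tau> * d$i) * (cos \<tau> * d$3 + sin \<tau> * d$i) ^ j
       * (cos \<tau> * d$i - sin \<tau> * d$3)"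
  have "(LINT d|sphere_measure. ?f \<tau> d) = (LINT d|sphere_measure. ?F d)" for \<tau>
    using sphere_integral_rotate[OF orthogonal_rotation_plane[of 3 i \<tau>], of ?F] i
    by (simp add: continuous_intros)
  then have "((\<lambda>\<tau>. LINT d|sphere_measure. ?f \<tau> d) has_vector_derivative 0) (at 0)"
    by simp
  moreover have "((\<lambda>\<tau>. LINT d|sphere_measure. ?f \<tau> d) has_vector_derivative
                   (LINT d|sphere_measure. ?f' 0 d)) (at 0)"
  proof (rule sphere_integral_leibniz[where e=1])
    fix \<tau> :: real and d :: "real^3"
    show "((\<lambda>\<tau>. ?f \<tau> d) has_vector_derivative ?f' \<tau> d) (at \<tau>)"
      unfolding has_real_derivative_iff_has_vector_derivative[symmetric]
      by (rule derivative_eq_intros refl | simp)+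
    show "continuous_on (sphere 0 1) (?f \<tau>)" by (intro continuous_intros)
    show "continuous_on ({0 - 1<..<0 + 1} \<times> sphere 0 1) (\<lambda>(\<tau>, d). ?f' \<tau> d)"
      by (simp add: split_beta) (intro continuous_intros)
  qed simp
  ultimately have "(LINT d|sphere_measure. ?f' 0 d) = 0"
    by (rule vector_derivative_unique_at[symmetric])
  then have "(LINT d|sphere_measure. real (Suc j) * d$3 ^ j * (d$i)\<^sup>2 - d$3 ^ (j + 2)) = 0"
    by (simp add: power2_eq_square mult_ac power_add)
  then show ?thesis
    by (subst (asm) Bochner_Integration.integral_diff)
       (auto intro!: integrable_sphere continuous_intros)
qed

definition sphere_area :: real where "sphere_area = measure sphere_measure (sphere 0 1)"

text \<open>Adding the identities for the two horizontal axes and using \<open>|d| = 1\<close> closes the recursion.\<close>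

lemma sphere_moment_recursion:
  "real (j + 3) * (LINT d|sphere_measure. d$3 ^ (j + 2)) = real (j + 1) * (LINT d|sphere_measure. d$3 ^ j)"
proof -
  have "(LINT d|sphere_measure. real (Suc j) * d$3 ^ j * (d$1)\<^sup>2) + (LINT d|sphere_measure. real (Suc j) * d$3 ^ j * (d$2)\<^sup>2)
      + (LINT d|sphere_measure. real (Suc j) * d$3 ^ (j + 2))
      = (LINT d|sphere_measure. real (Suc j) * d$3 ^ j * (d$1)\<^sup>2 + real (Suc j) * d$3 ^ j * (d$2)\<^sup>2 + real (Suc j) * d$3 ^ (j + 2))"
    by (subst Bochner_Integration.integral_add | auto intro!: integrable_sphere continuous_intros)+
  also have "\<dots> = (LINT d|sphere_measure. real (Suc j) * d$3 ^ j)"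
  proof (rule Bochner_Integration.integral_cong[OF refl])
    fix d :: "real^3" assume "d \<in> space sphere_measure"
    then have "(d$1)\<^sup>2 + (d$2)\<^sup>2 + (d$3)\<^sup>2 = 1"
      by (simp add: norm_vec_def L2_set_def sum_3)
    then have "real (Suc j) * d$3 ^ j * ((d$1)\<^sup>2 + (d$2)\<^sup>2 + (d$3)\<^sup>2) = real (Suc j) * d$3 ^ j" by simp
    then show "real (Suc j) * d$3 ^ j * (d$1)\<^sup>2 + real (Suc j) * d$3 ^ j * (d$2)\<^sup>2 + real (Suc j) * d$3 ^ (j + 2)
      = real (Suc j) * d$3 ^ j" by (simp add: algebra_simps power_add power2_eq_square)
  qed
  finally have sum: "(LINT d|sphere_measure. real (Suc j) * d$3 ^ j * (d$1)\<^sup>2)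
      + (LINT d|sphere_measure. real (Suc j) * d$3 ^ j * (d$2)\<^sup>2)
      + (LINT d|sphere_measure. real (Suc j) * d$3 ^ (j + 2))
      = (LINT d|sphere_measure. real (Suc j) * d$3 ^ j)" .
  have s: "(LINT d|sphere_measure. real (Suc j) * d$3 ^ j * (d$1)\<^sup>2) = (LINT d|sphere_measure. d$3 ^ (j + 2))"
    "(LINT d|sphere_measure. real (Suc j) * d$3 ^ j * (d$2)\<^sup>2) = (LINT d|sphere_measure. d$3 ^ (j + 2))"
    by (rule sphere_moment_step, simp)+
  show ?thesis
    using sum unfolding s integral_mult_right_zero by (simp add: algebra_simps)
qed

lemma integral_monomial_symmetric:
  "integral {-1..1} (\<lambda>t :: real. t ^ j) = (1 - (-1) ^ Suc j) / real (Suc j)"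
proof (rule integral_unique)
  have "((\<lambda>t :: real. t ^ j) has_integral (1 ^ Suc j / real (Suc j) - (-1) ^ Suc j / real (Suc j))) {-1..1}"
  proof (rule fundamental_theorem_of_calculus)
    fix x :: real
    show "((\<lambda>t. t ^ Suc j / real (Suc j)) has_vector_derivative x ^ j) (at x within {-1..1})"
      unfolding has_real_derivative_iff_has_vector_derivative[symmetric]
      by (rule derivative_eq_intros refl | simp)+
  qed simp
  then show "((\<lambda>t :: real. t ^ j) has_integral ((1 - (-1) ^ Suc j) / real (Suc j))) {-1..1}"
    unfolding diff_divide_distrib[symmetric] power_one .
qed

text \<open>The moments of a coordinate are those of the uniform distribution on \<open>[-1, 1]\<close>: both sequences
  satisfy the same two-step recursion.\<close>

lemma sphere_moment:
  "(LINT d|sphere_measure. d$3 ^ j) = sphere_area / 2 * integral {-1..1} (\<lambda>t. t ^ j)"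
proof (induction j rule: induct_nat_012)
  case 0
  then show ?case by (simp add: sphere_area_def)
next
  case 1
  have "(LINT d|sphere_measure. (- d)$3) = (LINT d|sphere_measure. d$3)"
    by (rule sphere_integral_rotate[where T=uminus])
       (auto simp: orthogonal_transformation linear_iff intro!: continuous_intros)
  then show ?case using integral_monomial_symmetric[of 1] by simp
next
  case (ge2 j)
  have "real (j + 3) * (LINT d|sphere_measure. d$3 ^ (j + 2))
     = real (j + 1) * (sphere_area / 2 * ((1 - (-1) ^ Suc j) / real (j + 1)))"
    unfolding sphere_moment_recursion ge2(1) integral_monomial_symmetric by simp
  also have "\<dots> = sphere_area / 2 * (1 - (-1) ^ Suc j)"
  proof -
    have "x * (c * (z / x)) = c * z" if "x \<noteq> 0" for x c z :: real using that by simp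
    then show ?thesis by (metis of_nat_neq_0 Suc_eq_plus1)
  qed
  finally have "(LINT d|sphere_measure. d$3 ^ (j + 2)) = sphere_area / 2 * (1 - (-1) ^ Suc j) / real (j + 3)"
    by (simp add: nonzero_eq_divide_eq mult.commute del: of_nat_add)
  then show ?case
    unfolding integral_monomial_symmetric by simp
qed

lemma integrable_on_continuous_interval:
  fixes f :: "real \<Rightarrow> 'a :: banach"
  shows "continuous_on {a..b} f \<Longrightarrow> f integrable_on {a..b}"
  using integrable_continuous_real by blast

text \<open>From polynomials to continuous functions by the Weierstrass approximation theorem.\<close>

lemma sphere_integral_third_coordinate_real:
  fixes f :: "real \<Rightarrow> real"
  assumes f: "continuous_on {-1..1} f"
  shows "(LINT d|sphere_measure. f (d$3)) = sphere_area / 2 * integral {-1..1} f"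
proof -
  let ?E = "\<lambda>g. (LINT d|sphere_measure. g (d$3)) - sphere_area / 2 * integral {-1..1} g"
  have area: "sphere_area \<ge> 0" by (simp add: sphere_area_def)
  have cmp: "\<bar>(d :: real^3)$3\<bar> \<le> 1" if "norm d = 1" for d
    using component_le_norm_cart[of d 3] that by simp
  have cs: "continuous_on (sphere 0 1) (\<lambda>d :: real^3. g (d$3))" if "continuous_on {-1..1} g" for g :: "real \<Rightarrow> real"
    by (rule continuous_on_compose2[OF that]) (use cmp in \<open>auto intro!: continuous_intros simp: abs_le_iff\<close>)
  have small: "\<bar>?E f\<bar> \<le> 2 * sphere_area * e" if e: "e > 0" for e
  proof -
    obtain p where p: "real_polynomial_function p" and fp: "\<And>x. x \<in> {-1..1} \<Longrightarrow> \<bar>f x - p x\<bar> < e"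
      using Stone_Weierstrass_real_polynomial_function[OF compact_Icc f e] by blast
    from p obtain c n where pc: "p = (\<lambda>x. \<Sum>i\<le>n. c i * x ^ i)"
      unfolding real_polynomial_function_iff_sum by blast
    have cp: "continuous_on {-1..1} p" unfolding pc by (intro continuous_intros)
    have "?E p = 0"
    proof -
      have "(LINT d|sphere_measure. p (d$3)) = (\<Sum>i\<le>n. c i * (LINT d|sphere_measure. d$3 ^ i))"
        unfolding pc
        by (subst Bochner_Integration.integral_sum) (auto intro!: integrable_sphere continuous_intros)
      also have "\<dots> = sphere_area / 2 * (\<Sum>i\<le>n. c i * integral {-1..1} (\<lambda>t. t ^ i))"
        unfolding sphere_moment sum_distrib_left by (intro sum.cong) auto
      also have "(\<Sum>i\<le>n. c i * integral {-1..1} (\<lambda>t. t ^ i)) = integral {-1..1} p"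
        unfolding pc
        by (subst integral_sum) (auto intro!: integrable_on_continuous_interval continuous_intros)
      finally show ?thesis by simp
    qed
    then have "?E f = (LINT d|sphere_measure. f (d$3) - p (d$3)) - sphere_area / 2 * integral {-1..1} (\<lambda>x. f x - p x)"
      by (subst Bochner_Integration.integral_diff Henstock_Kurzweil_Integration.integral_diff
            | intro integrable_sphere cs f cp integrable_on_continuous_interval)+
         (simp add: algebra_simps)
    moreover have "\<bar>LINT d|sphere_measure. f (d$3) - p (d$3)\<bar> \<le> sphere_area * e"
    proof -
      have "norm (LINT d|sphere_measure. f (d$3) - p (d$3)) \<le> (LINT d|sphere_measure. e)"
      proof (rule Bochner_Integration.integral_norm_bound_integral)
        show "integrable sphere_measure (\<lambda>d. f (d$3) - p (d$3))"
          by (intro Bochner_Integration.integrable_diff integrable_sphere cs f cp)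
        show "integrable sphere_measure (\<lambda>d. e)" by (intro integrable_sphere continuous_intros)
        fix d assume "d \<in> space sphere_measure"
        then show "norm (f (d$3) - p (d$3)) \<le> e"
          using fp[of "d$3"] cmp[of d] by (auto simp: abs_le_iff)
      qed
      then show ?thesis by (simp add: sphere_area_def)
    qed
    moreover have "\<bar>sphere_area / 2 * integral {-1..1} (\<lambda>x. f x - p x)\<bar> \<le> sphere_area * e"
    proof -
      have "norm (integral {-1..1} (\<lambda>x. f x - p x)) \<le> integral {-1..1} (\<lambda>x :: real. e)"
        by (rule Henstock_Kurzweil_Integration.integral_norm_bound_integral)
           (use fp in \<open>auto intro!: integrable_on_continuous_interval continuous_intros f cp less_imp_le\<close>)
      then have "\<bar>integral {-1..1} (\<lambda>x. f x - p x)\<bar> \<le> 2 * e" by simp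
      from mult_left_mono[OF this, of "sphere_area / 2"] show ?thesis
        using area by (simp add: abs_mult)
    qed
    ultimately show ?thesis by linarith
  qed
  have "\<bar>?E f\<bar> \<le> 0"
  proof (rule field_le_epsilon)
    fix e :: real assume "e > 0"
    then have "\<bar>?E f\<bar> \<le> 2 * sphere_area * (e / (2 * sphere_area + 1))"
      using area by (intro small) (auto intro!: divide_pos_pos)
    also have "\<dots> \<le> e" using area \<open>e > 0\<close> by (simp add: field_simps)
    finally show "\<bar>?E f\<bar> \<le> 0 + e" by simp
  qed
  then show ?thesis by simp
qed

text \<open>Archimedes' hat-box theorem: \<open>d \<bullet> y\<close> is uniformly distributed on \<open>[-|y|, |y|]\<close>. A rotation moves
  \<open>y\<close> onto the third axis.\<close>

lemma sphere_integral_zonal: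
  fixes f :: "real \<Rightarrow> complex" and y :: "real^3"
  assumes f: "continuous_on {- norm y..norm y} f"
  shows "(LINT d|sphere_measure. f (d \<bullet> y)) = of_real (sphere_area / 2) * integral {-1..1} (\<lambda>t. f (norm y * t))"
proof -
  let ?g = "\<lambda>t. f (norm y * t)"
  have g: "continuous_on {-1..1} ?g"
  proof (rule continuous_on_compose2[OF f])
    show "(\<lambda>t. norm y * t) ` {-1..1} \<subseteq> {- norm y..norm y}"
      using mult_left_le[of _ "norm y"] mult_left_mono[of "-1" _ "norm y"] by auto
  qed (intro continuous_intros)
  have cmp: "\<bar>(d :: real^3)$3\<bar> \<le> 1" if "norm d = 1" for d
    using component_le_norm_cart[of d 3] that by simp
  have cs: "continuous_on (sphere 0 1) (\<lambda>d :: real^3. ?g (d$3))"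
    by (rule continuous_on_compose2[OF g]) (use cmp in \<open>auto intro!: continuous_intros simp: abs_le_iff\<close>)
  obtain T :: "real^3 \<Rightarrow> real^3" where T: "orthogonal_transformation T" "T (norm y *\<^sub>R axis 3 1) = y"
    using orthogonal_transformation_exists[of "norm y *\<^sub>R axis 3 1" y] by auto
  have Ty: "T d \<bullet> y = norm y * d$3" for d
  proof -
    have "T d \<bullet> y = T d \<bullet> T (norm y *\<^sub>R axis 3 1)" using T by simp
    also have "\<dots> = d \<bullet> (norm y *\<^sub>R axis 3 1)"
      using T(1) by (simp add: orthogonal_transformation_def)
    finally show ?thesis by (simp add: inner_axis)
  qed
  have "(LINT d|sphere_measure. f (d \<bullet> y)) = (LINT d|sphere_measure. f (T d \<bullet> y))"
  proof (rule sphere_integral_rotate[OF T(1), symmetric])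
    show "continuous_on (sphere 0 1) (\<lambda>d. f (d \<bullet> y))"
    proof (rule continuous_on_compose2[OF f])
      show "(\<lambda>d. d \<bullet> y) ` sphere 0 1 \<subseteq> {- norm y..norm y}"
      proof safe
        fix d :: "real^3" assume "d \<in> sphere 0 1"
        then have "\<bar>d \<bullet> y\<bar> \<le> norm y" using Cauchy_Schwarz_ineq2[of d y] by simp
        then show "d \<bullet> y \<in> {- norm y..norm y}" by (auto simp: abs_le_iff)
      qed
    qed (intro continuous_intros)
  qed
  also have "\<dots> = (LINT d|sphere_measure. ?g (d$3))" by (simp add: Ty)
  also have "\<dots> = of_real (sphere_area / 2) * integral {-1..1} ?g"
  proof (rule complex_eqI)
    have i: "?g integrable_on {-1..1}" by (rule integrable_on_continuous_interval[OF g])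
    have "Re (LINT d|sphere_measure. ?g (d$3)) = (LINT d|sphere_measure. Re (?g (d$3)))"
      using integrable_sphere[OF cs] by simp
    also have "\<dots> = sphere_area / 2 * integral {-1..1} (\<lambda>t. Re (?g t))"
      by (rule sphere_integral_third_coordinate_real) (intro continuous_intros g)
    also have "integral {-1..1} (\<lambda>t. Re (?g t)) = Re (integral {-1..1} ?g)"
      using integral_linear[OF i bounded_linear_Re] by (simp add: o_def)
    finally show "Re (LINT d|sphere_measure. ?g (d$3)) = Re (of_real (sphere_area / 2) * integral {-1..1} ?g)"
      by simp
    have "Im (LINT d|sphere_measure. ?g (d$3)) = (LINT d|sphere_measure. Im (?g (d$3)))"
      using integrable_sphere[OF cs] by simp
    also have "\<dots> = sphere_area / 2 * integral {-1..1} (\<lambda>t. Im (?g t))"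
      by (rule sphere_integral_third_coordinate_real) (intro continuous_intros g)
    also have "integral {-1..1} (\<lambda>t. Im (?g t)) = Im (integral {-1..1} ?g)"
      using integral_linear[OF i bounded_linear_Im] by (simp add: o_def)
    finally show "Im (LINT d|sphere_measure. ?g (d$3)) = Im (of_real (sphere_area / 2) * integral {-1..1} ?g)"
      by simp
  qed
  finally show ?thesis .
qed

section \<open>A Funk--Hecke formula for powers of null forms\<close>

lemma has_vector_derivative_chain_real:
  fixes g :: "real \<Rightarrow> 'a :: real_normed_vector"
  assumes "(f has_real_derivative f') (at x within S)" "(g has_vector_derivative g') (at (f x))"
  shows "((\<lambda>x. g (f x)) has_vector_derivative f' *\<^sub>R g') (at x within S)"
  using vector_diff_chain_within[of f f' x S g g'] assms
  by (simp add: o_def has_real_derivative_iff_has_vector_derivative has_vector_derivative_at_within)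

text \<open>For \<open>|a| = |b|\<close> and \<open>a \<bullet> b = 0\<close> this is \<open>y \<mapsto> \<zeta> \<cdot> y\<close> with \<open>\<zeta> = a + ib\<close> and \<open>\<zeta> \<cdot> \<zeta> = 0\<close>. The powers of such
  forms are the harmonic polynomials from which all spherical harmonics are generated.\<close>

definition null_form :: "real^3 \<Rightarrow> real^3 \<Rightarrow> real^3 \<Rightarrow> complex" where
  "null_form a b y = Complex (a \<bullet> y) (b \<bullet> y)"

lemma null_form_linear: "null_form a b (x + \<tau> *\<^sub>R y) = null_form a b x + of_real \<tau> * null_form a b y"
  by (simp add: null_form_def complex_eq_iff inner_add_right)

lemma continuous_on_null_form [continuous_intros]:
  "continuous_on S f \<Longrightarrow> continuous_on S (\<lambda>x. null_form a b (f x))"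
  unfolding null_form_def by (intro continuous_intros)

text \<open>Integration by parts against \<open>d/dt (1 - t\<^sup>2)\<^bsup>n+1\<^esup>\<close>, which raises the weight by one in the induction
  for the Funk--Hecke formula; the boundary terms vanish.\<close>

lemma weighted_integral_by_parts:
  fixes K K' :: "real \<Rightarrow> complex"
  assumes K: "\<And>s. \<bar>s\<bar> \<le> \<bar>r\<bar> \<Longrightarrow> (K has_vector_derivative K' s) (at s)"
    and K': "continuous_on {- \<bar>r\<bar>..\<bar>r\<bar>} K'"
  shows "of_real (2 * real (Suc n)) * integral {-1..1} (\<lambda>t. of_real ((1 - t\<^sup>2) ^ n) * of_real t * K (r * t))
       = of_real r * integral {-1..1} (\<lambda>t. of_real ((1 - t\<^sup>2) ^ Suc n) * K' (r * t))"
proof -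
  have rt: "\<bar>r * t\<bar> \<le> \<bar>r\<bar>" if "t \<in> {-1..1}" for t
    using that by (auto simp: abs_mult abs_le_iff intro!: mult_left_le)
  have cK: "continuous_on {- \<bar>r\<bar>..\<bar>r\<bar>} K"
    by (rule continuous_on_vector_derivative, rule has_vector_derivative_at_within, rule K) auto
  have c: "continuous_on {-1..1} (\<lambda>t. K (r * t))" "continuous_on {-1..1} (\<lambda>t. K' (r * t))"
    by (rule continuous_on_compose2[OF cK] continuous_on_compose2[OF K'],
        use rt in \<open>force intro!: continuous_intros simp: abs_le_iff\<close>,
        use rt in \<open>force intro!: continuous_intros simp: abs_le_iff\<close>)+
  let ?G = "\<lambda>t. of_real ((1 - t\<^sup>2) ^ Suc n) * K (r * t)"
  let ?u = "\<lambda>t. of_real (2 * real (Suc n)) * (of_real ((1 - t\<^sup>2) ^ n) * of_real t * K (r * t))"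
  let ?v = "\<lambda>t. of_real r * (of_real ((1 - t\<^sup>2) ^ Suc n) * K' (r * t))"
  have "((\<lambda>t. ?v t - ?u t) has_integral (?G 1 - ?G (-1))) {-1..1}"
  proof (rule fundamental_theorem_of_calculus)
    fix t :: real assume t: "t \<in> {-1..1}"
    have 1: "((\<lambda>t. K (r * t)) has_vector_derivative r *\<^sub>R K' (r * t)) (at t within {-1..1})"
      using vector_diff_chain_within[of "\<lambda>t. r * t" r t "{-1..1}" K "K' (r * t)"] K[OF rt[OF t]]
      by (auto simp: o_def has_vector_derivative_at_within
          intro!: derivative_eq_intros simp flip: has_real_derivative_iff_has_vector_derivative)
    have "((\<lambda>t. (1 - t\<^sup>2) ^ Suc n) has_real_derivative - (2 * real (Suc n) * (1 - t\<^sup>2) ^ n * t)) (at t within {-1..1})"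
      by (rule derivative_eq_intros refl | simp add: algebra_simps)+
    then have "((\<lambda>t. complex_of_real ((1 - t\<^sup>2) ^ Suc n)) has_vector_derivative
        of_real (- (2 * real (Suc n) * (1 - t\<^sup>2) ^ n * t))) (at t within {-1..1})"
      by (intro has_vector_derivative_of_real) (simp add: has_real_derivative_iff_has_vector_derivative)
    from has_vector_derivative_mult[OF this 1]
    show "(?G has_vector_derivative (?v t - ?u t)) (at t within {-1..1})"
      by (simp add: scaleR_conv_of_real algebra_simps)
  qed simp
  then have "integral {-1..1} (\<lambda>t. ?v t - ?u t) = 0" by (simp add: integral_unique)
  also have "integral {-1..1} (\<lambda>t. ?v t - ?u t) = integral {-1..1} ?v - integral {-1..1} ?u"
    by (intro Henstock_Kurzweil_Integration.integral_diff integrable_on_continuous_interval continuous_intros c)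
  finally show ?thesis by simp
qed

lemma leibniz_symmetric:
  fixes \<Phi> \<Phi>' :: "real \<Rightarrow> real \<Rightarrow> complex"
  assumes d: "\<And>r t. \<bar>r\<bar> < \<rho> \<Longrightarrow> \<bar>t\<bar> \<le> 1 \<Longrightarrow> ((\<lambda>r. \<Phi> r t) has_vector_derivative \<Phi>' r t) (at r)"
    and c: "continuous_on ({- \<rho><..<\<rho>} \<times> {-1..1}) (\<lambda>(r, t). \<Phi> r t)"
    and c': "continuous_on ({- \<rho><..<\<rho>} \<times> {-1..1}) (\<lambda>(r, t). \<Phi>' r t)"
    and r: "\<bar>r\<bar> < \<rho>"
  shows "((\<lambda>r. integral {-1..1} (\<Phi> r)) has_vector_derivative integral {-1..1} (\<Phi>' r)) (at r)"
proof -
  let ?U = "{- \<rho><..<\<rho>}"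
  have "((\<lambda>r. integral (cbox (-1) 1) (\<Phi> r)) has_vector_derivative integral (cbox (-1) 1) (\<Phi>' r)) (at r within ?U)"
  proof (rule leibniz_rule_vector_derivative)
    fix x t :: real assume "x \<in> ?U" "t \<in> cbox (-1) 1"
    then show "((\<lambda>x. \<Phi> x t) has_vector_derivative \<Phi>' x t) (at x within ?U)"
      by (intro has_vector_derivative_at_within[OF d]) auto
  next
    fix x assume "x \<in> ?U"
    then have "continuous_on {-1..1} (\<lambda>t. case (x, t) of (r, t) \<Rightarrow> \<Phi> r t)"
      by (intro continuous_on_compose2[OF c]) (auto intro!: continuous_intros)
    then show "\<Phi> x integrable_on cbox (-1) 1"
      by (auto intro: integrable_on_continuous_interval)
  qed (use c' r in auto)
  moreover have "r \<in> ?U" "open ?U" using r by auto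
  moreover from this have "at r within ?U = at r" by (rule at_within_open)
  ultimately show ?thesis by (simp only: box_real)
qed

lemma integral_scaled_derivative:
  fixes K K' :: "real \<Rightarrow> complex"
  assumes K: "\<And>s. \<bar>s\<bar> < B \<Longrightarrow> (K has_vector_derivative K' s) (at s)"
    and K': "continuous_on {- B<..<B} K'" and w: "continuous_on {-1..1} w" and r: "\<bar>r\<bar> < B"
  shows "((\<lambda>r. integral {-1..1} (\<lambda>t. w t * K (r * t))) has_vector_derivative
          integral {-1..1} (\<lambda>t. w t * (of_real t * K' (r * t)))) (at r)"
proof -
  have rt: "\<bar>r * t\<bar> < B" if "\<bar>t\<bar> \<le> 1" "\<bar>r\<bar> < B" for r t :: real
  proof -
    have "\<bar>r * t\<bar> \<le> \<bar>r\<bar> * 1" unfolding abs_mult using that by (intro mult_left_mono) auto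
    then show ?thesis using that by simp
  qed
  have cK: "continuous_on {- B<..<B} K"
    by (rule continuous_on_vector_derivative, rule has_vector_derivative_at_within, rule K) auto
  have cc: "continuous_on ({- B<..<B} \<times> {-1..1}) (\<lambda>p. L (fst p * snd p))" if "continuous_on {- B<..<B} L" for L :: "real \<Rightarrow> complex"
  proof (rule continuous_on_compose2[OF that])
    show "(\<lambda>p. fst p * snd p) ` ({- B<..<B} \<times> {-1..1}) \<subseteq> {- B<..<B}"
    proof safe
      fix x t :: real assume "x \<in> {- B<..<B}" "t \<in> {-1..1}"
      then have "\<bar>x * t\<bar> < B" by (intro rt) auto
      then show "fst (x, t) * snd (x, t) \<in> {- B<..<B}" by (auto simp: abs_less_iff)
    qed
  qed (intro continuous_intros)
  have cw: "continuous_on ({- B<..<B} \<times> {-1..1}) (\<lambda>p. w (snd p))"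
    by (rule continuous_on_compose2[OF w]) (auto intro!: continuous_intros)
  show ?thesis
  proof (rule leibniz_symmetric[OF _ _ _ r])
    fix x t :: real assume "\<bar>x\<bar> < B" "\<bar>t\<bar> \<le> 1"
    then have "((\<lambda>x. K (x * t)) has_vector_derivative t *\<^sub>R K' (x * t)) (at x)"
      by (intro has_vector_derivative_chain_real[where f="\<lambda>x. x * t"] K rt) (auto intro!: derivative_eq_intros)
    from has_vector_derivative_mult[OF has_vector_derivative_const this, of "w t"]
    show "((\<lambda>x. w t * K (x * t)) has_vector_derivative w t * (of_real t * K' (x * t))) (at x)"
      by (simp add: scaleR_conv_of_real)
  qed (unfold split_beta, (intro continuous_intros cw cc cK K')+)
qed

definition funk_hecke_const :: "nat \<Rightarrow> real" where
  "funk_hecke_const n = sphere_area / (2 ^ Suc n * fact n)"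

text \<open>The derivative of \<open>\<zeta> \<cdot> y\<close> in the complex direction \<open>\<zeta>\<close> is \<open>\<zeta> \<cdot> \<zeta> = 0\<close>.\<close>

lemma null_form_derivative_balance:
  assumes "a \<bullet> a = b \<bullet> b" "a \<bullet> b = 0"
  shows "null_form a b a + \<i> * null_form a b b = 0"
  using assms by (simp add: null_form_def complex_eq_iff inner_commute)

lemma has_vector_derivative_norm_line:
  fixes y u :: "real^3"
  assumes "y \<noteq> 0"
  shows "((\<lambda>\<tau>. norm (y + \<tau> *\<^sub>R u)) has_vector_derivative (u \<bullet> y) / norm y) (at 0)"
proof -
  have "((\<lambda>\<tau>. norm (y + \<tau> *\<^sub>R u)) has_derivative (\<lambda>\<tau>. (\<tau> *\<^sub>R u) \<bullet> sgn (y + 0 *\<^sub>R u))) (at 0)"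
    by (rule has_derivative_compose[of "\<lambda>\<tau>. y + \<tau> *\<^sub>R u" "\<lambda>\<tau>. \<tau> *\<^sub>R u" 0 UNIV norm])
       (use assms in \<open>auto intro!: derivative_eq_intros has_derivative_norm\<close>)
  then show ?thesis
    by (simp add: has_vector_derivative_def sgn_div_norm divide_inverse_commute mult_ac)
qed

text \<open>Induction on \<open>n\<close>. For \<open>n = 0\<close> this is the hat-box theorem. For the step, apply the formula to an
  antiderivative of \<open>F 0\<close> and differentiate both sides in \<open>y\<close> along \<open>a\<close> and along \<open>b\<close>, that is, in the
  complex direction \<open>\<zeta> = a + ib\<close>. On the left this produces one more factor \<open>\<zeta> \<cdot> d\<close>. On the right
  \<open>\<zeta> \<cdot> y\<close> behaves as a constant, while the radial factor contributes \<open>(\<zeta> \<cdot> y)/|y|\<close> times its radial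
  derivative.\<close>

theorem funk_hecke_null:
  fixes F :: "nat \<Rightarrow> real \<Rightarrow> complex" and a b y :: "real^3"
  assumes null: "a \<bullet> a = b \<bullet> b" "a \<bullet> b = 0"
    and "norm y < B" "y \<noteq> 0"
    and "\<And>i s. \<bar>s\<bar> < B \<Longrightarrow> (F i has_vector_derivative F (Suc i) s) (at s)"
  shows "(LINT d|sphere_measure. F 0 (d \<bullet> y) * null_form a b d ^ n) =
    of_real (funk_hecke_const n) * null_form a b y ^ n *
    integral {-1..1} (\<lambda>t. of_real ((1 - t\<^sup>2) ^ n) * F n (norm y * t))"
  using assms(3-5)
proof (induction n arbitrary: F B y)
  case 0
  have "continuous_on {- norm y..norm y} (F 0)"
    by (rule continuous_on_vector_derivative, rule has_vector_derivative_at_within, rule "0.prems"(3))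
       (use 0 in auto)
  then show ?case
    using sphere_integral_zonal[of y "F 0"] by (simp add: funk_hecke_const_def)
next
  case (Suc n F B y)
  let ?l = "null_form a b"
  \<comment> \<open>The antiderivative is taken on a smaller closed interval, where it exists by continuity.\<close>
  define B' where "B' = (norm y + B) / 2"
  have B': "norm y < B'" "B' < B" "B' > 0"
    using Suc.prems(1) norm_ge_zero[of y] unfolding B'_def by (simp_all add: field_simps, linarith)
  have F: "(F i has_vector_derivative F (Suc i) s) (at s)" if "\<bar>s\<bar> < B" for i s
    using Suc.prems(3) that .
  have cF: "continuous_on {- B<..<B} (F i)" for i
    by (rule continuous_on_vector_derivative, rule has_vector_derivative_at_within, rule F) auto
  have "continuous_on {- B'..B'} (F 0)"
    by (rule continuous_on_subset[OF cF]) (use B' in auto)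
  from antiderivative_continuous[OF this] obtain g where
    g0: "\<And>x. x \<in> {- B'..B'} \<Longrightarrow> (g has_vector_derivative F 0 x) (at x within {- B'..B'})"
    by blast
  have g: "(g has_vector_derivative F 0 x) (at x)" if "\<bar>x\<bar> < B'" for x
    using g0[of x] that at_within_Icc_at[of "- B'" x B'] by (auto simp: abs_less_iff)
  have cg: "continuous_on {- B'<..<B'} g"
    by (rule continuous_on_vector_derivative, rule has_vector_derivative_at_within, rule g) auto
  define G where "G = case_nat g F"
  have G: "(G i has_vector_derivative G (Suc i) s) (at s)" if "\<bar>s\<bar> < B'" for i s
    using that g F[of s] B' by (cases i) (auto simp: G_def)
  define I where "I r = integral {-1..1} (\<lambda>t. of_real ((1 - t\<^sup>2) ^ n) * G n (r * t))" for r
  define I' where "I' r = integral {-1..1} (\<lambda>t. of_real ((1 - t\<^sup>2) ^ n) * (of_real t * F n (r * t)))" for r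
  have IH: "(LINT d|sphere_measure. g (d \<bullet> x) * ?l d ^ n) = of_real (funk_hecke_const n) * ?l x ^ n * I (norm x)"
    if "norm x < B'" "x \<noteq> 0" for x
    using Suc.IH[of x B' G] that G by (simp add: G_def I_def)
  have dI: "(I has_vector_derivative I' r) (at r)" if "\<bar>r\<bar> < B'" for r
    unfolding I_def I'_def
    by (rule integral_scaled_derivative[where B=B'])
       (use G[of _ n] that B' in \<open>auto simp: G_def intro!: continuous_intros continuous_on_subset[OF cF]\<close>)
  have dir: "(LINT d|sphere_measure. of_real (d \<bullet> u) * (F 0 (d \<bullet> y) * ?l d ^ n)) =
     of_real (funk_hecke_const n) * (of_nat n * ?l y ^ (n - 1) * ?l u * I (norm y)
       + ?l y ^ n * (of_real ((u \<bullet> y) / norm y) * I' (norm y)))" for u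
  proof -
    \<comment> \<open>Steps below this size keep the point inside the ball and away from the origin, where the norm is not differentiable.\<close>
    define e where "e = min (B' - norm y) (norm y) / (norm u + 1)"
    have e: "e > 0" using B' Suc.prems norm_ge_zero[of u] unfolding e_def
      by (intro divide_pos_pos) (auto intro: add_nonneg_pos)
    have eu: "\<bar>\<tau>\<bar> * norm u < B' - norm y" "\<bar>\<tau>\<bar> * norm u < norm y" if "\<bar>\<tau>\<bar> < e" for \<tau>
    proof -
      have "\<bar>\<tau>\<bar> * norm u \<le> \<bar>\<tau>\<bar> * (norm u + 1)" by (intro mult_left_mono) auto
      also have "\<dots> < e * (norm u + 1)"
        using that norm_ge_zero[of u] by (intro mult_strict_right_mono) (auto intro: add_nonneg_pos)
      also have "\<dots> = min (B' - norm y) (norm y)"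
        using norm_ge_zero[of u] unfolding e_def by (simp add: add_nonneg_eq_0_iff)
      finally show "\<bar>\<tau>\<bar> * norm u < B' - norm y" "\<bar>\<tau>\<bar> * norm u < norm y" by auto
    qed
    have ny: "norm (y + \<tau> *\<^sub>R u) < B'" "y + \<tau> *\<^sub>R u \<noteq> 0" if "\<bar>\<tau>\<bar> < e" for \<tau>
    proof -
      show "norm (y + \<tau> *\<^sub>R u) < B'"
        using norm_triangle_ineq[of y "\<tau> *\<^sub>R u"] eu[OF that] by simp
      show "y + \<tau> *\<^sub>R u \<noteq> 0"
      proof
        assume "y + \<tau> *\<^sub>R u = 0"
        then have "norm y = norm (\<tau> *\<^sub>R u)" by (metis add_eq_0_iff norm_minus_cancel)
        then show False using eu(2)[OF that] by simp
      qed
    qed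
    have dy: "\<bar>d \<bullet> (y + \<tau> *\<^sub>R u)\<bar> < B'" if "\<bar>\<tau>\<bar> < e" "norm d = 1" for \<tau> d
      using Cauchy_Schwarz_ineq2[of d "y + \<tau> *\<^sub>R u"] ny(1)[OF that(1)] that(2) by simp
    let ?y = "\<lambda>\<tau>. y + \<tau> *\<^sub>R u"
    let ?L = "\<lambda>\<tau>. LINT d|sphere_measure. g (d \<bullet> (?y \<tau>)) * ?l d ^ n"
    let ?R = "\<lambda>\<tau>. of_real (funk_hecke_const n) * (?l (?y \<tau>) ^ n * I (norm (?y \<tau>)))"
    have dL: "(?L has_vector_derivative
       (LINT d|sphere_measure. of_real (d \<bullet> u) * F 0 (d \<bullet> (y + 0 *\<^sub>R u)) * ?l d ^ n)) (at 0)"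
    proof (rule sphere_integral_leibniz[OF e])
      fix \<tau> :: real and d :: "real^3" assume \<tau>: "\<bar>\<tau> - 0\<bar> < e" and d: "norm d = 1"
      have "((\<lambda>\<tau>. g (d \<bullet> (?y \<tau>))) has_vector_derivative (d \<bullet> u) *\<^sub>R F 0 (d \<bullet> (?y \<tau>))) (at \<tau>)"
        by (rule has_vector_derivative_chain_real[where f="\<lambda>\<tau>. d \<bullet> (?y \<tau>)"])
           (use g[OF dy[of \<tau> d]] \<tau> d in \<open>auto simp: inner_add_right intro!: derivative_eq_intros\<close>)
      from has_vector_derivative_mult[OF this has_vector_derivative_const, of "?l d ^ n"]
      show "((\<lambda>\<tau>. g (d \<bullet> (?y \<tau>)) * ?l d ^ n) has_vector_derivative
         of_real (d \<bullet> u) * F 0 (d \<bullet> (?y \<tau>)) * ?l d ^ n) (at \<tau>)"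
        by (simp add: scaleR_conv_of_real)
    next
      fix \<tau> :: real assume \<tau>: "\<bar>\<tau> - 0\<bar> < e"
      have "continuous_on (sphere 0 1) (\<lambda>d. g (d \<bullet> (?y \<tau>)))"
        by (rule continuous_on_compose2[OF cg])
           (use dy \<tau> in \<open>force intro!: continuous_intros simp: abs_less_iff\<close>)+
      then show "continuous_on (sphere 0 1) (\<lambda>d. g (d \<bullet> (?y \<tau>)) * ?l d ^ n)"
        by (intro continuous_intros)
    next
      have "continuous_on ({0 - e<..<0 + e} \<times> sphere 0 1) (\<lambda>p. F 0 (snd p \<bullet> (y + fst p *\<^sub>R u)))"
      proof (rule continuous_on_compose2[OF cF])
        show "(\<lambda>p. snd p \<bullet> (y + fst p *\<^sub>R u)) ` ({0 - e<..<0 + e} \<times> sphere 0 1) \<subseteq> {- B<..<B}"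
        proof safe
          fix \<tau> :: real and d :: "real^3" assume "\<tau> \<in> {0 - e<..<0 + e}" "d \<in> sphere 0 1"
          then have "\<bar>d \<bullet> (?y \<tau>)\<bar> < B'" by (intro dy) auto
          then show "snd (\<tau>, d) \<bullet> (y + fst (\<tau>, d) *\<^sub>R u) \<in> {- B<..<B}"
            using B' by (auto simp: abs_less_iff)
        qed
      qed (intro continuous_intros)
      then show "continuous_on ({0 - e<..<0 + e} \<times> sphere 0 1)
          (\<lambda>(\<tau>, d). of_real (d \<bullet> u) * F 0 (d \<bullet> (?y \<tau>)) * ?l d ^ n)"
        unfolding split_beta by (intro continuous_intros)
    qed
    have dl: "((\<lambda>\<tau>. ?l (?y \<tau>) ^ n) has_vector_derivative (of_nat n * ?l y ^ (n - 1) * ?l u)) (at 0)"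
    proof -
      have "((\<lambda>z. (?l y + z * ?l u) ^ n) has_field_derivative (of_nat n * ?l y ^ (n - 1) * ?l u)) (at (of_real 0))"
        by (rule derivative_eq_intros refl | simp)+
      from has_vector_derivative_real_field[OF this]
      show ?thesis by (simp add: null_form_linear)
    qed
    have dIn: "((\<lambda>\<tau>. I (norm (?y \<tau>))) has_vector_derivative ((u \<bullet> y) / norm y) *\<^sub>R I' (norm y)) (at 0)"
      using vector_diff_chain_at[OF has_vector_derivative_norm_line[OF Suc.prems(2), of u], of I "I' (norm y)"] dI[of "norm y"] B'
      by (simp add: o_def)
    have dR: "(?R has_vector_derivative of_real (funk_hecke_const n) * (?l (y + 0 *\<^sub>R u) ^ n * (((u \<bullet> y) / norm y) *\<^sub>R I' (norm y)) +
           (of_nat n * ?l y ^ (n - 1) * ?l u) * I (norm (y + 0 *\<^sub>R u)))) (at 0)"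
      by (rule has_vector_derivative_mult_right[OF has_vector_derivative_mult[OF dl dIn]])
    have "(?L has_vector_derivative of_real (funk_hecke_const n) * (?l (y + 0 *\<^sub>R u) ^ n * (((u \<bullet> y) / norm y) *\<^sub>R I' (norm y)) +
           (of_nat n * ?l y ^ (n - 1) * ?l u) * I (norm (y + 0 *\<^sub>R u)))) (at 0)"
    proof (rule has_vector_derivative_transform_within_open[OF dR, of "{- e<..<e}"])
      fix \<tau> assume "\<tau> \<in> {- e<..<e}"
      then have "\<bar>\<tau>\<bar> < e" by auto
      from IH[OF ny[OF this]] show "?R \<tau> = ?L \<tau>" by (simp add: mult.assoc)
    qed (use e in auto)
    from vector_derivative_unique_at[OF dL this] show ?thesis
      by (simp add: mult.assoc scaleR_conv_of_real add.commute)
  qed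
  have cI: "continuous_on (sphere 0 1) (\<lambda>d. of_real (d \<bullet> u) * (F 0 (d \<bullet> y) * ?l d ^ n))" for u
  proof -
    have "continuous_on (sphere 0 1) (\<lambda>d. F 0 (d \<bullet> y))"
    proof (rule continuous_on_compose2[OF cF])
      show "(\<lambda>d. d \<bullet> y) ` sphere 0 1 \<subseteq> {- B<..<B}"
      proof safe
        fix d :: "real^3" assume "d \<in> sphere 0 1"
        then have "\<bar>d \<bullet> y\<bar> < B"
          using Cauchy_Schwarz_ineq2[of d y] Suc.prems(1) by simp
        then show "d \<bullet> y \<in> {- B<..<B}" by (auto simp: abs_less_iff)
      qed
    qed (intro continuous_intros)
    then show ?thesis by (intro continuous_intros)
  qed
  have "(LINT d|sphere_measure. F 0 (d \<bullet> y) * ?l d ^ Suc n) =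
     (LINT d|sphere_measure. of_real (d \<bullet> a) * (F 0 (d \<bullet> y) * ?l d ^ n) + \<i> * (of_real (d \<bullet> b) * (F 0 (d \<bullet> y) * ?l d ^ n)))"
    by (rule Bochner_Integration.integral_cong)
       (auto simp: null_form_def complex_eq_iff inner_commute algebra_simps)
  also have "\<dots> = (LINT d|sphere_measure. of_real (d \<bullet> a) * (F 0 (d \<bullet> y) * ?l d ^ n))
     + \<i> * (LINT d|sphere_measure. of_real (d \<bullet> b) * (F 0 (d \<bullet> y) * ?l d ^ n))"
    by (subst Bochner_Integration.integral_add)
       (auto intro!: integrable_sphere cI Bochner_Integration.integrable_mult_right)
  also have "\<dots> = of_real (funk_hecke_const n) * (of_nat n * ?l y ^ (n - 1) * I (norm y) * (?l a + \<i> * ?l b)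
       + ?l y ^ n * (of_real (a \<bullet> y) + \<i> * of_real (b \<bullet> y)) * (I' (norm y) / of_real (norm y)))"
    unfolding dir by (simp add: algebra_simps)
  also have "\<dots> = of_real (funk_hecke_const n) * ?l y ^ Suc n * (I' (norm y) / of_real (norm y))"
    unfolding null_form_derivative_balance[OF null]
    by (simp add: null_form_def Complex_eq)
  also have "I' (norm y) / of_real (norm y) = integral {-1..1} (\<lambda>t. of_real ((1 - t\<^sup>2) ^ Suc n) * F (Suc n) (norm y * t)) / of_real (2 * real (Suc n))"
  proof -
    have "of_real (2 * real (Suc n)) * I' (norm y) = of_real (norm y) * integral {-1..1} (\<lambda>t. of_real ((1 - t\<^sup>2) ^ Suc n) * F (Suc n) (norm y * t))"
    proof -
      have "continuous_on {- \<bar>norm y\<bar>..\<bar>norm y\<bar>} (F (Suc n))"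
        by (rule continuous_on_subset[OF cF]) (use Suc.prems(1) in auto)
      moreover have "(F n has_vector_derivative F (Suc n) s) (at s)" if "\<bar>s\<bar> \<le> \<bar>norm y\<bar>" for s
        using that Suc.prems(1) by (intro F) simp
      ultimately show ?thesis
        using weighted_integral_by_parts[of "norm y" "F n" "F (Suc n)" n] by (simp only: I'_def mult.assoc)
    qed
    then show ?thesis using Suc.prems(2)
      by (simp add: field_simps del: of_nat_Suc)
  qed
  also have "of_real (funk_hecke_const n) * ?l y ^ Suc n * (integral {-1..1} (\<lambda>t. of_real ((1 - t\<^sup>2) ^ Suc n) * F (Suc n) (norm y * t)) / of_real (2 * real (Suc n)))
     = of_real (funk_hecke_const (Suc n)) * ?l y ^ Suc n * integral {-1..1} (\<lambda>t. of_real ((1 - t\<^sup>2) ^ Suc n) * F (Suc n) (norm y * t))"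
    by (simp add: funk_hecke_const_def)
  finally show ?case .
qed

section \<open>The Helmholtz kernel as a function of the squared distance\<close>

text \<open>Index \<open>n\<close> is the \<open>n\<close>-th derivative of \<open>e\<^bsup>i\<kappa>\<surd>s\<^esup> / (4\<pi>\<surd>s)\<close>, the Green's function in terms of the squared
  distance. The recursion is the Helmholtz equation \<open>4s k'' + 6k' + \<kappa>\<^sup>2 k = 0\<close> differentiated \<open>n\<close> times,
  i.e. the Helmholtz equation in dimension \<open>2n + 3\<close>.\<close>

fun radial_kernel :: "real \<Rightarrow> nat \<Rightarrow> real \<Rightarrow> complex" where
  "radial_kernel \<kappa> 0 s = exp (\<i> * of_real (\<kappa> * sqrt s)) / of_real (4 * pi * sqrt s)"
| "radial_kernel \<kappa> (Suc 0) s =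
     exp (\<i> * of_real (\<kappa> * sqrt s)) * (\<i> * of_real (\<kappa> * sqrt s) - 1) / of_real (8 * pi * sqrt s ^ 3)"
| "radial_kernel \<kappa> (Suc (Suc n)) s =
     - (of_real (4 * real n + 6) * radial_kernel \<kappa> (Suc n) s + of_real (\<kappa>\<^sup>2) * radial_kernel \<kappa> n s) / of_real (4 * s)"

lemma radial_kernel_recurrence:
  "s > 0 \<Longrightarrow> of_real (4 * s) * radial_kernel \<kappa> (Suc (Suc n)) s + of_real (4 * real n + 6) * radial_kernel \<kappa> (Suc n) s
     + of_real (\<kappa>\<^sup>2) * radial_kernel \<kappa> n s = 0"
  by (simp add: field_simps)

lemma has_vector_derivative_sqrt_compose:
  fixes f :: "complex \<Rightarrow> complex"
  assumes "(f has_field_derivative f') (at (of_real (sqrt s)))" "s > 0"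
  shows "((\<lambda>s. f (of_real (sqrt s))) has_vector_derivative of_real (inverse (2 * sqrt s)) * f') (at s)"
proof -
  have "((\<lambda>w. f (of_real w)) has_vector_derivative f') (at (sqrt s))"
    using assms(1) by (rule has_vector_derivative_real_field)
  from has_vector_derivative_chain_real[where f=sqrt and g="\<lambda>w. f (of_real w)", OF DERIV_real_sqrt[OF assms(2)] this]
  show ?thesis by (simp add: scaleR_conv_of_real inverse_eq_divide mult.commute)
qed

lemma radial_kernel_derivs_complex:
  fixes w K P :: complex
  assumes w: "w \<noteq> 0" and P: "P \<noteq> 0"
  shows "((\<lambda>w. exp (\<i> * (K * w)) / (4 * P * w)) has_field_derivative
            2 * w * (exp (\<i> * (K * w)) * (\<i> * (K * w) - 1) / (8 * P * w ^ 3))) (at w)"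
    and "((\<lambda>w. exp (\<i> * (K * w)) * (\<i> * (K * w) - 1) / (8 * P * w ^ 3)) has_field_derivative
            2 * w * (exp (\<i> * (K * w)) * (3 - 3 * (\<i> * (K * w)) - K\<^sup>2 * w\<^sup>2) / (16 * P * w ^ 5))) (at w)"
    and "exp (\<i> * (K * w)) * (3 - 3 * (\<i> * (K * w)) - K\<^sup>2 * w\<^sup>2) / (16 * P * w ^ 5) =
      - (6 * (exp (\<i> * (K * w)) * (\<i> * (K * w) - 1) / (8 * P * w ^ 3)) + K\<^sup>2 * (exp (\<i> * (K * w)) / (4 * P * w))) / (4 * w\<^sup>2)"
proof -
  have 1: "((\<lambda>w. exp (\<i> * (K * w))) has_field_derivative exp (\<i> * (K * w)) * (\<i> * K)) (at w)"
    by (auto intro!: derivative_eq_intros)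
  have 2: "((\<lambda>w. \<i> * (K * w) - 1) has_field_derivative \<i> * K) (at w)"
    by (auto intro!: derivative_eq_intros)
  have 3: "((\<lambda>w. 8 * P * w ^ 3) has_field_derivative 24 * P * w\<^sup>2) (at w)"
    by (auto intro!: derivative_eq_intros)
  have 4: "((\<lambda>w. 4 * P * w) has_field_derivative 4 * P) (at w)"
    by (auto intro!: derivative_eq_intros)
  show "((\<lambda>w. exp (\<i> * (K * w)) / (4 * P * w)) has_field_derivative
            2 * w * (exp (\<i> * (K * w)) * (\<i> * (K * w) - 1) / (8 * P * w ^ 3))) (at w)"
    by (rule DERIV_cong[OF DERIV_divide[OF 1 4]])
       (use w P in \<open>simp_all add: field_simps eval_nat_numeral\<close>)
  show "((\<lambda>w. exp (\<i> * (K * w)) * (\<i> * (K * w) - 1) / (8 * P * w ^ 3)) has_field_derivative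
            2 * w * (exp (\<i> * (K * w)) * (3 - 3 * (\<i> * (K * w)) - K\<^sup>2 * w\<^sup>2) / (16 * P * w ^ 5))) (at w)"
  proof (rule DERIV_cong[OF DERIV_divide[OF DERIV_mult[OF 1 2] 3]])
    define E where "E = exp (\<i> * (K * w))"
    show "((exp (\<i> * (K * w)) * (\<i> * K) * (\<i> * (K * w) - 1) + \<i> * K * exp (\<i> * (K * w))) * (8 * P * w ^ 3)
        - exp (\<i> * (K * w)) * (\<i> * (K * w) - 1) * (24 * P * w\<^sup>2)) / (8 * P * w ^ 3 * (8 * P * w ^ 3)) =
        2 * w * (exp (\<i> * (K * w)) * (3 - 3 * (\<i> * (K * w)) - K\<^sup>2 * w\<^sup>2) / (16 * P * w ^ 5))"
      unfolding E_def[symmetric] using w P by (simp add: divide_simps) (simp add: algebra_simps eval_nat_numeral)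
  qed (use w P in simp)
  define E where "E = exp (\<i> * (K * w))"
  show "exp (\<i> * (K * w)) * (3 - 3 * (\<i> * (K * w)) - K\<^sup>2 * w\<^sup>2) / (16 * P * w ^ 5) =
      - (6 * (exp (\<i> * (K * w)) * (\<i> * (K * w) - 1) / (8 * P * w ^ 3)) + K\<^sup>2 * (exp (\<i> * (K * w)) / (4 * P * w))) / (4 * w\<^sup>2)"
    unfolding E_def[symmetric] using w P by (simp add: divide_simps) (simp add: algebra_simps eval_nat_numeral)
qed

text \<open>The first two cases are computed in the variable \<open>w = \<surd>s\<close>. Differentiating the recursion reproduces
  the recursion with \<open>n\<close> replaced by \<open>n + 1\<close>.\<close>

lemma has_vector_derivative_radial_kernel:
  assumes "s > 0"
  shows "(radial_kernel \<kappa> n has_vector_derivative radial_kernel \<kappa> (Suc n) s) (at s)"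
  using assms
proof (induction n arbitrary: s rule: induct_nat_012)
  case (0 s)
  let ?w = "complex_of_real (sqrt s)"
  have w: "?w \<noteq> 0" and p: "complex_of_real pi \<noteq> 0" using 0 by simp_all
  have k0: "radial_kernel \<kappa> 0 = (\<lambda>s. (\<lambda>w. exp (\<i> * (of_real \<kappa> * w)) / (4 * of_real pi * w)) (of_real (sqrt s)))"
    by (simp add: fun_eq_iff)
  have k1: "radial_kernel \<kappa> (Suc 0) s = exp (\<i> * (of_real \<kappa> * ?w)) * (\<i> * (of_real \<kappa> * ?w) - 1) / (8 * of_real pi * ?w ^ 3)"
    by simp
  have "(radial_kernel \<kappa> 0 has_vector_derivative of_real (inverse (2 * sqrt s)) * (2 * ?w * radial_kernel \<kappa> (Suc 0) s)) (at s)"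
    unfolding k0 k1
    by (rule has_vector_derivative_sqrt_compose[OF radial_kernel_derivs_complex(1)[OF w p, of "of_real \<kappa>"] 0])
  moreover have "of_real (inverse (2 * sqrt s)) * (2 * ?w * z) = z" for z using w by simp
  ultimately show ?case by (simp only:)
next
  case (1 s)
  let ?w = "complex_of_real (sqrt s)"
  have w: "?w \<noteq> 0" and p: "complex_of_real pi \<noteq> 0" using 1 by simp_all
  have w2: "complex_of_real (4 * s) = 4 * ?w\<^sup>2" using 1 by (simp flip: of_real_power)
  have k1: "radial_kernel \<kappa> (Suc 0) = (\<lambda>s. (\<lambda>w. exp (\<i> * (of_real \<kappa> * w)) * (\<i> * (of_real \<kappa> * w) - 1) / (8 * of_real pi * w ^ 3)) (of_real (sqrt s)))"
    by (simp add: fun_eq_iff)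
  have k2: "radial_kernel \<kappa> (Suc (Suc 0)) s = exp (\<i> * (of_real \<kappa> * ?w)) * (3 - 3 * (\<i> * (of_real \<kappa> * ?w)) - (of_real \<kappa>)\<^sup>2 * ?w\<^sup>2) / (16 * of_real pi * ?w ^ 5)"
    unfolding radial_kernel_derivs_complex(3)[OF w p] radial_kernel.simps(3) w2 by simp
  have "(radial_kernel \<kappa> (Suc 0) has_vector_derivative of_real (inverse (2 * sqrt s)) * (2 * ?w * radial_kernel \<kappa> (Suc (Suc 0)) s)) (at s)"
    unfolding k1 k2
    by (rule has_vector_derivative_sqrt_compose[OF radial_kernel_derivs_complex(2)[OF w p, of "of_real \<kappa>"] 1])
  moreover have "of_real (inverse (2 * sqrt s)) * (2 * ?w * z) = z" for z using w by simp
  ultimately show ?case by (simp only:)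
next
  case (ge2 n s)
  let ?k = "radial_kernel \<kappa>"
  have d0: "(?k n has_vector_derivative ?k (Suc n) s) (at s)" by (rule ge2.IH(1)[OF ge2.prems])
  have d1: "(?k (Suc n) has_vector_derivative ?k (Suc (Suc n)) s) (at s)" by (rule ge2.IH(2)[OF ge2.prems])
  let ?a = "complex_of_real (4 * real n + 6)" and ?b = "complex_of_real (\<kappa>\<^sup>2)"
  have di: "((\<lambda>s. complex_of_real (- 1 / (4 * s))) has_vector_derivative of_real (1 / (4 * s\<^sup>2))) (at s)"
    by (rule has_vector_derivative_of_real)
       (use ge2.prems in \<open>auto intro!: derivative_eq_intros simp: power2_eq_square field_simps
          simp flip: has_real_derivative_iff_has_vector_derivative\<close>)
  have "((\<lambda>s. of_real (- 1 / (4 * s)) * (?a * ?k (Suc n) s + ?b * ?k n s)) has_vector_derivative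
      of_real (- 1 / (4 * s)) * (?a * ?k (Suc (Suc n)) s + ?b * ?k (Suc n) s)
      + of_real (1 / (4 * s\<^sup>2)) * (?a * ?k (Suc n) s + ?b * ?k n s)) (at s)"
    by (intro has_vector_derivative_mult di has_vector_derivative_add has_vector_derivative_mult_right d0 d1)
  moreover have "of_real (- 1 / (4 * s)) * (?a * ?k (Suc (Suc n)) s + ?b * ?k (Suc n) s)
      + of_real (1 / (4 * s\<^sup>2)) * (?a * ?k (Suc n) s + ?b * ?k n s) = ?k (Suc (Suc (Suc n))) s"
  proof -
    have e: "?a * ?k (Suc n) s + ?b * ?k n s = - of_real (4 * s) * ?k (Suc (Suc n)) s"
      using radial_kernel_recurrence[OF ge2.prems, of \<kappa> n] by (simp add: eq_neg_iff_add_eq_0 add_ac del: radial_kernel.simps)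
    show ?thesis unfolding e radial_kernel.simps(3)[of \<kappa> "Suc n"] using ge2.prems
      by (simp add: field_simps power2_eq_square del: radial_kernel.simps)
  qed
  moreover have "?k (Suc (Suc n)) = (\<lambda>s. of_real (- 1 / (4 * s)) * (?a * ?k (Suc n) s + ?b * ?k n s))"
  proof -
    have "- X / complex_of_real (4 * s) = of_real (- 1 / (4 * s)) * X" for X s by simp
    then show ?thesis by (intro ext) (simp only: radial_kernel.simps(3))
  qed
  ultimately show ?case by (simp only:)
qed

declare radial_kernel.simps(3) [simp del]

lemma continuous_on_radial_kernel: "continuous_on {0<..} (radial_kernel \<kappa> n)"
  by (rule continuous_on_vector_derivative, rule has_vector_derivative_at_within, rule has_vector_derivative_radial_kernel) auto

text \<open>Far away \<open>k\<^sub>n(w\<^sup>2)\<close> is \<open>(i\<kappa>/2)\<^sup>n e\<^bsup>i\<kappa>w\<^esup> / (4\<pi> w\<^bsup>n+1\<^esup>)\<close> to leading order, because the term with \<open>k\<^sub>n\<^sub>+\<^sub>1\<close>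
  in the recursion is smaller by a factor \<open>1/w\<close>. Hence no derivative of the kernel vanishes at large
  distances, which is what makes multipole coefficients invertible.\<close>

lemma radial_kernel_asymptotic:
  "((\<lambda>w. radial_kernel \<kappa> n (w\<^sup>2) * of_real w ^ Suc n * exp (- (\<i> * of_real (\<kappa> * w))))
      \<longlongrightarrow> (\<i> * of_real \<kappa> / 2) ^ n / of_real (4 * pi)) at_top"
proof (induction n rule: induct_nat_012)
  case 0
  have "eventually (\<lambda>w. radial_kernel \<kappa> 0 (w\<^sup>2) * of_real w ^ Suc 0 * exp (- (\<i> * of_real (\<kappa> * w))) = 1 / of_real (4 * pi)) at_top"
    using eventually_gt_at_top[of "0 :: real"]
    by eventually_elim (simp add: exp_minus field_simps)
  then show ?case by (auto intro: tendsto_eventually)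
next
  case 1
  have i: "((\<lambda>w :: real. complex_of_real (inverse w)) \<longlongrightarrow> of_real 0) at_top"
    by (intro tendsto_of_real tendsto_inverse_0_at_top filterlim_ident)
  have "((\<lambda>w. (\<i> * of_real \<kappa> - of_real (inverse w)) / of_real (8 * pi)) \<longlongrightarrow> (\<i> * of_real \<kappa> - of_real 0) / of_real (8 * pi)) at_top"
    by (intro tendsto_intros i) auto
  moreover have "eventually (\<lambda>w. (\<i> * of_real \<kappa> - of_real (inverse w)) / of_real (8 * pi) =
      radial_kernel \<kappa> 1 (w\<^sup>2) * of_real w ^ Suc 1 * exp (- (\<i> * of_real (\<kappa> * w)))) at_top"
    using eventually_gt_at_top[of "0 :: real"]
    by eventually_elim (simp add: exp_minus field_simps power2_eq_square power3_eq_cube)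
  ultimately show ?case by (simp add: tendsto_cong)
next
  case (ge2 n)
  let ?b = "\<lambda>n w. radial_kernel \<kappa> n (w\<^sup>2) * of_real w ^ Suc n * exp (- (\<i> * of_real (\<kappa> * w)))"
  have i: "((\<lambda>w :: real. complex_of_real (inverse w)) \<longlongrightarrow> of_real 0) at_top"
    by (intro tendsto_of_real tendsto_inverse_0_at_top filterlim_ident)
  have "((\<lambda>w. - (of_real (4 * real n + 6) * (?b (Suc n) w * of_real (inverse w)) + of_real (\<kappa>\<^sup>2) * ?b n w) / 4) \<longlongrightarrow>
     - (of_real (4 * real n + 6) * ((\<i> * of_real \<kappa> / 2) ^ Suc n / of_real (4 * pi) * of_real 0) + of_real (\<kappa>\<^sup>2) * ((\<i> * of_real \<kappa> / 2) ^ n / of_real (4 * pi))) / 4) at_top"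
    by (intro tendsto_intros i ge2) auto
  moreover have "eventually (\<lambda>w. - (of_real (4 * real n + 6) * (?b (Suc n) w * of_real (inverse w)) + of_real (\<kappa>\<^sup>2) * ?b n w) / 4 =
      ?b (Suc (Suc n)) w) at_top"
    using eventually_gt_at_top[of "0 :: real"]
    by eventually_elim (simp add: field_simps power2_eq_square radial_kernel.simps(3))
  moreover have "- (of_real (4 * real n + 6) * ((\<i> * of_real \<kappa> / 2) ^ Suc n / of_real (4 * pi) * of_real 0) + of_real (\<kappa>\<^sup>2) * ((\<i> * of_real \<kappa> / 2) ^ n / of_real (4 * pi))) / 4
     = (\<i> * of_real \<kappa> / 2) ^ Suc (Suc n) / of_real (4 * pi)"
  proof -
    have "(\<i> * k) * ((\<i> * k) * X) = (\<i> * \<i>) * (k * k * X)" for k X :: complex by (simp only: mult_ac)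
    then show ?thesis by (simp add: power2_eq_square)
  qed
  ultimately show ?case by (simp only: tendsto_cong)
qed

lemma radial_kernel_nonzero_far:
  assumes "\<kappa> > 0"
  shows "eventually (\<lambda>\<rho>. radial_kernel \<kappa> n (\<rho>\<^sup>2) \<noteq> 0) at_top"
proof -
  have "(\<i> * of_real \<kappa> / 2) ^ n / of_real (4 * pi) \<noteq> 0" using assms by simp
  from tendsto_imp_eventually_ne[OF radial_kernel_asymptotic this]
  show ?thesis by eventually_elim auto
qed

section \<open>Averages of the kernel over a sphere\<close>

text \<open>The squared distance of points at radii \<open>\<rho>\<close> and \<open>r\<close> enclosing an angle with cosine \<open>t\<close> is
  \<open>\<rho>\<^sup>2 + r\<^sup>2 - 2\<rho>rt\<close>, and \<open>(1 - t\<^sup>2)\<^sup>n\<close> is the density of \<open>t\<close> on the unit sphere in dimension \<open>2n + 3\<close>. Thus this is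
  a spherical mean of the kernel of that dimension.\<close>

definition zonal_coefficient :: "real \<Rightarrow> nat \<Rightarrow> real \<Rightarrow> real \<Rightarrow> complex" where
  "zonal_coefficient \<kappa> n \<rho> r =
     integral {-1..1} (\<lambda>t. of_real ((1 - t\<^sup>2) ^ n) * radial_kernel \<kappa> n (\<rho>\<^sup>2 + r\<^sup>2 - 2 * \<rho> * r * t))"

lemma chord_pos:
  fixes r t \<rho> :: real
  assumes "\<bar>r\<bar> < \<rho>" "\<bar>t\<bar> \<le> 1"
  shows "\<rho>\<^sup>2 + r\<^sup>2 - 2 * \<rho> * r * t > 0"
proof -
  have "r * t \<le> \<bar>r\<bar>"
    using assms(2) abs_ge_self[of "r * t"] mult_left_mono[of "\<bar>t\<bar>" 1 "\<bar>r\<bar>"] by (simp add: abs_mult)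
  then have "2 * \<rho> * (r * t) \<le> 2 * \<rho> * \<bar>r\<bar>" using assms by (intro mult_left_mono) auto
  moreover have "(\<rho> - \<bar>r\<bar>)\<^sup>2 > 0" using assms by simp
  moreover have "(\<rho> - \<bar>r\<bar>)\<^sup>2 = \<rho>\<^sup>2 + r\<^sup>2 - 2 * \<rho> * \<bar>r\<bar>" by (simp add: power2_diff)
  ultimately show ?thesis by (simp add: mult.assoc)
qed

lemma continuous_on_chord_kernel:
  "continuous_on ({- \<rho><..<\<rho>} \<times> {-1..1}) (\<lambda>(r, t). radial_kernel \<kappa> n (\<rho>\<^sup>2 + r\<^sup>2 - 2 * \<rho> * r * t))"
  unfolding split_beta
proof (rule continuous_on_compose2[OF continuous_on_radial_kernel])
  show "(\<lambda>p. \<rho>\<^sup>2 + (fst p)\<^sup>2 - 2 * \<rho> * fst p * snd p) ` ({- \<rho><..<\<rho>} \<times> {-1..1}) \<subseteq> {0<..}"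
    by (auto intro!: chord_pos)
qed (intro continuous_intros)

lemma chord_kernel_derivative:
  assumes "\<bar>r\<bar> < \<rho>" "\<bar>t\<bar> \<le> 1"
  shows "((\<lambda>r. radial_kernel \<kappa> n (\<rho>\<^sup>2 + r\<^sup>2 - 2 * \<rho> * r * t)) has_vector_derivative
     of_real (2 * r - 2 * \<rho> * t) * radial_kernel \<kappa> (Suc n) (\<rho>\<^sup>2 + r\<^sup>2 - 2 * \<rho> * r * t)) (at r)"
  unfolding scaleR_conv_of_real[symmetric]
  by (rule has_vector_derivative_chain_real[where f="\<lambda>r. \<rho>\<^sup>2 + r\<^sup>2 - 2 * \<rho> * r * t"])
     (use has_vector_derivative_radial_kernel[OF chord_pos[OF assms]] in \<open>auto intro!: derivative_eq_intros\<close>)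

text \<open>A spherical mean of Helmholtz solutions solves the radial Helmholtz equation
  \<open>f'' + (2n+2)/r f' + \<kappa>\<^sup>2 f = 0\<close>. After eliminating \<open>k\<^sub>n\<close> by the recursion, \<open>r\<close> times the left-hand side
  is the integral of the exact derivative of \<open>2\<rho>(1 - t\<^sup>2)\<^bsup>n+1\<^esup> k\<^sub>n\<^sub>+\<^sub>1\<close> over \<open>[-1, 1]\<close>.\<close>

lemma zonal_coefficient_ode:
  fixes \<kappa> \<rho> :: real and n :: nat
  obtains f' f'' where
    "\<And>r. \<bar>r\<bar> < \<rho> \<Longrightarrow> (zonal_coefficient \<kappa> n \<rho> has_vector_derivative f' r) (at r)"
    "\<And>r. \<bar>r\<bar> < \<rho> \<Longrightarrow> (f' has_vector_derivative f'' r) (at r)"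
    "\<And>r. \<bar>r\<bar> < \<rho> \<Longrightarrow> of_real r * (f'' r + of_real (\<kappa>\<^sup>2) * zonal_coefficient \<kappa> n \<rho> r) + of_real (2 * real n + 2) * f' r = 0"
proof -
  define f where "f = zonal_coefficient \<kappa> n \<rho>"
  let ?k = "\<lambda>m r t. radial_kernel \<kappa> m (\<rho>\<^sup>2 + r\<^sup>2 - 2 * \<rho> * r * t)"
  let ?w = "\<lambda>t :: real. complex_of_real ((1 - t\<^sup>2) ^ n)"
  let ?p = "\<lambda>r t :: real. complex_of_real (2 * r - 2 * \<rho> * t)"
  let ?f0 = "\<lambda>r t. ?w t * ?k n r t"
  let ?f1 = "\<lambda>r t. ?w t * (?p r t * ?k (Suc n) r t)"
  let ?f2 = "\<lambda>r t. ?w t * (?p r t * (?p r t * ?k (Suc (Suc n)) r t) + 2 * ?k (Suc n) r t)"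
  have ck: "continuous_on ({- \<rho><..<\<rho>} \<times> {-1..1}) (\<lambda>p. ?k m (fst p) (snd p))" for m
    using continuous_on_chord_kernel[of \<rho> \<kappa> m] by (simp add: split_beta)
  have c0: "continuous_on ({- \<rho><..<\<rho>} \<times> {-1..1}) (\<lambda>(r, t). ?f0 r t)"
    and c1: "continuous_on ({- \<rho><..<\<rho>} \<times> {-1..1}) (\<lambda>(r, t). ?f1 r t)"
    and c2: "continuous_on ({- \<rho><..<\<rho>} \<times> {-1..1}) (\<lambda>(r, t). ?f2 r t)"
    unfolding split_beta by (intro continuous_intros ck)+
  have ct: "continuous_on {-1..1} (\<lambda>t. ?k m r t)" if "\<bar>r\<bar> < \<rho>" for m r
  proof -
    have "continuous_on {-1..1} (\<lambda>t. (\<lambda>p. ?k m (fst p) (snd p)) (r, t))"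
      by (rule continuous_on_compose2[OF ck]) (use that in \<open>auto intro!: continuous_intros\<close>)
    then show ?thesis by simp
  qed
  let ?I1 = "\<lambda>r. integral {-1..1} (?f1 r)" and ?I2 = "\<lambda>r. integral {-1..1} (?f2 r)"
  have d1: "(f has_vector_derivative ?I1 r) (at r)" if r: "\<bar>r\<bar> < \<rho>" for r
    unfolding f_def zonal_coefficient_def
    by (rule leibniz_symmetric[OF _ c0 c1 r])
       (intro has_vector_derivative_mult_right chord_kernel_derivative)
  have d2: "(?I1 has_vector_derivative ?I2 r) (at r)" if r: "\<bar>r\<bar> < \<rho>" for r
  proof (rule leibniz_symmetric[OF _ c1 c2 r])
    fix r t :: real assume rt: "\<bar>r\<bar> < \<rho>" "\<bar>t\<bar> \<le> 1"
    have "((\<lambda>r. ?p r t) has_vector_derivative of_real 2) (at r)"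
      by (rule has_vector_derivative_of_real)
         (auto intro!: derivative_eq_intros simp flip: has_real_derivative_iff_has_vector_derivative)
    from has_vector_derivative_mult_right[OF has_vector_derivative_mult[OF this chord_kernel_derivative[OF rt, of \<kappa> "Suc n"]], of "?w t"]
    show "((\<lambda>r. ?f1 r t) has_vector_derivative ?f2 r t) (at r)"
      by (simp del: radial_kernel.simps)
  qed
  have ode: "of_real r * (?I2 r + of_real (\<kappa>\<^sup>2) * f r) + of_real (2 * real n + 2) * ?I1 r = 0"
    if r: "\<bar>r\<bar> < \<rho>" for r
  proof -
  let ?v = "\<lambda>t. of_real r * (?f2 r t + of_real (\<kappa>\<^sup>2) * ?f0 r t) + of_real (2 * real n + 2) * ?f1 r t"
  let ?G = "\<lambda>t. of_real (2 * \<rho>) * (of_real ((1 - t\<^sup>2) ^ Suc n) * ?k (Suc n) r t)"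
  have "(?v has_integral (?G 1 - ?G (-1))) {-1..1}"
  proof (rule fundamental_theorem_of_calculus)
    fix t :: real assume t: "t \<in> {-1..1}"
    then have pos: "\<rho>\<^sup>2 + r\<^sup>2 - 2 * \<rho> * r * t > 0" by (intro chord_pos r) auto
    have 1: "((\<lambda>t. ?k (Suc n) r t) has_vector_derivative (- (2 * \<rho> * r)) *\<^sub>R ?k (Suc (Suc n)) r t) (at t within {-1..1})"
      by (rule has_vector_derivative_chain_real[where f="\<lambda>t. \<rho>\<^sup>2 + r\<^sup>2 - 2 * \<rho> * r * t"])
         (use has_vector_derivative_radial_kernel[OF pos] in \<open>auto intro!: derivative_eq_intros\<close>)
    have "((\<lambda>t. (1 - t\<^sup>2) ^ Suc n) has_real_derivative - (2 * real (Suc n) * (1 - t\<^sup>2) ^ n * t)) (at t within {-1..1})"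
      by (rule derivative_eq_intros refl | simp add: algebra_simps)+
    then have 2: "((\<lambda>t. complex_of_real ((1 - t\<^sup>2) ^ Suc n)) has_vector_derivative
        of_real (- (2 * real (Suc n) * (1 - t\<^sup>2) ^ n * t))) (at t within {-1..1})"
      by (intro has_vector_derivative_of_real) (simp add: has_real_derivative_iff_has_vector_derivative)
    \<comment> \<open>The recursion eliminates the lowest derivative.\<close>
    have rec: "of_real (\<kappa>\<^sup>2) * ?k n r t = - (of_real (4 * (\<rho>\<^sup>2 + r\<^sup>2 - 2 * \<rho> * r * t)) * ?k (Suc (Suc n)) r t) - of_real (4 * real n + 6) * ?k (Suc n) r t"
      using radial_kernel_recurrence[OF pos, of \<kappa> n] by (simp add: algebra_simps eq_neg_iff_add_eq_0 del: radial_kernel.simps)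
    have alg: "R * (W * (P * (P * K2) + 2 * K1) + K * (W * K0)) + N' * (W * (P * K1)) = Q' * (W' * (D * K2) + C * K1)"
      if "K * K0 = - (4 * (Q\<^sup>2 + R\<^sup>2 - 2 * Q * R * T) * K2) - (4 * N + 6) * K1" "P = 2 * R - 2 * Q * T"
        "N' = 2 * N + 2" "Q' = 2 * Q" "W' = (1 - T\<^sup>2) * W" "D = - (2 * Q * R)" "C = - (2 * (N + 1) * W * T)"
      for R W P K0 K1 K2 K N Q T N' Q' W' D C :: complex
    proof -
      have e: "K * (W * K0) = W * (- (4 * (Q\<^sup>2 + R\<^sup>2 - 2 * Q * R * T) * K2) - (4 * N + 6) * K1)"
        by (simp only: mult.left_commute[of K] that(1))
      show ?thesis unfolding e that(2-) by (simp add: algebra_simps power2_eq_square)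
    qed
    have "?v t = of_real (2 * \<rho>) * (of_real ((1 - t\<^sup>2) ^ Suc n) * ((- (2 * \<rho> * r)) *\<^sub>R ?k (Suc (Suc n)) r t)
        + of_real (- (2 * real (Suc n) * (1 - t\<^sup>2) ^ n * t)) * ?k (Suc n) r t)"
      unfolding scaleR_conv_of_real
      by (rule alg[where Q="of_real \<rho>" and T="of_real t" and N="of_nat n"]) (use rec in simp_all)
    with has_vector_derivative_mult_right[OF has_vector_derivative_mult[OF 2 1], of "of_real (2 * \<rho>)"]
    show "(?G has_vector_derivative ?v t) (at t within {-1..1})"
      by (simp only:)
  qed simp
  then have z: "integral {-1..1} ?v = 0" by (simp add: integral_unique)
  have "integral {-1..1} ?v = of_real r * (integral {-1..1} (?f2 r) + of_real (\<kappa>\<^sup>2) * integral {-1..1} (?f0 r))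
     + of_real (2 * real n + 2) * integral {-1..1} (?f1 r)"
  proof -
    have i: "?f0 r integrable_on {-1..1}" "?f1 r integrable_on {-1..1}" "?f2 r integrable_on {-1..1}"
      by (intro integrable_on_continuous_interval continuous_intros ct r)+
    show ?thesis
      using i by (simp add: Henstock_Kurzweil_Integration.integral_add integrable_add integrable_on_cmult_left del: radial_kernel.simps of_real_add of_real_mult of_real_power of_real_diff)
  qed
  with z show ?thesis
    unfolding f_def zonal_coefficient_def by (simp only:)
  qed
  define I1 where "I1 = ?I1"
  define I2 where "I2 = ?I2"
  have "(f has_vector_derivative I1 r) (at r)" if "\<bar>r\<bar> < \<rho>" for r
    unfolding I1_def by (rule d1[OF that])
  moreover have "(I1 has_vector_derivative I2 r) (at r)" if "\<bar>r\<bar> < \<rho>" for r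
    unfolding I1_def I2_def by (rule d2[OF that])
  moreover have "of_real r * (I2 r + of_real (\<kappa>\<^sup>2) * f r) + of_real (2 * real n + 2) * I1 r = 0" if "\<bar>r\<bar> < \<rho>" for r
    unfolding I1_def I2_def by (rule ode[OF that])
  ultimately show thesis unfolding f_def by (rule that)
qed

text \<open>For \<open>p \<ge> 0\<close> the energy \<open>|w'|\<^sup>2 + \<kappa>\<^sup>2|w|\<^sup>2\<close> has derivative \<open>-2p/r |w'|\<^sup>2\<close> and cannot grow away from the
  singular point \<open>r = 0\<close>.\<close>

lemma singular_ode_unique:
  fixes w w' w'' :: "real \<Rightarrow> complex"
  assumes p: "p \<ge> 0" and \<kappa>: "\<kappa> > 0"
    and d: "\<And>r. \<bar>r\<bar> < \<rho> \<Longrightarrow> (w has_vector_derivative w' r) (at r)"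
    and d': "\<And>r. \<bar>r\<bar> < \<rho> \<Longrightarrow> (w' has_vector_derivative w'' r) (at r)"
    and ode: "\<And>r. \<bar>r\<bar> < \<rho> \<Longrightarrow> of_real r * (w'' r + of_real (\<kappa>\<^sup>2) * w r) + of_real p * w' r = 0"
    and w0: "w 0 = 0" "w' 0 = 0" and r: "0 \<le> r" "r < \<rho>"
  shows "w r = 0"
proof -
  let ?e = "\<lambda>r. w' r \<bullet> w' r + \<kappa>\<^sup>2 * (w r \<bullet> w r)"
  have "?e r \<le> ?e 0"
  proof (rule DERIV_nonpos_imp_nonincreasing[OF r(1), where f="?e"])
    fix x assume x: "0 \<le> x" "x \<le> r"
    then have x': "\<bar>x\<bar> < \<rho>" using r by auto
    have e: "(?e has_real_derivative 2 * (w' x \<bullet> (w'' x + \<kappa>\<^sup>2 *\<^sub>R w x))) (at x)"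
    proof -
      have "(?e has_derivative (\<lambda>h. (w' x \<bullet> (h *\<^sub>R w'' x) + (h *\<^sub>R w'' x) \<bullet> w' x) + \<kappa>\<^sup>2 * (w x \<bullet> (h *\<^sub>R w' x) + (h *\<^sub>R w' x) \<bullet> w x))) (at x)"
        using d[OF x'] d'[OF x'] unfolding has_vector_derivative_def
        by (intro derivative_intros)
      then show ?thesis unfolding has_field_derivative_def
        by (rule has_derivative_eq_rhs) (auto simp: fun_eq_iff inner_commute algebra_simps inner_add_right inner_scaleR_right)
    qed
    have "w' x \<bullet> (w'' x + of_real (\<kappa>\<^sup>2) * w x) \<le> 0"
    proof (cases "x = 0")
      case False
      then have "x > 0" using x by simp
      have "of_real x * (w'' x + of_real (\<kappa>\<^sup>2) * w x) = - (of_real p * w' x)"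
        using ode[OF x'] by (simp only: eq_neg_iff_add_eq_0)
      then have "x *\<^sub>R (w'' x + of_real (\<kappa>\<^sup>2) * w x) = - (p *\<^sub>R w' x)" by (simp only: scaleR_conv_of_real)
      then have "w' x \<bullet> (x *\<^sub>R (w'' x + of_real (\<kappa>\<^sup>2) * w x)) = - (p * (w' x \<bullet> w' x))" by simp
      then have "x * (w' x \<bullet> (w'' x + of_real (\<kappa>\<^sup>2) * w x)) \<le> 0" using p by (simp only: inner_scaleR_right) simp
      then show ?thesis using \<open>x > 0\<close> by (simp add: mult_le_0_iff)
    qed (simp add: w0)
    then show "\<exists>y. (?e has_real_derivative y) (at x) \<and> y \<le> 0" using e unfolding scaleR_conv_of_real by force
  qed
  moreover have "?e 0 = 0" using w0 by simp
  ultimately have "w' r \<bullet> w' r + \<kappa>\<^sup>2 * (w r \<bullet> w r) \<le> 0" by (simp only:)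
  then have "\<kappa>\<^sup>2 * (w r \<bullet> w r) \<le> 0" using inner_ge_zero[of "w' r"] by linarith
  then have "w r \<bullet> w r \<le> 0" using \<kappa> by (simp add: mult_le_0_iff)
  then show ?thesis by (metis inner_gt_zero_iff not_less)
qed

section \<open>Spherical Bessel functions\<close>

definition bessel_coeff :: "nat \<Rightarrow> nat \<Rightarrow> real" where
  "bessel_coeff n k = (- 1 / 2) ^ k / (fact k * (\<Prod>i\<le>n + k. 2 * real i + 1))"

text \<open>The entire function with \<open>j\<^sub>n(t) = t\<^sup>n reduced_bessel n (t\<^sup>2)\<close>.\<close>

definition reduced_bessel :: "nat \<Rightarrow> real \<Rightarrow> real" where
  "reduced_bessel n q = (\<Sum>k. bessel_coeff n k * q ^ k)"

lemma odd_factorial_ge_1: "(\<Prod>i\<le>m. 2 * real i + 1) \<ge> 1"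
  by (rule prod_ge_1) simp

lemma summable_reduced_bessel: "summable (\<lambda>k. bessel_coeff n k * q ^ k)"
proof (rule summable_comparison_test')
  show "summable (\<lambda>k. \<bar>q\<bar> ^ k / fact k)" using summable_exp[of "\<bar>q\<bar>"] by (simp add: field_simps)
  fix k
  have "fact k * (1 :: real) \<le> fact k * (\<Prod>i\<le>n + k. 2 * real i + 1)"
    by (intro mult_left_mono odd_factorial_ge_1) simp
  moreover have "(1 / 2 :: real) ^ k \<le> 1" by (rule power_le_one) auto
  ultimately have "\<bar>bessel_coeff n k\<bar> \<le> 1 / fact k"
    using odd_factorial_ge_1[of "n + k"]
    by (auto simp: bessel_coeff_def abs_mult power_abs intro!: frac_le)
  then have "\<bar>bessel_coeff n k\<bar> * \<bar>q\<bar> ^ k \<le> 1 / fact k * \<bar>q\<bar> ^ k" by (intro mult_right_mono) auto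
  then show "norm (bessel_coeff n k * q ^ k) \<le> \<bar>q\<bar> ^ k / fact k" by (simp add: abs_mult power_abs)
qed

lemma reduced_bessel_derivative:
  "(reduced_bessel n has_real_derivative - reduced_bessel (Suc n) q / 2) (at q)"
proof -
  have c: "diffs (bessel_coeff n) k = - 1 / 2 * bessel_coeff (Suc n) k" for k
    unfolding diffs_def bessel_coeff_def using odd_factorial_ge_1[of "n + Suc k"]
    by (simp add: divide_simps del: prod.atMost_Suc)
  have "(reduced_bessel n has_real_derivative (\<Sum>k. diffs (bessel_coeff n) k * q ^ k)) (at q)"
    unfolding reduced_bessel_def[abs_def]
    by (rule termdiffs_strong_converges_everywhere) (rule summable_reduced_bessel)
  also have "(\<Sum>k. diffs (bessel_coeff n) k * q ^ k) = - 1 / 2 * reduced_bessel (Suc n) q"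
    unfolding c reduced_bessel_def mult.assoc by (rule suminf_mult[OF summable_reduced_bessel])
  finally show ?thesis by simp
qed

lemma reduced_bessel_recurrence:
  "q * reduced_bessel (Suc (Suc n)) q - (2 * real n + 3) * reduced_bessel (Suc n) q + reduced_bessel n q = 0"
proof -
  let ?b = bessel_coeff
  have step: "?b (Suc (Suc n)) k - (2 * real n + 3) * ?b (Suc n) (Suc k) + ?b n (Suc k) = 0" for k
  proof -
    have "(\<Prod>i\<le>Suc n + Suc k. 2 * real i + 1) = (2 * real n + 2 * real k + 5) * (\<Prod>i\<le>n + Suc k. 2 * real i + 1)"
      by (simp add: algebra_simps)
    moreover have "(\<Prod>i\<le>Suc (Suc n) + k. 2 * real i + 1) = (\<Prod>i\<le>Suc n + Suc k. 2 * real i + 1)"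
      by simp
    ultimately show ?thesis unfolding bessel_coeff_def using odd_factorial_ge_1[of "n + Suc k"]
      by (simp only:) (simp add: divide_simps del: prod.atMost_Suc, simp add: algebra_simps)
  qed
  have zero: "- (2 * real n + 3) * ?b (Suc n) 0 + ?b n 0 = 0"
  proof -
    have p: "(\<Prod>i\<le>Suc n + 0. 2 * real i + 1) = (2 * real n + 3) * (\<Prod>i\<le>n + 0. 2 * real i + 1)"
      by (simp add: algebra_simps)
    have "- c * (1 / (1 * (c * P))) + 1 / (1 * P) = 0" if "c \<noteq> 0" "P \<noteq> 0" for c P :: real
      using that by (simp add: field_simps)
    moreover have "2 * real n + 3 \<noteq> 0" "(\<Prod>i\<le>n + 0. 2 * real i + 1) \<noteq> 0"
      using odd_factorial_ge_1[of "n + 0"] by linarith+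
    ultimately show ?thesis unfolding bessel_coeff_def p power_0 fact_0 by blast
  qed
  have s0: "reduced_bessel m q = ?b m 0 + (\<Sum>k. ?b m (Suc k) * q ^ Suc k)" for m
    unfolding reduced_bessel_def using suminf_split_head[OF summable_reduced_bessel[of m q]] by simp
  have sm: "summable (\<lambda>k. ?b m (Suc k) * q ^ Suc k)" for m
    using summable_reduced_bessel[of m q] by (subst summable_Suc_iff)
  have q: "q * reduced_bessel (Suc (Suc n)) q = (\<Sum>k. ?b (Suc (Suc n)) k * q ^ Suc k)"
    unfolding reduced_bessel_def
    by (subst suminf_mult[OF summable_reduced_bessel, symmetric]) (simp add: mult_ac)
  have sq: "summable (\<lambda>k. ?b (Suc (Suc n)) k * q ^ Suc k)"
    using summable_mult[OF summable_reduced_bessel[of "Suc (Suc n)" q], of q] by (simp add: mult_ac)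
  have "(\<Sum>k. ?b (Suc (Suc n)) k * q ^ Suc k) - (2 * real n + 3) * (\<Sum>k. ?b (Suc n) (Suc k) * q ^ Suc k) + (\<Sum>k. ?b n (Suc k) * q ^ Suc k)
     = (\<Sum>k. ?b (Suc (Suc n)) k * q ^ Suc k - (2 * real n + 3) * (?b (Suc n) (Suc k) * q ^ Suc k) + ?b n (Suc k) * q ^ Suc k)"
    by (simp only: suminf_mult[OF sm, symmetric] suminf_diff[OF sq summable_mult[OF sm]] suminf_add[OF summable_diff[OF sq summable_mult[OF sm]] sm])
  also have "\<dots> = (\<Sum>k. (?b (Suc (Suc n)) k - (2 * real n + 3) * ?b (Suc n) (Suc k) + ?b n (Suc k)) * q ^ Suc k)"
    by (simp only: algebra_simps)
  also have "\<dots> = 0" unfolding step by simp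
  finally have e: "(\<Sum>k. ?b (Suc (Suc n)) k * q ^ Suc k) - (2 * real n + 3) * (\<Sum>k. ?b (Suc n) (Suc k) * q ^ Suc k) + (\<Sum>k. ?b n (Suc k) * q ^ Suc k) = 0" .
  have "A - c * (b1 + S1) + (b0 + S0) = 0" if "A - c * S1 + S0 = 0" "- c * b1 + b0 = 0" for A c b0 b1 S0 S1 :: real
    using that by (simp add: algebra_simps)
  from this[OF e zero] show ?thesis
    unfolding q s0[of "Suc n"] s0[of n] .
qed

lemma reduced_bessel_0: "reduced_bessel n 0 = bessel_coeff n 0" "bessel_coeff n 0 > 0"
proof -
  show "reduced_bessel n 0 = bessel_coeff n 0"
    unfolding reduced_bessel_def using powser_zero[of "bessel_coeff n"] by simp
  show "bessel_coeff n 0 > 0" using odd_factorial_ge_1[of n] by (simp add: bessel_coeff_def)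
qed

lemma spherical_bessel_eq: "spherical_bessel n t = t ^ n * reduced_bessel n (t\<^sup>2)"
proof -
  have "(-1) ^ k * t ^ (n + 2 * k) / (2 ^ k * fact k * (\<Prod>i\<le>n + k. 2 * real i + 1)) = t ^ n * (bessel_coeff n k * (t\<^sup>2) ^ k)" for k
    unfolding bessel_coeff_def power_add[of t n] power_mult power_divide by (simp add: mult_ac)
  then show ?thesis unfolding spherical_bessel_def reduced_bessel_def
    by (simp only: suminf_mult[OF summable_reduced_bessel, symmetric])
qed

text \<open>Both sides solve the same singular equation with the same value and zero slope at \<open>r = 0\<close>. This is the
  separation of the variables \<open>\<rho>\<close> and \<open>r\<close> that an addition theorem would provide.\<close>

lemma zonal_coefficient_eq_bessel:
  assumes \<kappa>: "\<kappa> > 0" and r: "0 \<le> r" "r < \<rho>"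
  shows "zonal_coefficient \<kappa> n \<rho> r =
     zonal_coefficient \<kappa> n \<rho> 0 / of_real (bessel_coeff n 0) * of_real (reduced_bessel n (\<kappa>\<^sup>2 * r\<^sup>2))"
proof -
  let ?f = "zonal_coefficient \<kappa> n \<rho>"
  let ?C = "?f 0 / of_real (bessel_coeff n 0)"
  let ?B = "\<lambda>m r. reduced_bessel m (\<kappa>\<^sup>2 * r\<^sup>2)"
  obtain f' f'' where
    f: "\<And>r. \<bar>r\<bar> < \<rho> \<Longrightarrow> (?f has_vector_derivative f' r) (at r)"
       "\<And>r. \<bar>r\<bar> < \<rho> \<Longrightarrow> (f' has_vector_derivative f'' r) (at r)"
       "\<And>r. \<bar>r\<bar> < \<rho> \<Longrightarrow> of_real r * (f'' r + of_real (\<kappa>\<^sup>2) * ?f r) + of_real (2 * real n + 2) * f' r = 0"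
    by (rule zonal_coefficient_ode[where \<kappa>=\<kappa> and n=n and \<rho>=\<rho>]) blast
  have dB: "(?B m has_real_derivative - (\<kappa>\<^sup>2 * r * ?B (Suc m) r)) (at r)" for m r
  proof -
    have "((\<lambda>r. \<kappa>\<^sup>2 * r\<^sup>2) has_real_derivative \<kappa>\<^sup>2 * (2 * r)) (at r)"
      by (auto intro!: derivative_eq_intros)
    from DERIV_chain2[OF reduced_bessel_derivative this] show ?thesis by (simp add: mult_ac)
  qed
  let ?g = "\<lambda>r. ?B n r" and ?g' = "\<lambda>r. - (\<kappa>\<^sup>2 * r * ?B (Suc n) r)"
    and ?g'' = "\<lambda>r. - (\<kappa>\<^sup>2 * ?B (Suc n) r) + \<kappa>\<^sup>2 * r * (\<kappa>\<^sup>2 * r * ?B (Suc (Suc n)) r)"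
  have dg': "(?g' has_real_derivative ?g'' r) (at r)" for r
  proof -
    have "((\<lambda>r. \<kappa>\<^sup>2 * r) has_real_derivative \<kappa>\<^sup>2) (at r)" by (auto intro!: derivative_eq_intros)
    from DERIV_minus[OF DERIV_mult'[OF this dB[of "Suc n"]]] show ?thesis by (simp add: algebra_simps)
  qed
  have gode: "r * (?g'' r + \<kappa>\<^sup>2 * ?g r) + (2 * real n + 2) * ?g' r = 0" for r
  proof -
    have "r * (?g'' r + \<kappa>\<^sup>2 * ?g r) + (2 * real n + 2) * ?g' r =
       r * \<kappa>\<^sup>2 * (\<kappa>\<^sup>2 * r\<^sup>2 * ?B (Suc (Suc n)) r - (2 * real n + 3) * ?B (Suc n) r + ?B n r)"
      by (simp add: algebra_simps power2_eq_square)
    then show ?thesis unfolding reduced_bessel_recurrence by simp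
  qed
  let ?w = "\<lambda>r. ?f r - ?C * of_real (?g r)" and ?w' = "\<lambda>r. f' r - ?C * of_real (?g' r)"
    and ?w'' = "\<lambda>r. f'' r - ?C * of_real (?g'' r)"
  have b0: "of_real (bessel_coeff n 0) \<noteq> (0 :: complex)" using reduced_bessel_0(2)[of n] by simp
  have "?w r = 0"
  proof (rule singular_ode_unique[where p="2 * real n + 2" and \<kappa>="\<kappa>" and \<rho>="\<rho>" and w="?w" and w'="?w'" and w''="?w''"])
    fix r assume r: "\<bar>r\<bar> < \<rho>"
    show "(?w has_vector_derivative ?w' r) (at r)"
      by (intro has_vector_derivative_diff f(1)[OF r] has_vector_derivative_mult_right has_vector_derivative_of_real)
         (use dB in \<open>simp add: has_real_derivative_iff_has_vector_derivative\<close>)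
    show "(?w' has_vector_derivative ?w'' r) (at r)"
      by (intro has_vector_derivative_diff f(2)[OF r] has_vector_derivative_mult_right has_vector_derivative_of_real)
         (use dg' in \<open>simp add: has_real_derivative_iff_has_vector_derivative\<close>)
    have g: "of_real r * (of_real (?g'' r) + of_real (\<kappa>\<^sup>2) * of_real (?g r)) + of_real (2 * real n + 2) * of_real (?g' r) = (0 :: complex)"
      using gode[of r] by (simp only: of_real_add[symmetric] of_real_mult[symmetric] of_real_0)
    have alg: "R * ((a - C * a') + K * (b - C * b')) + N * (c - C * c') = 0"
      if "R * (a + K * b) + N * c = 0" "R * (a' + K * b') + N * c' = 0" for R a a' C K b b' N c c' :: complex
    proof -
      have "R * ((a - C * a') + K * (b - C * b')) + N * (c - C * c') = (R * (a + K * b) + N * c) - C * (R * (a' + K * b') + N * c')"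
        by (simp add: algebra_simps)
      then show ?thesis unfolding that by simp
    qed
    show "of_real r * (?w'' r + of_real (\<kappa>\<^sup>2) * ?w r) + of_real (2 * real n + 2) * ?w' r = 0"
      by (rule alg[OF f(3)[OF r] g])
  next
    show "?w 0 = 0" using b0 by (simp add: reduced_bessel_0)
    have "\<rho> > 0" using r by simp
    then have "of_real (2 * real n + 2) * f' 0 = 0" using f(3)[of 0] by simp
    moreover have "complex_of_real (2 * real n + 2) \<noteq> 0"
      unfolding of_real_eq_0_iff by linarith
    ultimately have "f' 0 = 0" by (metis mult_eq_0_iff)
    then show "?w' 0 = 0" by simp
  qed (use \<kappa> r in auto)
  then show ?thesis by simp
qed

lemma sphere_area_pos: "sphere_area > 0"
proof (rule ccontr)
  assume "\<not> sphere_area > 0"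
  then have "(LINT d|sphere_measure. 1) = (0 :: real)"
    by (simp add: sphere_area_def not_less) (metis measure_nonneg order_antisym)
  from sphere_integral_zero_imp_zero[OF _ _ this, of "axis 3 1"] show False by simp
qed

section \<open>Multipole moments of a point source\<close>

text \<open>Up to a nonzero factor that depends on \<open>\<kappa>\<close>, \<open>n\<close> and \<open>\<rho>\<close> only, the outgoing spherical Hankel function
  \<open>h\<^sub>n(\<kappa>\<rho>)\<close>.\<close>

definition multipole_coeff :: "real \<Rightarrow> nat \<Rightarrow> real \<Rightarrow> complex" where
  "multipole_coeff \<kappa> n \<rho> =
     of_real (funk_hecke_const n) * of_real (- 2 * \<rho>) ^ n * zonal_coefficient \<kappa> n \<rho> 0 / of_real (bessel_coeff n 0)"

text \<open>At \<open>r = 0\<close> the kernel is constant in \<open>t\<close>, so the coefficient is a positive multiple of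
  \<open>(-\<rho>)\<^sup>n k\<^sub>n(\<rho>\<^sup>2)\<close>.\<close>

lemma multipole_coeff_nonzero:
  assumes "\<kappa> > 0" shows "eventually (\<lambda>\<rho>. multipole_coeff \<kappa> n \<rho> \<noteq> 0) at_top"
proof -
  have w: "integral {-1..1} (\<lambda>t :: real. (1 - t\<^sup>2) ^ n) \<noteq> 0"
  proof
    have nn: "(1 - t\<^sup>2) ^ n \<ge> 0" if "t \<in> {-1..1}" for t :: real
      using that by (auto simp: abs_square_le_1 abs_le_iff)
    assume "integral {-1..1} (\<lambda>t :: real. (1 - t\<^sup>2) ^ n) = 0"
    then have "\<forall>t\<in>{-1..1 :: real}. (1 - t\<^sup>2) ^ n = 0"
      using integral_eq_0_iff[of "-1" 1 "\<lambda>t. (1 - t\<^sup>2) ^ n"] nn by (simp add: continuous_intros)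
    then show False by (auto dest: bspec[of _ _ 0])
  qed
  show ?thesis
    using radial_kernel_nonzero_far[OF assms, of n] eventually_gt_at_top[of "0 :: real"]
  proof eventually_elim
    case (elim \<rho>)
    have "zonal_coefficient \<kappa> n \<rho> 0 = of_real (integral {-1..1} (\<lambda>t. (1 - t\<^sup>2) ^ n)) * radial_kernel \<kappa> n (\<rho>\<^sup>2)"
    proof -
      have "((\<lambda>t. (1 - t\<^sup>2) ^ n) has_integral integral {-1..1} (\<lambda>t :: real. (1 - t\<^sup>2) ^ n)) {-1..1}"
        by (intro integrable_integral integrable_on_continuous_interval continuous_intros)
      from has_integral_mult_left[OF has_integral_of_real[OF this], of "radial_kernel \<kappa> n (\<rho>\<^sup>2)"]
      moreover have "\<rho>\<^sup>2 + 0\<^sup>2 - 2 * \<rho> * 0 * t = \<rho>\<^sup>2" for t by simp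
      ultimately show ?thesis unfolding zonal_coefficient_def by (simp only: integral_unique)
    qed
    then show ?case using elim w sphere_area_pos reduced_bessel_0(2)[of n]
      by (simp add: multipole_coeff_def funk_hecke_const_def)
  qed
qed

text \<open>Since \<open>|\<rho>d - y|\<^sup>2 = \<rho>\<^sup>2 + |y|\<^sup>2 - 2\<rho> d \<bullet> y\<close>, the Funk--Hecke formula applies to the kernel as a function of
  \<open>d \<bullet> y\<close> and leaves exactly the spherical mean computed above.\<close>

lemma point_source_null_moment:
  fixes y a b :: "real^3"
  assumes \<kappa>: "\<kappa> > 0" and null: "a \<bullet> a = b \<bullet> b" "a \<bullet> b = 0" and y: "norm y < \<rho>" "y \<noteq> 0"
  shows "(LINT d|sphere_measure. radial_kernel \<kappa> 0 ((norm (\<rho> *\<^sub>R d - y))\<^sup>2) * null_form a b d ^ n) =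
     multipole_coeff \<kappa> n \<rho> * of_real (reduced_bessel n (\<kappa>\<^sup>2 * (norm y)\<^sup>2)) * null_form a b y ^ n"
proof -
  have \<rho>: "\<rho> > 0" using y(1) norm_ge_zero[of y] by linarith
  let ?s = "\<lambda>s. \<rho>\<^sup>2 + (norm y)\<^sup>2 - 2 * \<rho> * s"
  let ?F = "\<lambda>i s. of_real (- 2 * \<rho>) ^ i * radial_kernel \<kappa> i (?s s)"
  define B where "B = (\<rho>\<^sup>2 + (norm y)\<^sup>2) / (2 * \<rho>)"
  have "(\<rho> - norm y)\<^sup>2 > 0" using y by simp
  then have B: "norm y < B" using \<rho> unfolding B_def by (simp add: power2_diff field_simps power2_eq_square)
  have dist: "(norm (\<rho> *\<^sub>R d - y))\<^sup>2 = ?s (d \<bullet> y)" if "norm d = 1" for d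
    using that by (simp add: power2_norm_eq_inner inner_diff_left inner_diff_right inner_commute)
       (simp add: power2_norm_eq_inner[symmetric] power2_eq_square dot_square_norm)
  have F: "(?F i has_vector_derivative ?F (Suc i) s) (at s)" if "\<bar>s\<bar> < B" for i s
  proof -
    have "?s s > 0" using that \<rho> unfolding B_def by (auto simp: abs_less_iff field_simps)
    then have "((\<lambda>s. radial_kernel \<kappa> i (?s s)) has_vector_derivative (- 2 * \<rho>) *\<^sub>R radial_kernel \<kappa> (Suc i) (?s s)) (at s)"
      by (intro has_vector_derivative_chain_real[where f="?s" and g="radial_kernel \<kappa> i"] has_vector_derivative_radial_kernel)
         (auto intro!: derivative_eq_intros)
    from has_vector_derivative_mult_right[OF this, of "of_real (- 2 * \<rho>) ^ i"] show ?thesis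
      by (simp add: scaleR_conv_of_real mult_ac del: radial_kernel.simps)
  qed
  have "(LINT d|sphere_measure. radial_kernel \<kappa> 0 ((norm (\<rho> *\<^sub>R d - y))\<^sup>2) * null_form a b d ^ n)
      = (LINT d|sphere_measure. ?F 0 (d \<bullet> y) * null_form a b d ^ n)"
    by (rule Bochner_Integration.integral_cong) (simp_all add: dist del: radial_kernel.simps)
  also have "\<dots> = of_real (funk_hecke_const n) * null_form a b y ^ n *
    integral {-1..1} (\<lambda>t. of_real ((1 - t\<^sup>2) ^ n) * ?F n (norm y * t))"
    by (rule funk_hecke_null[where F="?F", OF null B y(2)]) (rule F)
  also have "integral {-1..1} (\<lambda>t. of_real ((1 - t\<^sup>2) ^ n) * ?F n (norm y * t)) = of_real (- 2 * \<rho>) ^ n * zonal_coefficient \<kappa> n \<rho> (norm y)"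
    unfolding zonal_coefficient_def integral_mult_right[symmetric]
    by (rule arg_cong[where f="integral _"]) (simp add: fun_eq_iff mult_ac)
  also have "zonal_coefficient \<kappa> n \<rho> (norm y) = zonal_coefficient \<kappa> n \<rho> 0 / of_real (bessel_coeff n 0) * of_real (reduced_bessel n (\<kappa>\<^sup>2 * (norm y)\<^sup>2))"
    by (rule zonal_coefficient_eq_bessel) (use \<kappa> y in auto)
  finally show ?thesis by (simp add: multipole_coeff_def)
qed

text \<open>For \<open>s = \<plusminus>1\<close> this is \<open>y\<^sub>1 \<plusminus> i y\<^sub>2\<close>.\<close>

definition azimuthal :: "real \<Rightarrow> real^3 \<Rightarrow> complex" where
  "azimuthal s y = of_real (y$1) + \<i> * of_real (s * y$2)"

text \<open>Its value at \<open>z\<close> is \<open>\<zeta>(z) \<cdot> y\<close> for the null vector \<open>\<zeta>(z) = (1 - z\<^sup>2, -is(1 + z\<^sup>2), 2z)\<close>.\<close>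

definition null_poly :: "real \<Rightarrow> real^3 \<Rightarrow> complex poly" where
  "null_poly s y = [:cnj (azimuthal s y), 2 * of_real (y$3), - azimuthal s y:]"

text \<open>The powers of \<^const>\<open>null_poly\<close> are a generating function for the solid harmonics of degree \<open>n\<close>; the
  one of azimuthal order \<open>m\<close> sits at \<open>k = n + m\<close>.\<close>

definition solid_harmonic :: "real \<Rightarrow> nat \<Rightarrow> nat \<Rightarrow> real^3 \<Rightarrow> complex" where
  "solid_harmonic s n k y = coeff (null_poly s y ^ n) k"

lemma null_poly_eq_null_form:
  assumes s: "s\<^sup>2 = 1"
  obtains a b where "a \<bullet> a = b \<bullet> b" "a \<bullet> b = 0" "\<And>y. poly (null_poly s y) z = null_form a b y"
proof -
  let ?\<zeta> = "\<lambda>i :: 3. if i = 1 then 1 - z\<^sup>2 else if i = 2 then - of_real s * \<i> * (1 + z\<^sup>2) else 2 * z"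
  let ?a = "(\<chi> i. Re (?\<zeta> i)) :: real^3" and ?b = "(\<chi> i. Im (?\<zeta> i)) :: real^3"
  have "(\<Sum>i\<in>UNIV. (?\<zeta> i)\<^sup>2) = 0"
  proof -
    have "(of_real s)\<^sup>2 = (1 :: complex)" using s by (metis of_real_1 of_real_power)
    then show ?thesis by (simp add: sum_3 power_mult_distrib) (simp add: power2_eq_square algebra_simps)
  qed
  moreover have "(\<Sum>i\<in>UNIV. (?\<zeta> i)\<^sup>2) = Complex (?a \<bullet> ?a - ?b \<bullet> ?b) (2 * (?a \<bullet> ?b))"
    by (simp add: sum_3 inner_vec_def complex_eq_iff power2_eq_square del: mult_minus_left)
  ultimately have "Complex (?a \<bullet> ?a - ?b \<bullet> ?b) (2 * (?a \<bullet> ?b)) = 0" by simp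
  then have n: "?a \<bullet> ?a = ?b \<bullet> ?b" "?a \<bullet> ?b = 0"
    unfolding zero_complex.code complex.inject by linarith+
  have "poly (null_poly s y) z = null_form ?a ?b y" for y
    by (simp add: null_poly_def azimuthal_def null_form_def complex_eq_iff inner_vec_def sum_3 power2_eq_square algebra_simps)
  from that[OF n this] show thesis .
qed

lemma degree_null_poly_power: "degree (null_poly s y ^ n) \<le> 2 * n"
proof -
  have "degree (null_poly s y) \<le> 2" unfolding null_poly_def by (simp add: degree_pCons_le)
  then have "degree (null_poly s y) * n \<le> 2 * n" by simp
  then show ?thesis using degree_power_le[of "null_poly s y" n] by linarith
qed

lemma poly_eq_sum_upto:
  fixes p :: "'a :: comm_semiring_1 poly"
  assumes "degree p \<le> N" shows "poly p z = (\<Sum>k\<le>N. coeff p k * z ^ k)"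
  by (subst poly_as_sum_of_monoms'[OF assms, symmetric]) (simp add: poly_sum poly_monom)

lemma poly_null_poly_power: "poly (null_poly s y) z ^ n = (\<Sum>k\<le>2 * n. solid_harmonic s n k y * z ^ k)"
  using poly_eq_sum_upto[OF degree_null_poly_power[of s y n], of z] by (simp add: solid_harmonic_def)

lemma solid_harmonic_0: "solid_harmonic s 0 k y = (if k = 0 then 1 else 0)"
  by (simp add: solid_harmonic_def)

lemma solid_harmonic_Suc:
  "solid_harmonic s (Suc n) k y = cnj (azimuthal s y) * solid_harmonic s n k y
     + (if k \<ge> 1 then 2 * of_real (y$3) * solid_harmonic s n (k - 1) y else 0)
     - (if k \<ge> 2 then azimuthal s y * solid_harmonic s n (k - 2) y else 0)"
proof (cases k)
  case 0 then show ?thesis by (simp add: solid_harmonic_def null_poly_def)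
next
  case (Suc k')
  then show ?thesis
    by (cases k') (simp_all add: solid_harmonic_def null_poly_def)
qed

lemma continuous_on_azimuthal [continuous_intros]: "continuous_on S (azimuthal s)"
  unfolding azimuthal_def[abs_def] by (intro continuous_intros)

lemma continuous_on_solid_harmonic: "continuous_on S (solid_harmonic s n k)"
proof (induction n arbitrary: k)
  case 0 then show ?case by (simp add: solid_harmonic_0[abs_def])
next
  case (Suc n)
  have ifc: "continuous_on S (\<lambda>y. if P then f y else 0)" if "continuous_on S f" for P and f :: "real^3 \<Rightarrow> complex"
    using that by (cases P) auto
  then show ?case unfolding solid_harmonic_Suc[abs_def]
    by (intro continuous_on_add continuous_on_diff ifc) (intro continuous_intros Suc)+
qed

text \<open>The identity for null powers holds for every \<open>z\<close>; comparing coefficients of \<open>z\<^sup>k\<close> transfers it to solid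
  harmonics.\<close>

lemma point_source_moment:
  fixes y :: "real^3"
  assumes \<kappa>: "\<kappa> > 0" and s: "s\<^sup>2 = 1" and y: "norm y < \<rho>" "y \<noteq> 0"
  shows "(LINT d|sphere_measure. radial_kernel \<kappa> 0 ((norm (\<rho> *\<^sub>R d - y))\<^sup>2) * solid_harmonic s n k d) =
     multipole_coeff \<kappa> n \<rho> * of_real (reduced_bessel n (\<kappa>\<^sup>2 * (norm y)\<^sup>2)) * solid_harmonic s n k y"
proof (cases "k \<le> 2 * n")
  case False
  then have "solid_harmonic s n k d = 0" for d
    unfolding solid_harmonic_def using degree_null_poly_power[of s d n] by (intro coeff_eq_0) simp
  then show ?thesis by simp
next
  case True
  let ?g = "\<lambda>d. radial_kernel \<kappa> 0 ((norm (\<rho> *\<^sub>R d - y))\<^sup>2)"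
  let ?c = "multipole_coeff \<kappa> n \<rho> * of_real (reduced_bessel n (\<kappa>\<^sup>2 * (norm y)\<^sup>2))"
  have cg: "continuous_on (sphere 0 1) ?g"
  proof (rule continuous_on_compose2[OF continuous_on_radial_kernel])
    show "(\<lambda>d. (norm (\<rho> *\<^sub>R d - y))\<^sup>2) ` sphere 0 1 \<subseteq> {0<..}"
      using y(1) norm_ge_zero[of y] by auto
  qed (intro continuous_intros)
  let ?A = "\<lambda>k. LINT d|sphere_measure. ?g d * solid_harmonic s n k d"
  let ?P = "\<Sum>k\<le>2 * n. monom (?A k) k" and ?Q = "\<Sum>k\<le>2 * n. monom (?c * solid_harmonic s n k y) k"
  have "poly ?P z = poly ?Q z" for z
  proof -
    obtain a b where ab: "a \<bullet> a = b \<bullet> b" "a \<bullet> b = 0" "\<And>y. poly (null_poly s y) z = null_form a b y"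
      using null_poly_eq_null_form[OF s] by blast
    have "poly ?P z = (LINT d|sphere_measure. (\<Sum>k\<le>2 * n. ?g d * solid_harmonic s n k d * z ^ k))"
      unfolding poly_sum poly_monom
      by (subst Bochner_Integration.integral_sum)
         (auto intro!: integrable_sphere continuous_intros cg continuous_on_solid_harmonic simp del: radial_kernel.simps)
    also have "\<dots> = (LINT d|sphere_measure. ?g d * null_form a b d ^ n)"
      unfolding ab(3)[symmetric] poly_null_poly_power sum_distrib_left mult.assoc ..
    also have "\<dots> = ?c * null_form a b y ^ n"
      by (rule point_source_null_moment[OF \<kappa> ab(1,2) y])
    also have "\<dots> = poly ?Q z"
      unfolding ab(3)[symmetric] poly_null_poly_power sum_distrib_left poly_sum poly_monom mult.assoc ..
    finally show ?thesis .
  qed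
  then have "poly ?P = poly ?Q" by (rule ext)
  then have "?P = ?Q" by (simp only: poly_eq_poly_eq_iff)
  then have "coeff ?P k = coeff ?Q k" by simp
  then show ?thesis using True by (simp add: coeff_sum sum.delta del: radial_kernel.simps)
qed

section \<open>Solid harmonics and the regular waves\<close>

lemma map_poly_of_real_mult:
  "map_poly complex_of_real (p * q) = map_poly complex_of_real p * map_poly complex_of_real q"
  by (rule poly_eqI) (simp add: coeff_map_poly coeff_mult)

lemma map_poly_of_real_power: "map_poly complex_of_real (p ^ n) = map_poly complex_of_real p ^ n"
  by (induction n) (simp_all add: map_poly_of_real_mult)

lemma higher_pderiv_map_poly_of_real:
  "(pderiv ^^ k) (map_poly complex_of_real p) = map_poly complex_of_real ((pderiv ^^ k) p)"
proof (induction k)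
  case (Suc k)
  have "pderiv (map_poly complex_of_real q) = map_poly complex_of_real (pderiv q)" for q
    by (rule poly_eqI) (simp add: coeff_map_poly coeff_pderiv)
  with Suc show ?case by simp
qed simp

lemma poly_map_poly_of_real: "poly (map_poly complex_of_real p) (of_real x) = of_real (poly p x)"
  by (induction p) (simp_all add: map_poly_pCons)

text \<open>Taylor's formula: up to the chain rule factor \<open>b\<^sup>k\<close>, the coefficients are derivatives at \<open>a\<close>.\<close>

lemma coeff_pcompose_affine:
  fixes q :: "'a :: field_char_0 poly"
  shows "coeff (pcompose q [:a, b:]) k = b ^ k * poly ((pderiv ^^ k) q) a / fact k"
proof -
  have "(pderiv ^^ k) (pcompose q [:a, b:]) = smult (b ^ k) (pcompose ((pderiv ^^ k) q) [:a, b:])"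
    by (induction k) (simp_all add: pderiv_pcompose pderiv_smult pderiv_pCons mult_ac)
  then have "coeff ((pderiv ^^ k) (pcompose q [:a, b:])) 0 = b ^ k * poly ((pderiv ^^ k) q) a"
    by simp
  moreover have "coeff ((pderiv ^^ k) (pcompose q [:a, b:])) 0 = fact k * coeff (pcompose q [:a, b:]) k"
    by (simp add: coeff_higher_pderiv pochhammer_fact)
  ultimately show ?thesis by (simp add: field_simps)
qed

lemma pcompose_power: "pcompose (p ^ n) q = pcompose p q ^ n"
  by (induction n) (simp_all add: pcompose_1 pcompose_mult)

text \<open>On \<open>uv + x\<^sup>2 = 1\<close>, completing the square gives \<open>v + 2xz - uz\<^sup>2 = -((x - uz)\<^sup>2 - 1)/u\<close>. So the coefficients
  of its powers are Taylor coefficients of \<open>(X\<^sup>2 - 1)\<^sup>n\<close> at \<open>x\<close>, which are Rodrigues' derivatives.\<close>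

lemma coeff_null_power_nonzero:
  fixes u v x :: complex
  assumes uv: "u * v + x\<^sup>2 = 1" and u: "u \<noteq> 0"
  shows "coeff ([:v, 2 * x, - u:] ^ n) (n + m) =
     (-1) ^ m * u ^ m / fact (n + m) * poly ((pderiv ^^ (n + m)) ([:-1, 0, 1:] ^ n)) x"
proof -
  have "[:v, 2 * x, - u:] = smult (- 1 / u) (pcompose [:-1, 0, 1:] [:x, - u:])"
  proof -
    have "v = - ((x * x - 1) / u)" using uv u by (simp add: field_simps power2_eq_square eq_neg_iff_add_eq_0)
    then show ?thesis using u by (simp add: pcompose_pCons algebra_simps) (simp add: diff_divide_distrib)
  qed
  then have "[:v, 2 * x, - u:] ^ n = smult ((- 1 / u) ^ n) (pcompose ([:-1, 0, 1:] ^ n) [:x, - u:])"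
    by (simp only: smult_power pcompose_power)
  then have "coeff ([:v, 2 * x, - u:] ^ n) (n + m) = (- 1 / u) ^ n * ((- u) ^ (n + m) * poly ((pderiv ^^ (n + m)) ([:-1, 0, 1:] ^ n)) x / fact (n + m))"
    by (simp only: coeff_smult coeff_pcompose_affine)
  also have "(- 1 / u) ^ n * ((- u) ^ (n + m) * P / fact (n + m)) = (-1) ^ m * u ^ m / fact (n + m) * P" for P
  proof -
    have "(- 1 / u) ^ n * (- u) ^ n = 1" using u by (simp flip: power_mult_distrib)
    moreover have "(- 1 / u) ^ n * ((- u) ^ (n + m) * P / fact (n + m)) = ((- 1 / u) ^ n * (- u) ^ n) * (- u) ^ m * P / fact (n + m)"
      by (simp add: power_add mult_ac)
    ultimately show ?thesis by (simp add: power_minus[of u])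
  qed
  finally show ?thesis .
qed

text \<open>In the remaining case \<open>u = 0\<close>, i.e. at the poles, only \<open>m = 0\<close> is nontrivial. There the value of
  the derivative is read off from the auxiliary point \<open>u = 1\<close>, \<open>v = 0\<close>, which has the same \<open>x\<close>.\<close>

lemma coeff_null_power:
  fixes u v x :: complex
  assumes uv: "u * v + x\<^sup>2 = 1"
  shows "coeff ([:v, 2 * x, - u:] ^ n) (n + m) =
     (-1) ^ m * u ^ m / fact (n + m) * poly ((pderiv ^^ (n + m)) ([:-1, 0, 1:] ^ n)) x"
proof (cases "u = 0")
  case False
  then show ?thesis by (rule coeff_null_power_nonzero[OF uv])
next
  case True
  then have x2: "x\<^sup>2 = 1" using uv by simp
  then have x: "x \<noteq> 0" by auto
  have p: "[:v, 2 * x, - u:] = [:v, 2 * x:]" using True by simp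
  show ?thesis
  proof (cases "m = 0")
    case False
    have "degree ([:v, 2 * x:] ^ n) \<le> n" using degree_power_le[of "[:v, 2 * x:]" n] x by simp
    then have "coeff ([:v, 2 * x:] ^ n) (n + m) = 0" using False by (intro coeff_eq_0) simp
    then show ?thesis using False True by (simp add: p)
  next
    case True
    have "coeff ([:v, 2 * x:] ^ n) n = (2 * x) ^ n"
      using lead_coeff_power[of "[:v, 2 * x:]" n] x by (simp add: degree_power_eq)
    moreover have "coeff ([:0, 2 * x, - 1:] ^ n) n = (2 * x) ^ n"
    proof -
      have "[:0, 2 * x, - 1:] = monom 1 1 * [:2 * x, - 1:]" by (simp add: monom_altdef)
      then have "[:0, 2 * x, - 1:] ^ n = monom 1 n * [:2 * x, - 1:] ^ n"
        by (simp only: power_mult_distrib monom_power mult_1 power_one)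
      then have "coeff ([:0, 2 * x, - 1:] ^ n) n = coeff ([:2 * x, - 1:] ^ n) 0"
        by (simp add: coeff_monom_mult)
      then show ?thesis by (simp add: coeff_0_power)
    qed
    ultimately show ?thesis using True coeff_null_power_nonzero[of 1 0 x n 0] x2 by (simp add: p)
  qed
qed

lemma azimuthal_mult_cnj_sphere:
  assumes s: "s\<^sup>2 = 1" and d: "norm d = 1"
  shows "azimuthal s d * cnj (azimuthal s d) + (of_real (d$3))\<^sup>2 = 1"
proof -
  have "(d$1)\<^sup>2 + (d$2)\<^sup>2 + (d$3)\<^sup>2 = 1" using d by (simp add: norm_vec_def L2_set_def sum_3)
  then have "(d$1)\<^sup>2 + s\<^sup>2 * (d$2)\<^sup>2 + (d$3)\<^sup>2 = 1" using s by simp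
  then show ?thesis
    by (simp add: azimuthal_def complex_eq_iff power2_eq_square algebra_simps)
qed

lemma solid_harmonic_sphere:
  assumes s: "s\<^sup>2 = 1" and d: "norm d = 1"
  shows "solid_harmonic s n (n + m) d =
    (-1) ^ m * azimuthal s d ^ m * of_real (2 ^ n * fact n / fact (n + m) * poly ((pderiv ^^ m) (legendre n)) (d$3))"
proof -
  have l: "poly ((pderiv ^^ (n + m)) ([:-1, 0, 1:] ^ n)) x = 2 ^ n * fact n * poly ((pderiv ^^ m) (legendre n)) x" for x :: real
  proof -
    have "(pderiv ^^ (n + m)) p = (pderiv ^^ m) ((pderiv ^^ n) p)" for p :: "real poly"
      by (simp only: funpow_add add.commute[of n m] comp_apply)
    then show ?thesis by (simp add: legendre_def higher_pderiv_smult)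
  qed
  have q: "[:-1, 0, 1:] ^ n = map_poly complex_of_real ([:-1, 0, 1:] ^ n)"
    by (simp add: map_poly_of_real_power map_poly_pCons)
  have "poly ((pderiv ^^ (n + m)) ([:-1, 0, 1:] ^ n)) (complex_of_real (d$3)) =
      of_real (2 ^ n * fact n * poly ((pderiv ^^ m) (legendre n)) (d$3))"
    unfolding q higher_pderiv_map_poly_of_real poly_map_poly_of_real l ..
  then show ?thesis
    using coeff_null_power[OF azimuthal_mult_cnj_sphere[OF s d], of n m]
    by (simp add: solid_harmonic_def null_poly_def)
qed

lemma solid_harmonic_scale: "solid_harmonic s n k (c *\<^sub>R y) = of_real c ^ n * solid_harmonic s n k y"
proof -
  have "null_poly s (c *\<^sub>R y) = smult (of_real c) (null_poly s y)"
    by (simp add: null_poly_def azimuthal_def algebra_simps)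
  then show ?thesis by (simp add: solid_harmonic_def smult_power)
qed

text \<open>The normalisation of \<^const>\<open>sph_harm\<close> together with the factor that relates associated Legendre functions
  to \<^const>\<open>solid_harmonic\<close>.\<close>

definition wave_coeff :: "real \<Rightarrow> nat \<Rightarrow> nat \<Rightarrow> real" where
  "wave_coeff \<kappa> n m = \<kappa> ^ n * sqrt ((2 * real n + 1) / (4 * pi) * fact (n - m) / fact (n + m))
     * (-1) ^ m * (fact (n + m) / (2 ^ n * fact n))"

text \<open>The wave contains the conjugate of a spherical harmonic, hence \<open>y\<^sub>1 - i y\<^sub>2\<close> for positive order.\<close>

definition orientation :: "int \<Rightarrow> real" where "orientation m = (if m \<ge> 0 then - 1 else 1)"

lemma orientation_square [simp]: "(orientation m)\<^sup>2 = 1" by (simp add: orientation_def)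

lemma wave_coeff_nonzero: "\<kappa> > 0 \<Longrightarrow> wave_coeff \<kappa> n m \<noteq> 0"
  by (simp add: wave_coeff_def)

lemma azimuthal_polar:
  "of_real (cmod (Complex (d$1) (d$2)) ^ nat \<bar>m\<bar>) * cnj (cis (of_int m * Arg (Complex (d$1) (d$2)))) = azimuthal (orientation m) d ^ nat \<bar>m\<bar>"
proof -
  let ?u = "Complex (d$1) (d$2)"
  have u: "of_real (cmod ?u) * cis (Arg ?u) = ?u" using rcis_cmod_Arg[of ?u] by (simp add: rcis_def)
  have cu: "of_real (cmod ?u) * cis (- Arg ?u) = cnj ?u" using arg_cong[OF u, of cnj] by (simp add: cis_cnj)
  show ?thesis
  proof (cases "m \<ge> 0")
    case True
    then obtain k where "m = int k" by (metis nonneg_int_cases)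
    then have "cnj (cis (of_int m * Arg ?u)) = cis (- Arg ?u) ^ nat \<bar>m\<bar>"
      using Complex.DeMoivre[of "- Arg ?u" k] by (simp add: cis_cnj)
    moreover have "azimuthal (orientation m) d = cnj ?u" using True by (simp add: azimuthal_def orientation_def complex_eq_iff)
    ultimately show ?thesis using cu by (simp add: power_mult_distrib[symmetric])
  next
    case False
    then obtain k where "m = - int k" by (metis linear nonpos_int_cases)
    then have "cnj (cis (of_int m * Arg ?u)) = cis (Arg ?u) ^ nat \<bar>m\<bar>"
      using Complex.DeMoivre[of "Arg ?u" k] by (simp add: cis_cnj)
    moreover have "azimuthal (orientation m) d = ?u" using False by (simp add: azimuthal_def orientation_def complex_eq_iff)
    ultimately show ?thesis using u by (simp add: power_mult_distrib[symmetric])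
  qed
qed

text \<open>The polar coordinates combine into an entire function of \<open>|y|\<^sup>2\<close> and a polynomial; in particular
  the origin and the poles are regular.\<close>

lemma wave_eq:
  assumes m: "m \<in> {- int n..int n}"
  shows "wave \<kappa> n m y = of_real (wave_coeff \<kappa> n (nat \<bar>m\<bar>)) * of_real (reduced_bessel n (\<kappa>\<^sup>2 * (norm y)\<^sup>2))
     * solid_harmonic (orientation m) n (n + nat \<bar>m\<bar>) y"
proof (cases "y = 0")
  case True
  show ?thesis
  proof (cases n)
    case 0
    then show ?thesis using True m
      by (simp add: wave_def spherical_bessel_eq sph_harm_def assoc_legendre_def legendre_def wave_coeff_def solid_harmonic_0)
  next
    case (Suc k)
    then show ?thesis using True
      by (simp add: wave_def spherical_bessel_eq solid_harmonic_def null_poly_def azimuthal_def)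
  qed
next
  case False
  let ?d = "sgn y" and ?m = "nat \<bar>m\<bar>"
  have d: "norm ?d = 1" using False by (simp add: norm_sgn)
  have y: "y = norm y *\<^sub>R ?d" using False by (simp add: sgn_div_norm)
  have sq: "sqrt (1 - (?d$3)\<^sup>2) = cmod (Complex (?d$1) (?d$2))"
  proof -
    have "(?d$1)\<^sup>2 + (?d$2)\<^sup>2 + (?d$3)\<^sup>2 = 1" using d by (simp add: norm_vec_def L2_set_def sum_3)
    then have "1 - (?d$3)\<^sup>2 = (?d$1)\<^sup>2 + (?d$2)\<^sup>2" by simp
    then show ?thesis by (simp add: cmod_def)
  qed
  let ?N = "sqrt ((2 * real n + 1) / (4 * pi) * fact (n - ?m) / fact (n + ?m))"
  let ?P = "poly ((pderiv ^^ ?m) (legendre n)) (?d$3)"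
  have "cnj (sph_harm n m ?d) = of_real (?N * ?P) * (of_real (cmod (Complex (?d$1) (?d$2)) ^ ?m) * cnj (cis (of_int m * Arg (Complex (?d$1) (?d$2)))))"
    unfolding sph_harm_def assoc_legendre_def sq by simp
  also have "\<dots> = of_real (?N * ?P) * azimuthal (orientation m) ?d ^ ?m"
    unfolding azimuthal_polar ..
  finally have Y: "cnj (sph_harm n m ?d) = of_real (?N * ?P) * azimuthal (orientation m) ?d ^ ?m" .
  have h: "solid_harmonic (orientation m) n (n + ?m) y = of_real (norm y) ^ n * ((-1) ^ ?m * azimuthal (orientation m) ?d ^ ?m * of_real (2 ^ n * fact n / fact (n + ?m) * ?P))"
    using solid_harmonic_scale[of "orientation m" n "n + ?m" "norm y" ?d] solid_harmonic_sphere[OF orientation_square d, of m n ?m] y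
    by simp
  have w: "wave_coeff \<kappa> n ?m * (-1) ^ ?m * (2 ^ n * fact n / fact (n + ?m)) = \<kappa> ^ n * ?N"
  proof -
    have "k * N * e * (a / b) * e * (b / a) = k * N" if "e * e = 1" "a \<noteq> 0" "b \<noteq> 0" for k N e a b :: real
      using that by (simp add: mult.assoc)
    then show ?thesis unfolding wave_coeff_def by (rule, simp_all flip: power_mult_distrib)
  qed
  have c: "of_real (wave_coeff \<kappa> n ?m) * ((-1) ^ ?m * A * of_real (2 ^ n * fact n / fact (n + ?m) * p)) = of_real (\<kappa> ^ n) * (of_real (?N * p) * A)" for A :: complex and p :: real
  proof -
    have "of_real (wave_coeff \<kappa> n ?m) * ((-1) ^ ?m * A * of_real (2 ^ n * fact n / fact (n + ?m) * p))
       = of_real (wave_coeff \<kappa> n ?m * (-1) ^ ?m * (2 ^ n * fact n / fact (n + ?m))) * (of_real p * A)"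
      by (simp add: mult_ac)
    then show ?thesis unfolding w by (simp add: mult_ac)
  qed
  have "wave \<kappa> n m y = of_real (norm y) ^ n * of_real (reduced_bessel n (\<kappa>\<^sup>2 * (norm y)\<^sup>2)) * (of_real (\<kappa> ^ n) * (of_real (?N * ?P) * azimuthal (orientation m) ?d ^ ?m))"
    unfolding wave_def Y spherical_bessel_eq by (simp add: power_mult_distrib mult_ac)
  then show ?thesis unfolding h c[symmetric] by (simp add: mult_ac)
qed

section \<open>Completeness of the spherical harmonics\<close>

text \<open>For fixed \<open>m\<close> the \<open>m\<close>-th derivatives of the Legendre polynomials have every degree once, hence span
  all polynomials.\<close>

lemma coeff_pderiv_legendre_top:
  "coeff ((pderiv ^^ m) (legendre (N + m))) N \<noteq> 0" "degree ((pderiv ^^ m) (legendre (N + m))) \<le> N"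
proof -
  let ?q = "[:-1, 0, 1:] ^ (N + m) :: real poly"
  have d: "degree ?q = 2 * (N + m)" by (simp add: degree_power_eq)
  have "coeff ?q (2 * (N + m)) = 1" using lead_coeff_power[of "[:-1, 0, 1:] :: real poly" "N + m"] d by simp
  moreover have l: "(pderiv ^^ m) (legendre (N + m)) = smult (1 / (2 ^ (N + m) * fact (N + m))) ((pderiv ^^ (m + (N + m))) ?q)"
    by (simp add: legendre_def higher_pderiv_smult funpow_add)
  ultimately show "coeff ((pderiv ^^ m) (legendre (N + m))) N \<noteq> 0"
    by (simp add: coeff_higher_pderiv pochhammer_eq_0_iff add_ac mult_2)

  show "degree ((pderiv ^^ m) (legendre (N + m))) \<le> N"
    unfolding l using degree_smult_le[of "1 / (2 ^ (N + m) * fact (N + m))" "(pderiv ^^ (m + (N + m))) ?q"]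
    by (simp add: degree_higher_pderiv d)
qed

text \<open>On the sphere every polynomial is a combination of \<open>(y\<^sub>1 \<plusminus> i y\<^sub>2)\<^sup>m q(y\<^sub>3)\<close> because
  \<open>(y\<^sub>1 + i y\<^sub>2)(y\<^sub>1 - i y\<^sub>2) = 1 - y\<^sub>3\<^sup>2\<close>. So \<open>f\<close> is orthogonal to all polynomials, by Stone--Weierstrass to all
  continuous functions, and finally to its own conjugate.\<close>

lemma sphere_harmonics_complete:
  fixes f :: "real^3 \<Rightarrow> complex"
  assumes f: "continuous_on (sphere 0 1) f"
    and orth: "\<And>s n m. s\<^sup>2 = 1 \<Longrightarrow> m \<le> n \<Longrightarrow> (LINT d|sphere_measure. f d * solid_harmonic s n (n + m) d) = 0"
    and d: "norm d = 1"
  shows "f d = 0"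
proof -
  let ?I = "integral\<^sup>L sphere_measure :: (real^3 \<Rightarrow> complex) \<Rightarrow> complex"
  have int: "integrable sphere_measure (\<lambda>d. f d * g d)" if "continuous_on (sphere 0 1) g" for g
    by (intro integrable_sphere continuous_intros f that)
  have cp: "continuous_on S (\<lambda>d :: real^3. complex_of_real (poly q (d$3)))" for q S
    by (intro continuous_intros)
  have leg: "?I (\<lambda>d. f d * (azimuthal s d ^ m * of_real (poly ((pderiv ^^ m) (legendre (N + m))) (d$3)))) = 0"
    if s: "s\<^sup>2 = 1" for s m N
  proof -
    let ?c = "complex_of_real ((-1) ^ m * (2 ^ (N + m) * fact (N + m) / fact (N + m + m)))"
    have "?I (\<lambda>d. ?c * (f d * (azimuthal s d ^ m * of_real (poly ((pderiv ^^ m) (legendre (N + m))) (d$3))))) = 0"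
      (is "integral\<^sup>L _ ?l = 0")
    proof -
      have "?I ?l = ?I (\<lambda>d. f d * solid_harmonic s (N + m) (N + m + m) d)"
        by (rule Bochner_Integration.integral_cong) (simp_all add: solid_harmonic_sphere[OF s])
      then show ?thesis using orth[OF s, of m "N + m"] by simp
    qed
    then show ?thesis unfolding integral_mult_right_zero by simp
  qed
  have pol: "?I (\<lambda>d. f d * (azimuthal s d ^ m * of_real (poly q (d$3)))) = 0"
    if s: "s\<^sup>2 = 1" for s m and q :: "real poly"
  proof -
    have "\<And>q. degree q < N \<or> q = 0 \<Longrightarrow> ?I (\<lambda>d. f d * (azimuthal s d ^ m * of_real (poly q (d$3)))) = 0" for N
    proof (induction N)
      case 0 then show ?case by simp
    next
      case (Suc N)
      \<comment> \<open>Subtracting a multiple of the Legendre derivative of the same degree lowers the degree.\<close>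
      let ?L = "(pderiv ^^ m) (legendre (N + m))"
      define c where "c = coeff q N / coeff ?L N"
      define q' where "q' = q - smult c ?L"
      have "degree q \<le> N" using Suc.prems by auto
      then have dq: "degree q' \<le> N" unfolding q'_def
        using degree_diff_le[of q N "smult c ?L"] degree_smult_le[of c ?L] coeff_pderiv_legendre_top(2)[of m N] by linarith
      have "coeff q' N = 0" unfolding q'_def c_def using coeff_pderiv_legendre_top(1)[of m N] by simp
      with dq have "degree q' < N \<or> q' = 0"
        by (metis eq_zero_or_degree_less)
      from Suc.IH[OF this] have z: "?I (\<lambda>d. f d * (azimuthal s d ^ m * of_real (poly q' (d$3)))) = 0" .
      have "?I (\<lambda>d. f d * (azimuthal s d ^ m * of_real (poly q (d$3)))) =
         ?I (\<lambda>d. f d * (azimuthal s d ^ m * of_real (poly q' (d$3))) + of_real c * (f d * (azimuthal s d ^ m * of_real (poly ?L (d$3)))))"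
        by (rule Bochner_Integration.integral_cong) (simp_all add: q'_def algebra_simps)
      also have "\<dots> = ?I (\<lambda>d. f d * (azimuthal s d ^ m * of_real (poly q' (d$3)))) + of_real c * ?I (\<lambda>d. f d * (azimuthal s d ^ m * of_real (poly ?L (d$3))))"
        by (subst Bochner_Integration.integral_add)
           (auto intro!: int continuous_intros Bochner_Integration.integrable_mult_right cp)
      finally show ?case using z leg[OF s] by simp
    qed
    then show ?thesis by blast
  qed
  let ?u = "azimuthal 1" and ?v = "azimuthal (-1)"
  have uv: "?u d * ?v d = of_real (poly [:1, 0, -1:] (d$3))" if "norm d = 1" for d
  proof -
    have "?v d = cnj (?u d)" by (simp add: azimuthal_def complex_eq_iff)
    then show ?thesis using azimuthal_mult_cnj_sphere[of 1 d] that by (simp add: power2_eq_square eq_diff_eq)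
  qed
  have mon: "?I (\<lambda>d. f d * (?u d ^ a * ?v d ^ b * of_real (poly q (d$3)))) = 0" for a b and q :: "real poly"
  proof (induction "a + b" arbitrary: a b q rule: less_induct)
    case (less a b q)
    show ?case
    proof (cases "a = 0 \<or> b = 0")
      case True
      then show ?thesis using pol[of 1 a q] pol[of "-1" b q] by auto
    next
      case False
      then obtain a' b' where ab: "a = Suc a'" "b = Suc b'" by (metis not0_implies_Suc)
      have "?I (\<lambda>d. f d * (?u d ^ a * ?v d ^ b * of_real (poly q (d$3)))) =
         ?I (\<lambda>d. f d * (?u d ^ a' * ?v d ^ b' * of_real (poly ([:1, 0, -1:] * q) (d$3))))"
      proof (rule Bochner_Integration.integral_cong)
        fix d assume "d \<in> space sphere_measure"
        then have "?u d * ?v d = of_real (poly [:1, 0, -1:] (d$3))" by (intro uv) simp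
        then have "?u d ^ a * ?v d ^ b * of_real (poly q (d$3)) = ?u d ^ a' * ?v d ^ b' * (of_real (poly [:1, 0, -1:] (d$3)) * of_real (poly q (d$3)))"
          unfolding ab power_Suc by (metis (no_types, lifting) mult.assoc mult.left_commute)
        then show "f d * (?u d ^ a * ?v d ^ b * of_real (poly q (d$3))) = f d * (?u d ^ a' * ?v d ^ b' * of_real (poly ([:1, 0, -1:] * q) (d$3)))"
          by (simp only: poly_mult of_real_mult)
      qed simp
      then show ?thesis using less[of a' b' "[:1, 0, -1:] * q"] ab by simp
    qed
  qed
  let ?m = "\<lambda>a b c d. ?u d ^ a * ?v d ^ b * of_real (d$3) ^ c"
  \<comment> \<open>\<open>G\<close> collects the functions that are orthogonal to \<open>f\<close> together with all their monomial multiples.\<close>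
  define G where "G = {g. continuous_on (sphere 0 1) g \<and> (\<forall>a b c. ?I (\<lambda>d. f d * (g d * ?m a b c d)) = 0)}"
  have G1: "(\<lambda>d. 1) \<in> G"
  proof -
    have "?I (\<lambda>d. f d * (1 * ?m a b c d)) = 0" for a b c
      using mon[of a b "monom 1 c"] by (simp add: poly_monom)
    then show ?thesis unfolding G_def by auto
  qed
  have Gadd: "(\<lambda>d. g d + h d) \<in> G" if "g \<in> G" "h \<in> G" for g h
  proof -
    have "?I (\<lambda>d. f d * ((g d + h d) * ?m a b c d)) = 0" for a b c
    proof -
      have "?I (\<lambda>d. f d * ((g d + h d) * ?m a b c d)) =
         ?I (\<lambda>d. f d * (g d * ?m a b c d) + f d * (h d * ?m a b c d))"
        by (rule Bochner_Integration.integral_cong) (simp_all add: algebra_simps)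
      also have "\<dots> = ?I (\<lambda>d. f d * (g d * ?m a b c d)) + ?I (\<lambda>d. f d * (h d * ?m a b c d))"
        by (rule Bochner_Integration.integral_add) (use that in \<open>auto simp: G_def intro!: int continuous_intros\<close>)
      finally show ?thesis using that by (simp add: G_def)
    qed
    then show ?thesis using that unfolding G_def by (auto intro!: continuous_intros)
  qed
  have Gmul: "(\<lambda>d. k * g d) \<in> G" if "g \<in> G" for g k
    using that unfolding G_def by (auto intro!: continuous_intros simp: mult.assoc mult.left_commute[of _ k])
  have Gu: "(\<lambda>d. ?u d * g d) \<in> G" "(\<lambda>d. ?v d * g d) \<in> G" "(\<lambda>d. of_real (d$3) * g d) \<in> G" if "g \<in> G" for g
  proof -
    have z: "?I (\<lambda>d. f d * (g d * ?m a b c d)) = 0" for a b c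
      using that by (simp add: G_def)
    have c: "continuous_on (sphere 0 1) g" using that by (simp add: G_def)
    show "(\<lambda>d. ?u d * g d) \<in> G" using z[of "Suc _"] c unfolding G_def by (auto intro!: continuous_intros simp: mult_ac)
    show "(\<lambda>d. ?v d * g d) \<in> G" using z[of _ "Suc _"] c unfolding G_def by (auto intro!: continuous_intros simp: mult_ac)
    show "(\<lambda>d. of_real (d$3) * g d) \<in> G" using z[of _ _ "Suc _"] c unfolding G_def by (auto intro!: continuous_intros simp: mult_ac)
  qed
  have Gx: "(\<lambda>d. of_real (d$i) * g d) \<in> G" if "g \<in> G" for g i
  proof -
    have 1: "(\<lambda>d. of_real (d$1) * g d) = (\<lambda>d. (1/2) * (?u d * g d) + (1/2) * (?v d * g d))"
      by (auto simp: fun_eq_iff azimuthal_def algebra_simps)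
    have 2: "(\<lambda>d. of_real (d$2) * g d) = (\<lambda>d. (- \<i>/2) * (?u d * g d) + (\<i>/2) * (?v d * g d))"
      by (auto simp: fun_eq_iff azimuthal_def algebra_simps)
    show ?thesis
      using exhaust_3[of i] Gadd[OF Gmul[OF Gu(1)[OF that], of "1/2"] Gmul[OF Gu(2)[OF that], of "1/2"]]
        Gadd[OF Gmul[OF Gu(1)[OF that], of "- \<i>/2"] Gmul[OF Gu(2)[OF that], of "\<i>/2"]] Gu(3)[OF that] 1 2
      by auto
  qed
  have poly: "\<forall>g\<in>G. (\<lambda>d. of_real (p d) * g d) \<in> G" if "real_polynomial_function p" for p :: "real^3 \<Rightarrow> real"
    using that
  proof (induction p rule: real_polynomial_function.induct)
    case (linear p)
    have p: "p d = p (axis 1 1) * d$1 + p (axis 2 1) * d$2 + p (axis 3 1) * d$3" for d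
    proof -
      have "d = (d$1) *\<^sub>R axis 1 1 + (d$2) *\<^sub>R axis 2 1 + (d$3) *\<^sub>R axis 3 1"
        by (simp add: vec_eq_iff forall_3 axis_def)
      then have "p d = p ((d$1) *\<^sub>R axis 1 1 + (d$2) *\<^sub>R axis 2 1 + (d$3) *\<^sub>R axis 3 1)" by simp
      then show ?thesis using linear by (simp add: linear_simps mult.commute)
    qed
    show ?case
    proof
      fix g assume g: "g \<in> G"
      have "(\<lambda>d. of_real (p d) * g d) = (\<lambda>d. (of_real (p (axis 1 1)) * (of_real (d$1) * g d) + of_real (p (axis 2 1)) * (of_real (d$2) * g d)) + of_real (p (axis 3 1)) * (of_real (d$3) * g d))"
        by (rule ext, subst p) (simp add: algebra_simps)
      then show "(\<lambda>d. of_real (p d) * g d) \<in> G" by (simp only:) (intro Gadd Gmul Gx g)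
    qed
  next
    case (const c)
    then show ?case using Gmul by auto
  next
    case (add p q)
    show ?case
    proof
      fix g assume g: "g \<in> G"
      show "(\<lambda>d. of_real (p d + q d) * g d) \<in> G"
        using Gadd[OF add.IH(1)[rule_format, OF g] add.IH(2)[rule_format, OF g]] by (simp add: algebra_simps)
    qed
  next
    case (mult p q)
    show ?case
    proof
      fix g assume g: "g \<in> G"
      show "(\<lambda>d. of_real (p d * q d) * g d) \<in> G"
        using mult.IH(1)[rule_format, OF mult.IH(2)[rule_format, OF g]] by (simp add: mult.assoc)
    qed
  qed
  have poly0: "?I (\<lambda>d. f d * of_real (p d)) = 0" if "real_polynomial_function p" for p
  proof -
    have "?I (\<lambda>d. f d * ((of_real (p d) * 1) * (?u d ^ 0 * ?v d ^ 0 * of_real (d$3) ^ 0))) = 0"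
      using bspec[OF poly[OF that] G1] unfolding G_def by blast
    then show ?thesis by simp
  qed
  have cont0: "?I (\<lambda>d. f d * of_real (h d)) = 0" if h: "continuous_on (sphere 0 1) h" for h
  proof -
    obtain B where B: "\<And>d. norm d = 1 \<Longrightarrow> norm (f d) \<le> B"
    proof -
      have "bounded (f ` sphere 0 1)" by (intro compact_imp_bounded compact_continuous_image f) auto
      then obtain B where "\<forall>x\<in>f ` sphere 0 1. norm x \<le> B" unfolding bounded_iff by blast
      then show thesis by (intro that[of B]) auto
    qed
    have B0: "B \<ge> 0" using B[OF d] norm_ge_zero[of "f d"] by linarith
    have bd: "norm (?I (\<lambda>d. f d * of_real (h d))) \<le> B * sphere_area * e" if e: "e > 0" for e
    proof -
      obtain p where p: "real_polynomial_function p" and hp: "\<And>x. x \<in> sphere 0 1 \<Longrightarrow> \<bar>h x - p x\<bar> < e"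
        using Stone_Weierstrass_real_polynomial_function[OF compact_sphere h e] by blast
      have cpl: "continuous_on S p" for S
        using p continuous_on_polymonial_function real_polynomial_function_eq by blast
      have "?I (\<lambda>d. f d * of_real (h d)) = ?I (\<lambda>d. f d * of_real (h d) - f d * of_real (p d))"
        by (subst Bochner_Integration.integral_diff) (auto simp: poly0[OF p] intro!: int continuous_intros h cpl)
      also have "norm \<dots> \<le> (LINT d|sphere_measure. B * e)"
      proof (rule Bochner_Integration.integral_norm_bound_integral)
        show "integrable sphere_measure (\<lambda>d. f d * of_real (h d) - f d * of_real (p d))"
          by (intro Bochner_Integration.integrable_diff int continuous_intros h cpl)
        show "integrable sphere_measure (\<lambda>d. B * e)" by (intro integrable_sphere continuous_intros)
        fix d assume "d \<in> space sphere_measure"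
        then have d: "norm d = 1" by simp
        have "norm (f d * of_real (h d) - f d * of_real (p d)) = norm (f d) * \<bar>h d - p d\<bar>"
          by (simp add: norm_mult flip: right_diff_distrib of_real_diff)
        also have "\<dots> \<le> B * e" using B[OF d] hp[of d] d B0 by (intro mult_mono) auto
        finally show "norm (f d * of_real (h d) - f d * of_real (p d)) \<le> B * e" .
      qed
      also have "\<dots> = B * sphere_area * e" by (simp add: sphere_area_def)
      finally show ?thesis .
    qed
    have "norm (?I (\<lambda>d. f d * of_real (h d))) \<le> 0 + e" if e: "e > 0" for e
    proof -
      have K: "B * sphere_area \<ge> 0" using B0 sphere_area_pos by simp
      have "norm (?I (\<lambda>d. f d * of_real (h d))) \<le> B * sphere_area * (e / (B * sphere_area + 1))"
        by (rule bd) (use K e in simp)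
      also have "\<dots> \<le> e" using K e by (simp add: field_simps)
      finally show ?thesis by simp
    qed
    then have "norm (?I (\<lambda>d. f d * of_real (h d))) \<le> 0" by (rule field_le_epsilon)
    then show ?thesis by simp
  qed
  have "?I (\<lambda>d. f d * of_real (Re (f d))) = 0" "?I (\<lambda>d. f d * of_real (Im (f d))) = 0"
    by (intro cont0 continuous_intros f)+
  then have "?I (\<lambda>d. f d * of_real (Re (f d))) - \<i> * ?I (\<lambda>d. f d * of_real (Im (f d))) = 0" by simp
  also have "?I (\<lambda>d. f d * of_real (Re (f d))) - \<i> * ?I (\<lambda>d. f d * of_real (Im (f d))) =
     ?I (\<lambda>d. f d * of_real (Re (f d)) - \<i> * (f d * of_real (Im (f d))))"
    by (subst Bochner_Integration.integral_diff) (auto intro!: int continuous_intros f Bochner_Integration.integrable_mult_right)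
  also have "\<dots> = ?I (\<lambda>d. of_real ((cmod (f d))\<^sup>2))"
    by (rule Bochner_Integration.integral_cong) (simp_all add: complex_eq_iff cmod_power2, simp_all add: power2_eq_square)
  finally have "(LINT d|sphere_measure. (cmod (f d))\<^sup>2) = 0"
    by (simp only: integral_complex_of_real of_real_eq_0_iff)
  from sphere_integral_zero_imp_zero[OF _ _ this d] show ?thesis
    by (simp add: continuous_intros f)
qed

section \<open>Smooth functions\<close>

lemma pd_eqI: "((\<lambda>t. f (x + t *\<^sub>R axis i 1)) has_vector_derivative D) (at 0) \<Longrightarrow> pd i f x = D"
  unfolding pd_def by (rule vector_derivative_at)

text \<open>Partial derivatives are vector derivatives along lines, so all rules of calculus for them go through
  this lemma.\<close>

lemma pd_line:
  assumes "f differentiable (at x)"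
  shows "((\<lambda>t. f (x + t *\<^sub>R axis i 1)) has_vector_derivative pd i f x) (at 0)"
proof -
  from assms obtain f' where f': "(f has_derivative f') (at x)" unfolding differentiable_def by blast
  have "((\<lambda>t. x + t *\<^sub>R axis i 1) has_vector_derivative axis i 1) (at 0)"
    by (auto intro!: derivative_eq_intros)
  moreover have "(f has_derivative f') (at (x + 0 *\<^sub>R axis i 1))" using f' by simp
  ultimately have "((f \<circ> (\<lambda>t. x + t *\<^sub>R axis i 1)) has_vector_derivative f' (axis i 1)) (at 0)"
    by (intro vector_derivative_diff_chain_within) (auto intro: has_derivative_at_withinI)
  then have "((\<lambda>t. f (x + t *\<^sub>R axis i 1)) has_vector_derivative f' (axis i 1)) (at 0)"
    by (simp add: o_def)
  then show ?thesis using pd_eqI by metis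
qed

lemma pd_cong_open:
  assumes "open S" "x \<in> S" "\<And>z. z \<in> S \<Longrightarrow> f z = g z"
  shows "pd i f x = pd i g x"
proof -
  have "open ((\<lambda>t. x + t *\<^sub>R axis i 1) -` S)"
    by (intro open_vimage assms(1) continuous_intros)
  then have "eventually (\<lambda>t. x + t *\<^sub>R axis i 1 \<in> S) (nhds (0 :: real))"
    using assms(2) unfolding eventually_nhds by (intro exI[of _ "(\<lambda>t. x + t *\<^sub>R axis i 1) -` S"]) auto
  then have "eventually (\<lambda>t. f (x + t *\<^sub>R axis i 1) = g (x + t *\<^sub>R axis i 1)) (nhds 0)"
    by eventually_elim (rule assms(3))
  then show ?thesis unfolding pd_def by (intro vector_derivative_cong_eq) auto
qed

lemma pd_add: "f differentiable (at x) \<Longrightarrow> g differentiable (at x) \<Longrightarrow> pd i (\<lambda>x. f x + g x) x = pd i f x + pd i g x"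
  by (intro pd_eqI has_vector_derivative_add pd_line)

lemma pd_mult:
  assumes "f differentiable (at x)" "g differentiable (at x)"
  shows "pd i (\<lambda>x. f x * g x) x = f x * pd i g x + pd i f x * g x"
  using has_vector_derivative_mult[OF pd_line[OF assms(1)] pd_line[OF assms(2)], of i i] by (intro pd_eqI) simp

lemma pd_const [simp]: "pd i (\<lambda>x. c) x = 0"
  by (intro pd_eqI) simp

lemma pd_cmult: "f differentiable (at x) \<Longrightarrow> pd i (\<lambda>x. c * f x) x = c * pd i f x"
  using pd_mult[of "\<lambda>_. c" x f i] by simp

lemma Ck_mono: "Ck (Suc k) f \<Longrightarrow> Ck k f"
proof (induction k arbitrary: f)
  case 0 then show ?case by (auto intro: differentiable_imp_continuous_on)
next
  case (Suc k)
  then show ?case by (simp only: Ck.simps(2)[of k] Ck.simps(2)[of "Suc k"]) blast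
qed

lemma Cinf_differentiable: "f \<in> Cinf \<Longrightarrow> f differentiable (at x)"
  unfolding Cinf_def differentiable_on_def by (auto dest: spec[of _ "Suc 0"] simp: differentiable_on_def)

lemma Cinf_pd: "f \<in> Cinf \<Longrightarrow> pd i f \<in> Cinf"
proof -
  assume "f \<in> Cinf"
  then have "Ck (Suc k) f" for k by (simp only: Cinf_def mem_Collect_eq)
  then show ?thesis by (simp add: Cinf_def)
qed

lemma Cinf_continuous: "f \<in> Cinf \<Longrightarrow> continuous_on S f"
  unfolding Cinf_def using continuous_on_subset[of UNIV f S] by (auto dest: spec[of _ 0])

lemma Ck_const: "Ck k (\<lambda>x. c)"
proof (induction k arbitrary: c)
  case (Suc k)
  have "pd i (\<lambda>x. c) = (\<lambda>x. 0)" for i by (simp add: fun_eq_iff)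
  then show ?case using Suc by (simp add: differentiable_on_const)
qed simp

lemma Ck_add: "Ck k f \<Longrightarrow> Ck k g \<Longrightarrow> Ck k (\<lambda>x. f x + g x)"
proof (induction k arbitrary: f g)
  case 0 then show ?case by (auto intro: continuous_intros)
next
  case (Suc k)
  then have d: "f differentiable (at x)" "g differentiable (at x)" for x by (auto simp: differentiable_on_def)
  have "pd i (\<lambda>x. f x + g x) = (\<lambda>x. pd i f x + pd i g x)" for i by (intro ext pd_add d)
  then show ?case using Suc by (auto intro: differentiable_on_add)
qed

lemma Ck_mult: "Ck k f \<Longrightarrow> Ck k g \<Longrightarrow> Ck k (\<lambda>x. f x * g x)"
proof (induction k arbitrary: f g)
  case 0 then show ?case by (auto intro: continuous_intros)
next
  case (Suc k)
  then have d: "f differentiable (at x)" "g differentiable (at x)" for x by (auto simp: differentiable_on_def)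
  have "pd i (\<lambda>x. f x * g x) = (\<lambda>x. f x * pd i g x + pd i f x * g x)" for i by (intro ext pd_mult d)
  moreover have "Ck k f" "Ck k g" using Suc.prems by (auto intro: Ck_mono)
  ultimately show ?case using Suc by (auto intro!: differentiable_on_mult Ck_add)
qed

lemma Ck_coordinate: "Ck k (\<lambda>x :: real^3. of_real (x$j))"
proof (cases k)
  case 0 then show ?thesis by (auto intro!: continuous_intros)
next
  case (Suc k')
  have p: "pd i (\<lambda>x :: real^3. of_real (x$j)) = (\<lambda>x. if i = j then 1 else 0)" for i
  proof (intro ext pd_eqI)
    fix x :: "real^3"
    have "((\<lambda>t. (x + t *\<^sub>R axis i 1) $ j) has_real_derivative (if i = j then 1 else 0)) (at 0)"
      by (auto simp: axis_def intro!: derivative_eq_intros)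
    then have "((\<lambda>t. complex_of_real ((x + t *\<^sub>R axis i 1) $ j)) has_vector_derivative of_real (if i = j then 1 else 0)) (at 0)"
      by (intro has_vector_derivative_of_real) (simp add: has_real_derivative_iff_has_vector_derivative)
    then show "((\<lambda>t. complex_of_real ((x + t *\<^sub>R axis i 1) $ j)) has_vector_derivative (if i = j then 1 else 0)) (at 0)"
      by (simp split: if_splits)
  qed
  have "(\<lambda>x :: real^3. complex_of_real (x$j)) differentiable_on UNIV"
    by (intro linear_imp_differentiable_on linearI) (auto simp: complex_eq_iff)
  moreover have "Ck k' (\<lambda>x :: real^3. if i = j then 1 else 0)" for i by (rule Ck_const)
  ultimately show ?thesis unfolding Suc Ck.simps p by simp
qed

lemma Cinf_const: "(\<lambda>x. c) \<in> Cinf" by (simp add: Cinf_def Ck_const)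
lemma Cinf_add: "f \<in> Cinf \<Longrightarrow> g \<in> Cinf \<Longrightarrow> (\<lambda>x. f x + g x) \<in> Cinf" by (simp add: Cinf_def Ck_add)
lemma Cinf_mult: "f \<in> Cinf \<Longrightarrow> g \<in> Cinf \<Longrightarrow> (\<lambda>x. f x * g x) \<in> Cinf" by (simp add: Cinf_def Ck_mult)
lemma Cinf_coordinate: "(\<lambda>x. of_real (x$j)) \<in> Cinf" by (simp add: Cinf_def Ck_coordinate)

text \<open>The whole sequence of derivatives of \<open>F 0\<close> is carried along, so that the statement is stable under
  differentiation and the order of smoothness can be increased by induction.\<close>

lemma Cinf_compose_real:
  fixes F :: "nat \<Rightarrow> real \<Rightarrow> complex" and u :: "real^3 \<Rightarrow> real"
  assumes F: "\<And>i s. (F i has_vector_derivative F (Suc i) s) (at s)" and u: "(\<lambda>x. of_real (u x)) \<in> Cinf"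
  shows "(\<lambda>x. F i (u x)) \<in> Cinf"
proof -
  have du: "u differentiable (at x)" for x
  proof -
    have "(Re \<circ> (\<lambda>x. complex_of_real (u x))) differentiable (at x)"
      by (intro differentiable_chain_at Cinf_differentiable[OF u] bounded_linear_imp_differentiable bounded_linear_Re)
    then show ?thesis by (simp add: o_def)
  qed
  have dF: "(\<lambda>x. F i (u x)) differentiable (at x)" for i x
  proof -
    have "F i differentiable (at (u x))" using F[of i "u x"] unfolding has_vector_derivative_def differentiable_def by blast
    then have "(F i \<circ> u) differentiable (at x)" by (intro differentiable_chain_at du)
    then show ?thesis by (simp add: o_def)
  qed
  have p: "pd j (\<lambda>x. F i (u x)) = (\<lambda>x. F (Suc i) (u x) * pd j (\<lambda>x. of_real (u x)) x)" for i j
  proof (intro ext pd_eqI)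
    fix x
    let ?u = "\<lambda>t. u (x + t *\<^sub>R axis j 1)"
    have l: "((\<lambda>t. complex_of_real (?u t)) has_vector_derivative pd j (\<lambda>x. of_real (u x)) x) (at 0)"
      using pd_line[OF Cinf_differentiable[OF u]] .
    have "((\<lambda>t. Re (complex_of_real (?u t))) has_vector_derivative Re (pd j (\<lambda>x. of_real (u x)) x)) (at 0)"
      by (rule bounded_linear.has_vector_derivative[OF bounded_linear_Re l])
    then have r: "(?u has_real_derivative Re (pd j (\<lambda>x. of_real (u x)) x)) (at 0)"
      by (simp add: has_real_derivative_iff_has_vector_derivative)
    have "((\<lambda>t. Im (complex_of_real (?u t))) has_vector_derivative Im (pd j (\<lambda>x. of_real (u x)) x)) (at 0)"
      by (rule bounded_linear.has_vector_derivative[OF bounded_linear_Im l])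
    then have "((\<lambda>t. 0 :: real) has_vector_derivative Im (pd j (\<lambda>x. of_real (u x)) x)) (at 0)" by simp
    from vector_derivative_unique_at[OF this has_vector_derivative_const]
    have "Im (pd j (\<lambda>x. of_real (u x)) x) = 0" .
    then have re: "of_real (Re (pd j (\<lambda>x. of_real (u x)) x)) = pd j (\<lambda>x. of_real (u x)) x"
      by (simp add: complex_eq_iff)
    have "((\<lambda>t. F i (?u t)) has_vector_derivative Re (pd j (\<lambda>x. of_real (u x)) x) *\<^sub>R F (Suc i) (?u 0)) (at 0)"
      by (rule has_vector_derivative_chain_real[OF r F])
    then show "((\<lambda>t. F i (u (x + t *\<^sub>R axis j 1))) has_vector_derivative F (Suc i) (u x) * pd j (\<lambda>x. of_real (u x)) x) (at 0)"
      by (simp add: scaleR_conv_of_real re mult.commute)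
  qed
  have "Ck k (\<lambda>x. F i (u x))" for k i
  proof (induction k arbitrary: i)
    case 0
    then show ?case using dF[of i] by (auto intro!: differentiable_imp_continuous_on simp: differentiable_on_def)
  next
    case (Suc k)
    have "Ck k (pd j (\<lambda>x. of_real (u x)))" for j using Cinf_pd[OF u] by (simp add: Cinf_def)
    then show ?case using dF[of i] Suc by (auto simp: differentiable_on_def p intro: Ck_mult)
  qed
  then show ?thesis by (simp add: Cinf_def)
qed

lemma Cinf_norm_square: "(\<lambda>x. of_real ((norm x)\<^sup>2)) \<in> Cinf"
proof -
  have "(\<lambda>x :: real^3. complex_of_real ((norm x)\<^sup>2)) =
     (\<lambda>x. of_real (x$1) * of_real (x$1) + (of_real (x$2) * of_real (x$2) + of_real (x$3) * of_real (x$3)))"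
    by (simp add: fun_eq_iff power2_norm_eq_inner inner_vec_def sum_3)
  then show ?thesis by (simp only:) (intro Cinf_add Cinf_mult Cinf_coordinate)
qed

lemma Cinf_azimuthal: "azimuthal s \<in> Cinf"
proof -
  have "azimuthal s = (\<lambda>y. of_real (y$1) + (\<i> * of_real s) * of_real (y$2))"
    by (simp add: fun_eq_iff azimuthal_def)
  then show ?thesis by (simp only:) (intro Cinf_add Cinf_mult Cinf_coordinate Cinf_const)
qed

lemma Cinf_solid_harmonic: "solid_harmonic s n k \<in> Cinf"
proof (induction n arbitrary: k)
  case 0
  have "solid_harmonic s 0 k = (\<lambda>y. if k = 0 then 1 else 0)" by (simp add: fun_eq_iff solid_harmonic_0)
  then show ?case by (simp add: Cinf_const)
next
  case (Suc n)
  have ca: "(\<lambda>y. cnj (azimuthal s y)) \<in> Cinf"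
  proof -
    have "(\<lambda>y. cnj (azimuthal s y)) = azimuthal (- s)" by (simp add: fun_eq_iff azimuthal_def)
    then show ?thesis by (simp add: Cinf_azimuthal)
  qed
  have e: "solid_harmonic s (Suc n) k = (\<lambda>y. (cnj (azimuthal s y) * solid_harmonic s n k y
     + ((if k \<ge> 1 then 2 else 0) * of_real (y$3)) * solid_harmonic s n (k - 1) y)
     + ((if k \<ge> 2 then -1 else 0) * azimuthal s y) * solid_harmonic s n (k - 2) y)"
    by (simp add: fun_eq_iff solid_harmonic_Suc)
  show ?case unfolding e
    by (intro Cinf_add Cinf_mult ca Suc Cinf_const Cinf_coordinate Cinf_azimuthal)
qed

text \<open>The wave without its normalisation; it is manifestly smooth.\<close>

definition regular_wave :: "real \<Rightarrow> real \<Rightarrow> nat \<Rightarrow> nat \<Rightarrow> real^3 \<Rightarrow> complex" where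
  "regular_wave \<kappa> s n k y = of_real (reduced_bessel n (\<kappa>\<^sup>2 * (norm y)\<^sup>2)) * solid_harmonic s n k y"

lemma Cinf_regular_wave: "regular_wave \<kappa> s n k \<in> Cinf"
proof -
  let ?F = "\<lambda>i s. complex_of_real ((- \<kappa>\<^sup>2 / 2) ^ i * reduced_bessel (n + i) (\<kappa>\<^sup>2 * s))"
  have "(?F i has_vector_derivative ?F (Suc i) s) (at s)" for i s
  proof -
    have "((\<lambda>s. \<kappa>\<^sup>2 * s) has_real_derivative \<kappa>\<^sup>2) (at s)" by (auto intro!: derivative_eq_intros)
    from DERIV_cmult[OF DERIV_chain2[OF reduced_bessel_derivative this, of "n + i"], of "(- \<kappa>\<^sup>2 / 2) ^ i"]
    have "((\<lambda>s. (- \<kappa>\<^sup>2 / 2) ^ i * reduced_bessel (n + i) (\<kappa>\<^sup>2 * s)) has_real_derivative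
        (- \<kappa>\<^sup>2 / 2) ^ Suc i * reduced_bessel (n + Suc i) (\<kappa>\<^sup>2 * s)) (at s)"
      by (simp add: mult_ac)
    then show ?thesis by (intro has_vector_derivative_of_real) (simp add: has_real_derivative_iff_has_vector_derivative)
  qed
  from Cinf_compose_real[where F="?F" and i=0, OF this Cinf_norm_square]
  have "(\<lambda>y :: real^3. complex_of_real (reduced_bessel n (\<kappa>\<^sup>2 * (norm y)\<^sup>2))) \<in> Cinf" by simp
  from Cinf_mult[OF this Cinf_solid_harmonic] show ?thesis unfolding regular_wave_def[abs_def] .
qed

lemma wave_eq_regular_wave:
  "m \<in> {- int n..int n} \<Longrightarrow> wave \<kappa> n m = (\<lambda>y. of_real (wave_coeff \<kappa> n (nat \<bar>m\<bar>)) * regular_wave \<kappa> (orientation m) n (n + nat \<bar>m\<bar>) y)"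
  by (simp add: fun_eq_iff wave_eq regular_wave_def mult.assoc)

lemma dyadic_component: "dyadic \<kappa> f y $ i $ j = (if i = j then f y else 0) + of_real (1 / \<kappa>\<^sup>2) * pd i (pd j f) y"
  by (simp add: dyadic_def mat_def hessian_def) (simp add: scaleR_conv_of_real)

lemma dyadic_cmult:
  assumes "f \<in> Cinf"
  shows "dyadic \<kappa> (\<lambda>y. c * f y) y $ i $ j = c * dyadic \<kappa> f y $ i $ j"
proof -
  have p: "pd j (\<lambda>y. c * f y) = (\<lambda>y. c * pd j f y)" for j by (intro ext pd_cmult Cinf_differentiable assms)
  show ?thesis unfolding dyadic_component p
    by (simp add: pd_cmult[OF Cinf_differentiable[OF Cinf_pd[OF assms]]] algebra_simps)
qed

section \<open>The dyadic kernel\<close>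

definition point_kernel :: "real \<Rightarrow> nat \<Rightarrow> real^3 \<Rightarrow> real^3 \<Rightarrow> complex" where
  "point_kernel \<kappa> m x y = radial_kernel \<kappa> m ((norm (x - y))\<^sup>2)"

text \<open>The entries of \<open>(I + \<kappa>\<^sup>-\<^sup>2\<nabla>\<nabla>)g\<close>, from \<open>\<partial>\<^sub>j k(|x - y|\<^sup>2) = 2(x - y)\<^sub>j k'(|x - y|\<^sup>2)\<close>.\<close>

definition kernel_tensor :: "real \<Rightarrow> 3 \<Rightarrow> 3 \<Rightarrow> real^3 \<Rightarrow> real^3 \<Rightarrow> complex" where
  "kernel_tensor \<kappa> i j x y = (if i = j then point_kernel \<kappa> 0 x y else 0) + of_real (1 / \<kappa>\<^sup>2) *
     ((if i = j then 2 else 0) * point_kernel \<kappa> (Suc 0) x y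
      + of_real (2 * (x - y)$j) * (of_real (2 * (x - y)$i) * point_kernel \<kappa> (Suc (Suc 0)) x y))"

lemma green_eq_point_kernel: "green \<kappa> x y = point_kernel \<kappa> 0 x y"
  by (simp add: green_def point_kernel_def)

lemma point_kernel_commute: "point_kernel \<kappa> m x y = point_kernel \<kappa> m y x"
  by (simp add: point_kernel_def norm_minus_commute)

lemma kernel_tensor_commute: "kernel_tensor \<kappa> i j x y = kernel_tensor \<kappa> i j y x"
proof -
  have "of_real (2 * (x - y)$j) * (of_real (2 * (x - y)$i) * z) = of_real (2 * (y - x)$j) * (of_real (2 * (y - x)$i) * z)" for z :: complex
    by (simp add: algebra_simps)
  then show ?thesis unfolding kernel_tensor_def point_kernel_commute[of \<kappa> _ x y] by simp
qed

lemma kernel_tensor_symmetric: "kernel_tensor \<kappa> i j x y = kernel_tensor \<kappa> j i x y"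
  by (simp add: kernel_tensor_def mult.left_commute)

lemma continuous_on_point_kernel:
  assumes "continuous_on S f" "continuous_on S g" "\<And>p. p \<in> S \<Longrightarrow> f p \<noteq> g p"
  shows "continuous_on S (\<lambda>p. point_kernel \<kappa> m (f p) (g p))"
  unfolding point_kernel_def
proof (rule continuous_on_compose2[OF continuous_on_radial_kernel])
  show "(\<lambda>p. (norm (f p - g p))\<^sup>2) ` S \<subseteq> {0<..}" using assms(3) by auto
qed (intro continuous_intros assms)

lemma continuous_on_kernel_tensor:
  assumes "continuous_on S f" "continuous_on S g" "\<And>p. p \<in> S \<Longrightarrow> f p \<noteq> g p"
  shows "continuous_on S (\<lambda>p. kernel_tensor \<kappa> i j (f p) (g p))"
proof -
  have "continuous_on S (\<lambda>p. if i = j then point_kernel \<kappa> 0 (f p) (g p) else 0)"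
    using continuous_on_point_kernel[OF assms, of \<kappa> 0] by (cases "i = j") auto
  then show ?thesis unfolding kernel_tensor_def
    by (intro continuous_on_add continuous_on_mult continuous_on_const continuous_on_point_kernel assms continuous_on_of_real
        continuous_on_component continuous_on_diff)
qed

lemma point_kernel_line:
  assumes "x + \<tau> *\<^sub>R axis i 1 \<noteq> y"
  shows "((\<lambda>t. point_kernel \<kappa> m (x + t *\<^sub>R axis i 1) y) has_vector_derivative
     of_real (2 * (x + \<tau> *\<^sub>R axis i 1 - y)$i) * point_kernel \<kappa> (Suc m) (x + \<tau> *\<^sub>R axis i 1) y) (at \<tau>)"
  unfolding point_kernel_def scaleR_conv_of_real[symmetric]
proof (rule has_vector_derivative_chain_real[where f="\<lambda>t. (norm (x + t *\<^sub>R axis i 1 - y))\<^sup>2"])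
  show "(radial_kernel \<kappa> m has_vector_derivative radial_kernel \<kappa> (Suc m) ((norm (x + \<tau> *\<^sub>R axis i 1 - y))\<^sup>2)) (at ((norm (x + \<tau> *\<^sub>R axis i 1 - y))\<^sup>2))"
    using assms by (intro has_vector_derivative_radial_kernel) simp
  have e: "(\<lambda>t. (norm (x + t *\<^sub>R axis i 1 - y))\<^sup>2) = (\<lambda>t. (x - y) \<bullet> (x - y) + 2 * t * (x - y)$i + t\<^sup>2)"
  proof
    fix t :: real
    have "x + t *\<^sub>R axis i 1 - y = (x - y) + t *\<^sub>R axis i 1" by simp
    moreover have "(norm (z + t *\<^sub>R axis i 1))\<^sup>2 = z \<bullet> z + 2 * t * z$i + t\<^sup>2" for z :: "real^3"
      unfolding power2_norm_eq_inner
      by (simp add: inner_add_left inner_add_right inner_axis inner_axis' inner_axis_axis power2_eq_square algebra_simps)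
    ultimately show "(norm (x + t *\<^sub>R axis i 1 - y))\<^sup>2 = (x - y) \<bullet> (x - y) + 2 * t * (x - y)$i + t\<^sup>2" by (simp only:)
  qed
  show "((\<lambda>t. (norm (x + t *\<^sub>R axis i 1 - y))\<^sup>2) has_real_derivative 2 * (x + \<tau> *\<^sub>R axis i 1 - y)$i) (at \<tau>)"
    unfolding e by (auto intro!: derivative_eq_intros simp: axis_def algebra_simps)
qed

lemma point_kernel_second_line:
  assumes "x + \<tau> *\<^sub>R axis i 1 \<noteq> y"
  shows "((\<lambda>t. of_real (2 * (x + t *\<^sub>R axis i 1 - y)$j) * point_kernel \<kappa> (Suc 0) (x + t *\<^sub>R axis i 1) y) has_vector_derivative
     (if i = j then 2 else 0) * point_kernel \<kappa> (Suc 0) (x + \<tau> *\<^sub>R axis i 1) y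
      + of_real (2 * (x + \<tau> *\<^sub>R axis i 1 - y)$j) * (of_real (2 * (x + \<tau> *\<^sub>R axis i 1 - y)$i) * point_kernel \<kappa> (Suc (Suc 0)) (x + \<tau> *\<^sub>R axis i 1) y)) (at \<tau>)"
proof -
  have "((\<lambda>t. 2 * (x + t *\<^sub>R axis i 1 - y)$j) has_real_derivative (if i = j then 2 else 0)) (at \<tau>)"
    by (auto intro!: derivative_eq_intros simp: axis_def)
  then have "((\<lambda>t. complex_of_real (2 * (x + t *\<^sub>R axis i 1 - y)$j)) has_vector_derivative of_real (if i = j then 2 else 0)) (at \<tau>)"
    by (intro has_vector_derivative_of_real) (simp add: has_real_derivative_iff_has_vector_derivative)
  from has_vector_derivative_mult[OF this point_kernel_line[OF assms, of \<kappa> "Suc 0"]]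
  show ?thesis
    by (rule has_vector_derivative_eq_rhs) (simp del: vector_add_component vector_minus_component vector_scaleR_component of_real_mult)
qed

lemma pd_point_kernel: "x \<noteq> y \<Longrightarrow> pd j (\<lambda>z. point_kernel \<kappa> 0 z y) x = of_real (2 * (x - y)$j) * point_kernel \<kappa> (Suc 0) x y"
  using point_kernel_line[of x 0 j y \<kappa> 0] by (intro pd_eqI) simp

lemma green_tensor_eq:
  assumes "x \<noteq> y" shows "green_tensor \<kappa> x y $ i $ j = kernel_tensor \<kappa> i j x y"
proof -
  have "pd i (pd j (\<lambda>z. point_kernel \<kappa> 0 z y)) x = pd i (\<lambda>z. of_real (2 * (z - y)$j) * point_kernel \<kappa> (Suc 0) z y) x"
  proof (rule pd_cong_open[of "- {y}"])
    fix z assume "z \<in> - {y}"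
    then show "pd j (\<lambda>z. point_kernel \<kappa> 0 z y) z = of_real (2 * (z - y)$j) * point_kernel \<kappa> (Suc 0) z y"
      by (intro pd_point_kernel) simp
  qed (use assms in auto)
  also have "\<dots> = (if i = j then 2 else 0) * point_kernel \<kappa> (Suc 0) x y
      + of_real (2 * (x - y)$j) * (of_real (2 * (x - y)$i) * point_kernel \<kappa> (Suc (Suc 0)) x y)"
    using point_kernel_second_line[of x 0 i y j \<kappa>] assms by (intro pd_eqI) simp
  finally show ?thesis
    unfolding green_tensor_def dyadic_component green_eq_point_kernel kernel_tensor_def by simp
qed

lemma dyadic_cong_open:
  assumes "open S" "x \<in> S" "\<And>z. z \<in> S \<Longrightarrow> f z = g z"
  shows "dyadic \<kappa> f x = dyadic \<kappa> g x"
proof -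
  have "pd j f z = pd j g z" if "z \<in> S" for j z by (rule pd_cong_open[OF assms(1) that assms(3)])
  then have "pd i (pd j f) x = pd i (pd j g) x" for i j by (rule pd_cong_open[OF assms(1,2)])
  then show ?thesis using assms(2,3) by (simp add: vec_eq_iff dyadic_component)
qed

text \<open>Two differentiations under the sphere integral; \<open>y\<close> keeps a positive distance from the sphere of
  radius \<open>\<rho>\<close>.\<close>

lemma dyadic_superposition:
  fixes h :: "real^3 \<Rightarrow> complex"
  assumes h: "continuous_on (sphere 0 1) h" and y: "norm y < \<rho>"
  shows "dyadic \<kappa> (\<lambda>y. LINT d|sphere_measure. point_kernel \<kappa> 0 y (\<rho> *\<^sub>R d) * h d) y $ i $ j
       = (LINT d|sphere_measure. kernel_tensor \<kappa> i j y (\<rho> *\<^sub>R d) * h d)"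
proof -
  have \<rho>: "\<rho> > 0" using y norm_ge_zero[of y] by linarith
  have ne: "z \<noteq> \<rho> *\<^sub>R d" if "norm z < \<rho>" "norm d = 1" for z d :: "real^3"
    using that \<rho> by auto
  have ball: "norm (z + \<tau> *\<^sub>R axis l 1) < \<rho>" if "\<bar>\<tau> - 0\<bar> < \<rho> - norm z" for z :: "real^3" and \<tau> l
    using norm_triangle_ineq[of z "\<tau> *\<^sub>R axis l 1"] that by simp
  have cont: "continuous_on ({0 - e<..<0 + e} \<times> sphere 0 1) (\<lambda>p. point_kernel \<kappa> m (z + fst p *\<^sub>R axis l 1) (\<rho> *\<^sub>R snd p))"
    if "e = \<rho> - norm z" for e z m l
  proof (rule continuous_on_point_kernel)
    fix p assume "p \<in> {0 - e<..<0 + e} \<times> sphere (0 :: real^3) 1"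
    then have "\<bar>fst p - 0\<bar> < e" "norm (snd p) = 1" by auto
    then show "z + fst p *\<^sub>R axis l 1 \<noteq> \<rho> *\<^sub>R snd p" using that by (intro ne ball) auto
  qed (intro continuous_intros)+
  have h2: "continuous_on (A \<times> sphere 0 1) (\<lambda>p. h (snd p))" for A :: "real set"
    by (rule continuous_on_compose2[OF h]) (auto intro!: continuous_intros)
  have cont1: "continuous_on (sphere 0 1) (\<lambda>d. point_kernel \<kappa> m z (\<rho> *\<^sub>R d))" if "norm z < \<rho>" for m z
    by (rule continuous_on_point_kernel) (use that in \<open>auto intro!: continuous_intros ne\<close>)
  let ?v = "\<lambda>y. LINT d|sphere_measure. point_kernel \<kappa> 0 y (\<rho> *\<^sub>R d) * h d"
  let ?v1 = "\<lambda>y. LINT d|sphere_measure. of_real (2 * (y - \<rho> *\<^sub>R d)$j) * point_kernel \<kappa> (Suc 0) y (\<rho> *\<^sub>R d) * h d"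
  let ?K2 = "\<lambda>y d. (if i = j then 2 else 0) * point_kernel \<kappa> (Suc 0) y (\<rho> *\<^sub>R d)
      + of_real (2 * (y - \<rho> *\<^sub>R d)$j) * (of_real (2 * (y - \<rho> *\<^sub>R d)$i) * point_kernel \<kappa> (Suc (Suc 0)) y (\<rho> *\<^sub>R d))"
  have v1: "pd j ?v z = ?v1 z" if z: "norm z < \<rho>" for z
  proof (rule pd_eqI)
    have "((\<lambda>t. ?v (z + t *\<^sub>R axis j 1)) has_vector_derivative (LINT d|sphere_measure. of_real (2 * (z + 0 *\<^sub>R axis j 1 - \<rho> *\<^sub>R d)$j) * point_kernel \<kappa> (Suc 0) (z + 0 *\<^sub>R axis j 1) (\<rho> *\<^sub>R d) * h d)) (at 0)"
    proof (rule sphere_integral_leibniz[where e="\<rho> - norm z"])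
      fix \<tau> d assume "\<bar>\<tau> - 0\<bar> < \<rho> - norm z" "norm (d :: real^3) = 1"
      then have "z + \<tau> *\<^sub>R axis j 1 \<noteq> \<rho> *\<^sub>R d" by (intro ne ball) auto
      from has_vector_derivative_mult[OF point_kernel_line[OF this, of \<kappa> 0] has_vector_derivative_const, of "h d"]
      show "((\<lambda>\<tau>. point_kernel \<kappa> 0 (z + \<tau> *\<^sub>R axis j 1) (\<rho> *\<^sub>R d) * h d) has_vector_derivative
         of_real (2 * (z + \<tau> *\<^sub>R axis j 1 - \<rho> *\<^sub>R d)$j) * point_kernel \<kappa> (Suc 0) (z + \<tau> *\<^sub>R axis j 1) (\<rho> *\<^sub>R d) * h d) (at \<tau>)"
        by simp
    next
      fix \<tau> assume "\<bar>\<tau> - 0\<bar> < \<rho> - norm z"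
      then show "continuous_on (sphere 0 1) (\<lambda>d. point_kernel \<kappa> 0 (z + \<tau> *\<^sub>R axis j 1) (\<rho> *\<^sub>R d) * h d)"
        by (intro continuous_on_mult h cont1 ball)
    next
      show "continuous_on ({0 - (\<rho> - norm z)<..<0 + (\<rho> - norm z)} \<times> sphere 0 1)
         (\<lambda>(\<tau>, d). of_real (2 * (z + \<tau> *\<^sub>R axis j 1 - \<rho> *\<^sub>R d)$j) * point_kernel \<kappa> (Suc 0) (z + \<tau> *\<^sub>R axis j 1) (\<rho> *\<^sub>R d) * h d)"
        unfolding split_beta by (intro continuous_on_mult h2 cont refl continuous_intros)
    qed (use z in simp)
    then show "((\<lambda>t. ?v (z + t *\<^sub>R axis j 1)) has_vector_derivative ?v1 z) (at 0)" by simp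
  qed
  have "pd i (pd j ?v) y = pd i ?v1 y"
    by (rule pd_cong_open[of "ball 0 \<rho>"]) (use y v1 in auto)
  also have "\<dots> = (LINT d|sphere_measure. ?K2 y d * h d)"
  proof (rule pd_eqI)
    have "((\<lambda>t. ?v1 (y + t *\<^sub>R axis i 1)) has_vector_derivative (LINT d|sphere_measure. ?K2 (y + 0 *\<^sub>R axis i 1) d * h d)) (at 0)"
    proof (rule sphere_integral_leibniz[where e="\<rho> - norm y"])
      fix \<tau> d assume "\<bar>\<tau> - 0\<bar> < \<rho> - norm y" "norm (d :: real^3) = 1"
      then have "y + \<tau> *\<^sub>R axis i 1 \<noteq> \<rho> *\<^sub>R d" by (intro ne ball) auto
      from has_vector_derivative_mult[OF point_kernel_second_line[OF this, of j \<kappa>] has_vector_derivative_const, of "h d"]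
      show "((\<lambda>\<tau>. of_real (2 * (y + \<tau> *\<^sub>R axis i 1 - \<rho> *\<^sub>R d)$j) * point_kernel \<kappa> (Suc 0) (y + \<tau> *\<^sub>R axis i 1) (\<rho> *\<^sub>R d) * h d) has_vector_derivative
         ?K2 (y + \<tau> *\<^sub>R axis i 1) d * h d) (at \<tau>)"
        by (simp only: mult_zero_right add_0_left)
    next
      fix \<tau> assume "\<bar>\<tau> - 0\<bar> < \<rho> - norm y"
      then show "continuous_on (sphere 0 1) (\<lambda>d. of_real (2 * (y + \<tau> *\<^sub>R axis i 1 - \<rho> *\<^sub>R d)$j) * point_kernel \<kappa> (Suc 0) (y + \<tau> *\<^sub>R axis i 1) (\<rho> *\<^sub>R d) * h d)"
        by (intro continuous_on_mult h cont1 ball continuous_intros)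
    next
      show "continuous_on ({0 - (\<rho> - norm y)<..<0 + (\<rho> - norm y)} \<times> sphere 0 1)
         (\<lambda>(\<tau>, d). ?K2 (y + \<tau> *\<^sub>R axis i 1) d * h d)"
        unfolding split_beta by (intro continuous_on_mult continuous_on_add h2 cont refl continuous_intros)
    qed (use y in simp)
    then show "((\<lambda>t. ?v1 (y + t *\<^sub>R axis i 1)) has_vector_derivative (LINT d|sphere_measure. ?K2 y d * h d)) (at 0)" by simp
  qed
  finally have pd2: "pd i (pd j ?v) y = (LINT d|sphere_measure. ?K2 y d * h d)" .
  have c0: "continuous_on (sphere 0 1) (\<lambda>d. (if i = j then point_kernel \<kappa> 0 y (\<rho> *\<^sub>R d) else 0) * h d)"
    using cont1[OF y, of 0] h by (cases "i = j") (auto intro!: continuous_intros)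
  have c2: "continuous_on (sphere 0 1) (\<lambda>d. ?K2 y d * h d)"
    by (intro continuous_on_mult continuous_on_add h cont1[OF y] continuous_intros)
  have "(LINT d|sphere_measure. kernel_tensor \<kappa> i j y (\<rho> *\<^sub>R d) * h d) =
     (LINT d|sphere_measure. (if i = j then point_kernel \<kappa> 0 y (\<rho> *\<^sub>R d) else 0) * h d + of_real (1 / \<kappa>\<^sup>2) * (?K2 y d * h d))"
    unfolding kernel_tensor_def by (simp only: distrib_right mult.assoc)
  also have "\<dots> = (LINT d|sphere_measure. (if i = j then point_kernel \<kappa> 0 y (\<rho> *\<^sub>R d) else 0) * h d) + of_real (1 / \<kappa>\<^sup>2) * (LINT d|sphere_measure. ?K2 y d * h d)"
    unfolding integral_mult_right_zero[symmetric]
    by (rule Bochner_Integration.integral_add[OF integrable_sphere[OF c0] Bochner_Integration.integrable_mult_right[OF integrable_sphere[OF c2]]])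
  finally show ?thesis unfolding dyadic_component pd2 by (simp del: of_real_divide)
qed

text \<open>Integrating the dyadic kernel over an exterior sphere against a spherical harmonic produces the dyadic
  of the regular wave. The scalar identity holds on an open set, so it may be differentiated.\<close>

lemma kernel_tensor_moment:
  assumes \<kappa>: "\<kappa> > 0" and s: "s\<^sup>2 = 1" and y: "norm y < \<rho>" "y \<noteq> 0"
  shows "(LINT d|sphere_measure. kernel_tensor \<kappa> i j (\<rho> *\<^sub>R d) y * solid_harmonic s n k d)
     = multipole_coeff \<kappa> n \<rho> * dyadic \<kappa> (regular_wave \<kappa> s n k) y $ i $ j"
proof -
  have "(LINT d|sphere_measure. kernel_tensor \<kappa> i j (\<rho> *\<^sub>R d) y * solid_harmonic s n k d)
     = dyadic \<kappa> (\<lambda>y. LINT d|sphere_measure. point_kernel \<kappa> 0 y (\<rho> *\<^sub>R d) * solid_harmonic s n k d) y $ i $ j"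
    unfolding kernel_tensor_commute[of \<kappa> i j "\<rho> *\<^sub>R _" y]
    by (rule dyadic_superposition[OF continuous_on_solid_harmonic y(1), symmetric])
  also have "dyadic \<kappa> (\<lambda>y. LINT d|sphere_measure. point_kernel \<kappa> 0 y (\<rho> *\<^sub>R d) * solid_harmonic s n k d) y
     = dyadic \<kappa> (\<lambda>y. multipole_coeff \<kappa> n \<rho> * regular_wave \<kappa> s n k y) y"
  proof (rule dyadic_cong_open[of "ball 0 \<rho> - {0}"])
    fix z assume "z \<in> ball 0 \<rho> - {0 :: real^3}"
    then have z: "norm z < \<rho>" "z \<noteq> 0" by auto
    show "(LINT d|sphere_measure. point_kernel \<kappa> 0 z (\<rho> *\<^sub>R d) * solid_harmonic s n k d) = multipole_coeff \<kappa> n \<rho> * regular_wave \<kappa> s n k z"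
      using point_source_moment[OF \<kappa> s z, of n k]
      unfolding point_kernel_def norm_minus_commute[of z] regular_wave_def by (simp only: mult.assoc)
  qed (use y in auto)
  also have "\<dots> $ i $ j = multipole_coeff \<kappa> n \<rho> * dyadic \<kappa> (regular_wave \<kappa> s n k) y $ i $ j"
    by (rule dyadic_cmult[OF Cinf_regular_wave])
  finally show ?thesis .
qed

text \<open>Inherited from the kernel, whose Hessian is symmetric by its explicit form, through a sphere
  with nonzero multipole coefficient.\<close>

lemma hessian_regular_wave_symmetric:
  assumes \<kappa>: "\<kappa> > 0" and s: "s\<^sup>2 = 1" and y: "y \<noteq> 0"
  shows "pd i (pd j (regular_wave \<kappa> s n k)) y = pd j (pd i (regular_wave \<kappa> s n k)) y"
proof -
  have "eventually (\<lambda>\<rho>. multipole_coeff \<kappa> n \<rho> \<noteq> 0 \<and> norm y < \<rho>) at_top"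
    by (intro eventually_conj multipole_coeff_nonzero[OF \<kappa>] eventually_gt_at_top)
  then obtain \<rho> where \<rho>: "multipole_coeff \<kappa> n \<rho> \<noteq> 0" "norm y < \<rho>"
    using eventually_happens'[OF trivial_limit_at_top_linorder] by blast
  have "multipole_coeff \<kappa> n \<rho> * dyadic \<kappa> (regular_wave \<kappa> s n k) y $ i $ j = multipole_coeff \<kappa> n \<rho> * dyadic \<kappa> (regular_wave \<kappa> s n k) y $ j $ i"
    unfolding kernel_tensor_moment[OF \<kappa> s \<rho>(2) y, symmetric] kernel_tensor_symmetric[of \<kappa> i j] ..
  then have "of_real (1 / \<kappa>\<^sup>2) * pd i (pd j (regular_wave \<kappa> s n k)) y = of_real (1 / \<kappa>\<^sup>2) * pd j (pd i (regular_wave \<kappa> s n k)) y"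
    using \<rho>(1) by (simp add: dyadic_component split: if_splits)
  then show ?thesis using \<kappa> by simp
qed

section \<open>Integrals against the source\<close>

lemma borel_measurable_vecI:
  fixes f :: "'a \<Rightarrow> complex^3"
  assumes "\<And>i. (\<lambda>x. f x $ i) \<in> borel_measurable M"
  shows "f \<in> borel_measurable M"
proof (subst borel_measurable_euclidean_space, intro ballI)
  fix b :: "complex^3" assume "b \<in> Basis"
  then obtain i c where b: "b = axis i c" by (auto simp: Basis_vec_def)
  show "(\<lambda>x. f x \<bullet> b) \<in> borel_measurable M"
    unfolding b inner_axis using assms[of i] by simp
qed

lemma integrable_vecI:
  fixes f :: "'a \<Rightarrow> complex^3"
  assumes "\<And>i. integrable M (\<lambda>x. f x $ i)"
  shows "integrable M f"
proof (rule Bochner_Integration.integrable_bound)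
  show "integrable M (\<lambda>x. \<Sum>i\<in>UNIV. norm (f x $ i))"
    by (intro Bochner_Integration.integrable_sum integrable_norm assms)
  show "f \<in> borel_measurable M" by (intro borel_measurable_vecI borel_measurable_integrable assms)
  show "AE x in M. norm (f x) \<le> norm (\<Sum>i\<in>UNIV. norm (f x $ i))"
  proof (rule AE_I2)
    fix x
    have "norm (f x) \<le> (\<Sum>i\<in>UNIV. norm (f x $ i))"
      unfolding norm_vec_def by (rule L2_set_le_sum) simp
    then show "norm (f x) \<le> norm (\<Sum>i\<in>UNIV. norm (f x $ i))" by simp
  qed
qed

lemma integral_vec_component:
  fixes f :: "'a \<Rightarrow> complex^3"
  assumes "\<And>i. integrable M (\<lambda>x. f x $ i)"
  shows "(LINT x|M. f x) $ i = (LINT x|M. f x $ i)"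
  using integral_bounded_linear[OF bounded_linear_vec_nth integrable_vecI[OF assms], of i] by simp

lemma integrable_L2_ball:
  fixes f :: "real^3 \<Rightarrow> 'b :: euclidean_space"
  assumes "f \<in> L2 (ball 0 R)"
  shows "integrable (lebesgue_on (ball 0 R)) f"
proof (rule Bochner_Integration.integrable_bound)
  have fin: "finite_measure (lebesgue_on (ball 0 R :: (real^3) set))"
    by (intro finite_measure_lebesgue_on) simp
  then interpret finite_measure "lebesgue_on (ball 0 R :: (real^3) set)" .
  show "integrable (lebesgue_on (ball 0 R)) (\<lambda>x. 1 + (norm (f x))\<^sup>2)"
    using assms by (auto simp: L2_def)
  show "f \<in> borel_measurable (lebesgue_on (ball 0 R))" using assms by (simp add: L2_def)
  show "AE x in lebesgue_on (ball 0 R). norm (f x) \<le> norm (1 + (norm (f x))\<^sup>2)"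
  proof (rule AE_I2)
    fix x
    have "0 \<le> (norm (f x) - 1)\<^sup>2" by simp
    then have "2 * norm (f x) \<le> 1 + (norm (f x))\<^sup>2" by (simp add: power2_diff)
    then have "norm (f x) \<le> 1 + (norm (f x))\<^sup>2" using norm_ge_zero[of "f x"] by linarith
    then show "norm (f x) \<le> norm (1 + (norm (f x))\<^sup>2)" by simp
  qed
qed

text \<open>The complement of the support is a union of countably many open sets on which the source vanishes almost
  everywhere, by the Lindelof property.\<close>

lemma AE_outside_ess_support: "AE x in lebesgue. x \<notin> ess_support J \<longrightarrow> J x = 0"
proof -
  let ?F = "{U. open U \<and> (AE x in lebesgue. x \<in> U \<longrightarrow> J x = 0)}"
  obtain F' where F': "F' \<subseteq> ?F" "countable F'" "\<Union>F' = \<Union>?F"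
    using Lindelof[of ?F] by auto
  have "AE x in lebesgue. \<forall>U\<in>F'. x \<in> U \<longrightarrow> J x = 0"
    using F' by (subst AE_ball_countable) auto
  then show ?thesis
  proof eventually_elim
    case (elim x)
    then show ?case using F'(3) unfolding ess_support_def by blast
  qed
qed

text \<open>The kernel is singular when \<open>x\<close> and \<open>y\<close> meet on the boundary sphere. A slightly smaller ball that
  still carries the source keeps all kernels bounded.\<close>

lemma support_radius:
  assumes "R > 0" "compact (ess_support J)" "ess_support J \<subseteq> ball 0 R"
  obtains r where "0 < r" "r < R" "AE x in lebesgue. x \<notin> cball 0 r \<longrightarrow> J x = 0"
proof -
  obtain r where r: "0 < r" "r < R" "ess_support J \<subseteq> cball 0 r"
  proof (cases "ess_support J = {}")
    case True
    then show thesis using assms(1) by (intro that[of "R/2"]) auto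
  next
    case False
    obtain x where x: "x \<in> ess_support J" "\<And>y. y \<in> ess_support J \<Longrightarrow> norm y \<le> norm x"
      using continuous_attains_sup[OF assms(2) False continuous_on_norm[OF continuous_on_id]] by auto
    then have "norm x < R" using assms(3) by auto
    define q where "q = (norm x + R) / 2"
    have q: "2 * q = norm x + R" by (simp add: q_def)
    show thesis
    proof (rule that[of q])
      show "0 < q" using q assms(1) norm_ge_zero[of x] by linarith
      show "q < R" using q \<open>norm x < R\<close> by linarith
      show "ess_support J \<subseteq> cball 0 q"
      proof
        fix y assume "y \<in> ess_support J"
        from x(2)[OF this] have "norm y \<le> q" using q \<open>norm x < R\<close> by linarith
        then show "y \<in> cball 0 q" by simp
      qed
    qed
  qed
  have "AE x in lebesgue. x \<notin> cball 0 r \<longrightarrow> J x = 0"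
    using AE_outside_ess_support[of J] by eventually_elim (use r(3) in blast)
  with r(1,2) show thesis by (rule that)
qed

lemma integrable_mult_bounded_continuous:
  fixes \<phi> g :: "real^3 \<Rightarrow> complex"
  assumes \<phi>: "integrable (lebesgue_on S) \<phi>" and S: "S \<in> sets lebesgue"
    and g: "continuous_on S g" and B: "\<And>x. x \<in> S \<Longrightarrow> norm (g x) \<le> B"
  shows "integrable (lebesgue_on S) (\<lambda>x. g x * \<phi> x)"
proof (rule Bochner_Integration.integrable_bound)
  show "integrable (lebesgue_on S) (\<lambda>x. B * norm (\<phi> x))"
    by (intro Bochner_Integration.integrable_mult_right integrable_norm \<phi>)
  show "(\<lambda>x. g x * \<phi> x) \<in> borel_measurable (lebesgue_on S)"
    by (intro borel_measurable_times borel_measurable_integrable[OF \<phi>] continuous_imp_measurable_on_sets_lebesgue g S)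
  show "AE x in lebesgue_on S. norm (g x * \<phi> x) \<le> norm (B * norm (\<phi> x))"
  proof (rule AE_I2)
    fix x assume "x \<in> space (lebesgue_on S)"
    then have "x \<in> S" by (simp add: space_restrict_space)
    from B[OF this] show "norm (g x * \<phi> x) \<le> norm (B * norm (\<phi> x))"
      by (simp add: norm_mult) (meson abs_ge_self abs_ge_zero mult_right_mono norm_ge_zero order_trans)
  qed
qed

lemma integrable_mult_compact_continuous:
  fixes \<phi> g :: "real^3 \<Rightarrow> complex"
  assumes \<phi>: "integrable (lebesgue_on S) \<phi>" and S: "compact S" and g: "continuous_on S g"
  shows "integrable (lebesgue_on S) (\<lambda>x. g x * \<phi> x)"
proof -
  have "bounded (g ` S)" by (intro compact_imp_bounded compact_continuous_image g S)
  then obtain B where "\<forall>x\<in>g ` S. norm x \<le> B" unfolding bounded_iff by blast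
  then show ?thesis
    by (intro integrable_mult_bounded_continuous[OF \<phi> _ g, of B]) (use S in \<open>auto intro: fmeasurableD lmeasurable_compact\<close>)
qed

lemma integrable_lebesgue_on_subset:
  fixes f :: "real^3 \<Rightarrow> 'b :: {banach, second_countable_topology}"
  assumes "integrable (lebesgue_on T) f" "S \<subseteq> T" "S \<in> sets lebesgue" "T \<in> sets lebesgue"
  shows "integrable (lebesgue_on S) f"
proof -
  have "set_integrable lebesgue T f" using assms by (simp add: set_integrable_def integrable_restrict_space)
  then have "set_integrable lebesgue S f" by (rule set_integrable_subset[OF _ assms(3,2)])
  then show ?thesis using assms by (simp add: set_integrable_def integrable_restrict_space)
qed

lemma set_integral_source_cut:
  fixes J :: "real^3 \<Rightarrow> complex^3" and F :: "real^3 \<Rightarrow> 'b :: euclidean_space"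
  assumes J0: "AE x in lebesgue. x \<notin> cball 0 r \<longrightarrow> J x = 0" and r: "r < R"
    and F: "F \<in> borel_measurable (lebesgue_on (ball 0 R))" and F0: "\<And>x. J x = 0 \<Longrightarrow> F x = 0"
  shows "(LINT y:ball 0 R|lebesgue. F y) = (LINT y|lebesgue_on (cball 0 r). F y)"
proof -
  have sub: "cball 0 r \<subseteq> ball (0 :: real^3) R" using r by auto
  have 1: "(\<lambda>x. indicator (ball 0 R) x *\<^sub>R F x) \<in> borel_measurable lebesgue"
    using F by (subst (asm) borel_measurable_restrict_space_iff) auto
  have "(\<lambda>x. indicator (cball 0 r) x *\<^sub>R (indicator (ball 0 R) x *\<^sub>R F x)) \<in> borel_measurable lebesgue"
    by (intro borel_measurable_scaleR borel_measurable_indicator 1) auto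
  moreover have "(\<lambda>x. indicator (cball 0 r) x *\<^sub>R (indicator (ball 0 R) x *\<^sub>R F x)) = (\<lambda>x. indicator (cball 0 r) x *\<^sub>R F x)"
    using sub by (auto simp: fun_eq_iff indicator_def)
  ultimately have 2: "(\<lambda>x. indicator (cball 0 r) x *\<^sub>R F x) \<in> borel_measurable lebesgue" by (simp only:)
  have "(LINT y:ball 0 R|lebesgue. F y) = (LINT y|lebesgue. indicator (cball 0 r) y *\<^sub>R F y)"
    unfolding set_lebesgue_integral_def
  proof (rule integral_cong_AE[OF 1 2])
    show "AE x in lebesgue. indicator (ball 0 R) x *\<^sub>R F x = indicator (cball 0 r) x *\<^sub>R F x"
      using J0
    proof eventually_elim
      case (elim x)
      then show ?case using sub F0[of x] by (auto simp: indicator_def)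
    qed
  qed
  also have "\<dots> = (LINT y|lebesgue_on (cball 0 r). F y)"
    by (subst integral_restrict_space) auto
  finally show ?thesis .
qed

lemma matrix_source_integral:
  fixes J :: "real^3 \<Rightarrow> complex^3" and \<Phi> :: "real^3 \<Rightarrow> complex^3^3"
  assumes J: "J \<in> L2 (ball 0 R)" and J0: "AE x in lebesgue. x \<notin> cball 0 r \<longrightarrow> J x = 0" and r: "r < R"
    and \<Phi>: "\<And>i j. continuous_on (ball 0 R) (\<lambda>y. \<Phi> y $ i $ j)"
  shows "(LINT y:ball 0 R|lebesgue. \<Phi> y *v J y) $ i = (\<Sum>j\<in>UNIV. LINT y|lebesgue_on (cball 0 r). \<Phi> y $ i $ j * J y $ j)"
proof -
  have sub: "cball 0 r \<subseteq> ball (0 :: real^3) R" using r by auto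
  have Jm: "(\<lambda>y. J y $ j) \<in> borel_measurable (lebesgue_on (ball 0 R))" for j
    by (rule borel_measurable_integrable[OF integrable_bounded_linear[OF bounded_linear_vec_nth integrable_L2_ball[OF J]]])
  have Ji: "integrable (lebesgue_on (cball 0 r)) (\<lambda>y. J y $ j)" for j
    by (rule integrable_lebesgue_on_subset[OF integrable_bounded_linear[OF bounded_linear_vec_nth integrable_L2_ball[OF J]] sub]) auto
  have ci: "integrable (lebesgue_on (cball 0 r)) (\<lambda>y. \<Phi> y $ i $ j * J y $ j)" for i j
    by (rule integrable_mult_compact_continuous[OF Ji]) (use sub in \<open>auto intro: continuous_on_subset[OF \<Phi>]\<close>)
  have m: "(\<lambda>y. \<Phi> y *v J y) \<in> borel_measurable (lebesgue_on (ball 0 R))"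
  proof (rule borel_measurable_vecI)
    fix i
    have m: "(\<lambda>y. \<Phi> y $ i $ j) \<in> borel_measurable (lebesgue_on (ball 0 R))" for j
      by (rule continuous_imp_measurable_on_sets_lebesgue[OF \<Phi>]) simp
    show "(\<lambda>y. (\<Phi> y *v J y) $ i) \<in> borel_measurable (lebesgue_on (ball 0 R))"
      unfolding matrix_vector_mult_def vec_lambda_beta by (intro borel_measurable_sum borel_measurable_times Jm m)
  qed
  have "(LINT y:ball 0 R|lebesgue. \<Phi> y *v J y) = (LINT y|lebesgue_on (cball 0 r). \<Phi> y *v J y)"
    by (rule set_integral_source_cut[OF J0 r m]) (simp add: matrix_vector_mult_def vec_eq_iff)
  moreover have "(LINT y|lebesgue_on (cball 0 r). \<Phi> y *v J y) $ i = (LINT y|lebesgue_on (cball 0 r). (\<Phi> y *v J y) $ i)"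
    by (rule integral_vec_component) (auto simp: matrix_vector_mult_def intro!: Bochner_Integration.integrable_sum ci)
  moreover have "(LINT y|lebesgue_on (cball 0 r). (\<Phi> y *v J y) $ i) = (\<Sum>j\<in>UNIV. LINT y|lebesgue_on (cball 0 r). \<Phi> y $ i $ j * J y $ j)"
    unfolding matrix_vector_mult_def by (simp add: Bochner_Integration.integral_sum[OF ci])
  ultimately show ?thesis by (simp only:)
qed

text \<open>On the compact set the kernel is bounded, and the source is integrable; so Fubini's theorem and dominated
  convergence apply.\<close>

lemma sphere_source_fubini:
  fixes T :: "real^3 \<Rightarrow> real^3 \<Rightarrow> complex" and \<phi> :: "real^3 \<Rightarrow> complex"
  assumes T: "continuous_on (sphere 0 1 \<times> cball 0 r) (\<lambda>(d, y). T d y)"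
    and \<phi>: "integrable (lebesgue_on (cball 0 r)) \<phi>"
  shows "(LINT d|sphere_measure. LINT y|lebesgue_on (cball 0 r). T d y * \<phi> y)
       = (LINT y|lebesgue_on (cball 0 r). (LINT d|sphere_measure. T d y) * \<phi> y)"
    and "continuous_on (sphere 0 1) (\<lambda>d. LINT y|lebesgue_on (cball 0 r). T d y * \<phi> y)"
    and "integrable (lebesgue_on (cball 0 r)) (\<lambda>y. (LINT d|sphere_measure. T d y) * \<phi> y)"
proof -
  let ?N = "lebesgue_on (cball (0 :: real^3) r)"
  interpret S: finite_measure sphere_measure by (rule finite_measure_sphere)
  have Nf: "finite_measure ?N" by (intro finite_measure_lebesgue_on) simp
  interpret N: finite_measure ?N by (rule Nf)
  interpret P: pair_sigma_finite sphere_measure ?N ..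
  have "compact (sphere (0 :: real^3) 1 \<times> cball (0 :: real^3) r)" by (intro compact_Times) auto
  then have "bounded ((\<lambda>(d, y). T d y) ` (sphere 0 1 \<times> cball 0 r))"
    by (intro compact_imp_bounded compact_continuous_image T)
  then obtain B where B0: "\<forall>z\<in>sphere 0 1 \<times> cball 0 r. norm (case z of (d, y) \<Rightarrow> T d y) \<le> B"
    unfolding bounded_iff by blast
  have B: "norm (T d y) \<le> B" if "norm d = 1" "norm y \<le> r" for d y
    using bspec[OF B0, of "(d, y)"] that by simp
  have Td: "continuous_on (cball 0 r) (T d)" if "norm d = 1" for d
    using continuous_on_compose2[OF T, of "cball 0 r" "\<lambda>y. (d, y)"] that by (force intro!: continuous_intros)
  have Ty: "continuous_on (sphere 0 1) (\<lambda>d. T d y)" if "norm y \<le> r" for y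
    using continuous_on_compose2[OF T, of "sphere 0 1" "\<lambda>d. (d, y)"] that by (force intro!: continuous_intros)
  have i1: "integrable ?N (\<lambda>y. T d y * \<phi> y)" if "norm d = 1" for d
    by (rule integrable_mult_compact_continuous[OF \<phi> _ Td[OF that]]) simp
  have meas: "(\<lambda>p. T (fst p) (snd p) * \<phi> (snd p)) \<in> borel_measurable (sphere_measure \<Otimes>\<^sub>M ?N)"
  proof (rule borel_measurable_times)
    have idm: "(\<lambda>p. (fst p, snd p)) \<in> measurable (sphere_measure \<Otimes>\<^sub>M ?N) (restrict_space borel (sphere 0 1 \<times> cball 0 r))"
    proof (rule measurable_restrict_space2)
      show "(\<lambda>p. (fst p, snd p)) \<in> space (sphere_measure \<Otimes>\<^sub>M ?N) \<rightarrow> sphere 0 1 \<times> cball 0 r"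
        by (auto simp: space_pair_measure space_restrict_space)
      have f: "fst \<in> borel_measurable (sphere_measure \<Otimes>\<^sub>M ?N)"
        using measurable_compose[OF measurable_fst borel_measurable_sphere[of "\<lambda>x. x"]] continuous_on_id by auto
      have "(\<lambda>x. x) \<in> borel_measurable ?N"
        by (rule continuous_imp_measurable_on_sets_lebesgue) (auto intro: continuous_intros)
      then have s: "snd \<in> borel_measurable (sphere_measure \<Otimes>\<^sub>M ?N)"
        using measurable_compose[OF measurable_snd] by auto
      show "(\<lambda>p. (fst p, snd p)) \<in> borel_measurable (sphere_measure \<Otimes>\<^sub>M ?N)"
        using f s by (rule borel_measurable_Pair)
    qed
    have "(\<lambda>(d, y). T d y) \<in> borel_measurable (restrict_space borel (sphere 0 1 \<times> cball 0 r))"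
      by (rule borel_measurable_continuous_on_restrict[OF T])
    from measurable_compose[OF idm this] show "(\<lambda>p. T (fst p) (snd p)) \<in> borel_measurable (sphere_measure \<Otimes>\<^sub>M ?N)"
      by simp
    show "(\<lambda>p. \<phi> (snd p)) \<in> borel_measurable (sphere_measure \<Otimes>\<^sub>M ?N)"
      by (rule measurable_compose[OF measurable_snd borel_measurable_integrable[OF \<phi>]])
  qed
  have "integrable (sphere_measure \<Otimes>\<^sub>M ?N) (\<lambda>p. T (fst p) (snd p) * \<phi> (snd p))"
  proof (rule P.Fubini_integrable[OF meas])
    have "(\<lambda>d. LINT y|?N. norm (T d y * \<phi> y)) \<in> borel_measurable sphere_measure"
      using measurable_compose[OF meas borel_measurable_norm] by (intro N.borel_measurable_lebesgue_integral) (simp add: split_beta)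
    moreover have "norm (LINT y|?N. norm (T d y * \<phi> y)) \<le> (LINT y|?N. B * norm (\<phi> y))" if "norm d = 1" for d
    proof -
      have "(LINT y|?N. norm (T d y * \<phi> y)) \<le> (LINT y|?N. B * norm (\<phi> y))"
        by (rule integral_mono[OF integrable_norm[OF i1[OF that]] Bochner_Integration.integrable_mult_right[OF integrable_norm[OF \<phi>]]])
           (use B that in \<open>auto simp: norm_mult space_restrict_space intro!: mult_right_mono\<close>)
      then show ?thesis by simp
    qed
    ultimately show "integrable sphere_measure (\<lambda>d. LINT y|?N. norm (T (fst (d, y)) (snd (d, y)) * \<phi> (snd (d, y))))"
      by (intro S.integrable_const_bound[of _ "LINT y|?N. B * norm (\<phi> y)"] AE_I2) auto
    show "AE d in sphere_measure. integrable ?N (\<lambda>y. T (fst (d, y)) (snd (d, y)) * \<phi> (snd (d, y)))"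
      by (rule AE_I2) (use i1 in auto)
  qed
  then have prod: "integrable (sphere_measure \<Otimes>\<^sub>M ?N) (\<lambda>(d, y). T d y * \<phi> y)" by (simp only: case_prod_beta')
  from P.integrable_snd[OF this] show "integrable ?N (\<lambda>y. (LINT d|sphere_measure. T d y) * \<phi> y)" by simp
  from P.Fubini_integral[OF prod]
  have "(LINT d|sphere_measure. LINT y|?N. T d y * \<phi> y) = (LINT y|?N. LINT d|sphere_measure. T d y * \<phi> y)" by simp
  also have "\<dots> = (LINT y|?N. (LINT d|sphere_measure. T d y) * \<phi> y)"
    by simp
  finally show "(LINT d|sphere_measure. LINT y|?N. T d y * \<phi> y) = (LINT y|?N. (LINT d|sphere_measure. T d y) * \<phi> y)" .
  show "continuous_on (sphere 0 1) (\<lambda>d. LINT y|?N. T d y * \<phi> y)"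
    unfolding continuous_on_sequentially
  proof (intro ballI allI impI)
    fix X :: "nat \<Rightarrow> real^3" and d assume d: "d \<in> sphere 0 1" and X: "(\<forall>i. X i \<in> sphere 0 1) \<and> X \<longlonglongrightarrow> d"
    have "(\<lambda>i. LINT y|?N. T (X i) y * \<phi> y) \<longlonglongrightarrow> (LINT y|?N. T d y * \<phi> y)"
    proof (rule integral_dominated_convergence[where w="\<lambda>y. B * norm (\<phi> y)"])
      show "(\<lambda>y. T d y * \<phi> y) \<in> borel_measurable ?N" using d by (intro borel_measurable_integrable i1) simp
      show "(\<lambda>y. T (X i) y * \<phi> y) \<in> borel_measurable ?N" for i using X by (intro borel_measurable_integrable i1) simp
      show "integrable ?N (\<lambda>y. B * norm (\<phi> y))"
        by (intro Bochner_Integration.integrable_mult_right integrable_norm \<phi>)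
      show "AE y in ?N. (\<lambda>i. T (X i) y * \<phi> y) \<longlonglongrightarrow> T d y * \<phi> y"
      proof (rule AE_I2)
        fix y assume "y \<in> space ?N"
        then have "norm y \<le> r" by (simp add: space_restrict_space)
        from Ty[OF this] have "(\<lambda>i. T (X i) y) \<longlonglongrightarrow> T d y"
          using d X unfolding continuous_on_sequentially comp_def by blast
        then show "(\<lambda>i. T (X i) y * \<phi> y) \<longlonglongrightarrow> T d y * \<phi> y" by (intro tendsto_mult tendsto_const)
      qed
      show "AE y in ?N. norm (T (X i) y * \<phi> y) \<le> B * norm (\<phi> y)" for i
        by (rule AE_I2) (use X B in \<open>auto simp: norm_mult space_restrict_space intro!: mult_right_mono\<close>)
    qed
    then show "((\<lambda>d. LINT y|?N. T d y * \<phi> y) \<circ> X) \<longlonglongrightarrow> (LINT y|?N. T d y * \<phi> y)" by (simp add: o_def)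
  qed
qed

section \<open>Nonradiating sources and wave moments\<close>

definition wave_moment :: "real \<Rightarrow> real \<Rightarrow> (real^3 \<Rightarrow> complex^3) \<Rightarrow> real \<Rightarrow> nat \<Rightarrow> nat \<Rightarrow> complex^3" where
  "wave_moment \<kappa> R J s n k = (LINT y:ball 0 R|lebesgue. dyadic \<kappa> (regular_wave \<kappa> s n k) y *v J y)"

lemma continuous_on_dyadic: "f \<in> Cinf \<Longrightarrow> continuous_on S (\<lambda>y. dyadic \<kappa> f y $ i $ j)"
proof -
  assume f: "f \<in> Cinf"
  have c: "continuous_on S (\<lambda>y. if i = j then f y else 0)" using Cinf_continuous[OF f, of S] by (cases "i = j") auto
  show ?thesis unfolding dyadic_component
    by (intro continuous_on_add[OF c] continuous_on_mult continuous_on_const Cinf_continuous Cinf_pd f)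
qed

text \<open>The central identity: by Fubini, the coefficients of the field on an exterior sphere are the moments of
  the source against regular waves, up to multipole coefficients. Both directions of the
  characterisation follow from it.\<close>

lemma field_moment:
  fixes J :: "real^3 \<Rightarrow> complex^3"
  assumes \<kappa>: "\<kappa> > 0" and s: "s\<^sup>2 = 1" and J: "J \<in> L2 (ball 0 R)"
    and J0: "AE x in lebesgue. x \<notin> cball 0 r \<longrightarrow> J x = 0" and r: "0 < r" "r < R" and \<rho>: "R \<le> \<rho>"
  shows "(LINT d|sphere_measure. electric_field \<kappa> R J (\<rho> *\<^sub>R d) $ i * solid_harmonic s n k d)
      = multipole_coeff \<kappa> n \<rho> * wave_moment \<kappa> R J s n k $ i"
    and "continuous_on (sphere 0 1) (\<lambda>d. electric_field \<kappa> R J (\<rho> *\<^sub>R d) $ i)"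
proof -
  let ?N = "lebesgue_on (cball (0 :: real^3) r)"
  have sub: "cball 0 r \<subseteq> ball (0 :: real^3) R" using r by auto
  have \<rho>0: "\<rho> > 0" "r < \<rho>" using r \<rho> by auto
  have Ji: "integrable ?N (\<lambda>y. J y $ j)" for j
    by (rule integrable_lebesgue_on_subset[OF integrable_bounded_linear[OF bounded_linear_vec_nth integrable_L2_ball[OF J]] sub]) auto
  have ne: "\<rho> *\<^sub>R d \<noteq> y" if "norm d = 1" "norm y < \<rho>" for d y :: "real^3" using that \<rho>0 by auto
  let ?T = "\<lambda>i j d y. kernel_tensor \<kappa> i j (\<rho> *\<^sub>R d) y"
  have E: "electric_field \<kappa> R J (\<rho> *\<^sub>R d) $ i = (\<Sum>j\<in>UNIV. LINT y|?N. ?T i j d y * J y $ j)"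
    if d: "norm d = 1" for d i
  proof -
    have "continuous_on (ball 0 R) (\<lambda>y. green_tensor \<kappa> (\<rho> *\<^sub>R d) y $ i $ j)" for i j
    proof -
      have "continuous_on (ball 0 R) (\<lambda>y. ?T i j d y)"
        by (rule continuous_on_kernel_tensor) (use d \<rho> in \<open>auto intro!: continuous_intros ne\<close>)
      moreover have "green_tensor \<kappa> (\<rho> *\<^sub>R d) y $ i $ j = ?T i j d y" if "y \<in> ball 0 R" for y
        by (rule green_tensor_eq) (use that d \<rho> in \<open>intro ne; simp\<close>)
      ultimately show ?thesis
        by (subst continuous_on_cong[OF refl, where g="\<lambda>y. ?T i j d y"]) auto
    qed
    from matrix_source_integral[OF J J0 r(2) this]
    have "electric_field \<kappa> R J (\<rho> *\<^sub>R d) $ i = (\<Sum>j\<in>UNIV. LINT y|?N. green_tensor \<kappa> (\<rho> *\<^sub>R d) y $ i $ j * J y $ j)"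
      unfolding electric_field_def .
    also have "\<dots> = (\<Sum>j\<in>UNIV. LINT y|?N. ?T i j d y * J y $ j)"
    proof (intro sum.cong refl Bochner_Integration.integral_cong)
      fix j :: 3 and y assume "y \<in> space ?N"
      then have "norm y < \<rho>" using \<rho>0 by (simp add: space_restrict_space)
      then show "green_tensor \<kappa> (\<rho> *\<^sub>R d) y $ i $ j * J y $ j = ?T i j d y * J y $ j"
        by (subst green_tensor_eq) (use d in \<open>auto intro: ne\<close>)
    qed
    finally show ?thesis .
  qed
  have cT: "continuous_on (sphere 0 1 \<times> cball 0 r) (\<lambda>(d, y). ?T i j d y)" for i j
    unfolding split_beta
    by (rule continuous_on_kernel_tensor) (use \<rho>0 in \<open>auto intro!: continuous_intros ne\<close>)
  show cE: "continuous_on (sphere 0 1) (\<lambda>d. electric_field \<kappa> R J (\<rho> *\<^sub>R d) $ i)"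
  proof -
    have "continuous_on (sphere 0 1) (\<lambda>d. \<Sum>j\<in>UNIV. LINT y|?N. ?T i j d y * J y $ j)"
      by (intro continuous_on_sum sphere_source_fubini(2)[OF cT Ji])
    then show ?thesis using E
      by (subst continuous_on_cong[OF refl, where g="\<lambda>d. \<Sum>j\<in>UNIV. LINT y|?N. ?T i j d y * J y $ j"]) auto
  qed
  let ?h = "solid_harmonic s n k"
  have cTh: "continuous_on (sphere 0 1 \<times> cball 0 r) (\<lambda>(d, y). ?T i j d y * ?h d)" for j
  proof -
    have "continuous_on (sphere 0 1 \<times> cball 0 r) (\<lambda>p :: (real^3) \<times> (real^3). ?h (fst p))"
      by (rule continuous_on_compose2[OF continuous_on_solid_harmonic[of UNIV]]) (auto intro!: continuous_intros)
    with cT[of i j] show ?thesis unfolding split_beta by (intro continuous_on_mult)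
  qed
  have ch: "continuous_on (sphere 0 1) (\<lambda>d. LINT y|?N. ?T i j d y * ?h d * J y $ j)" for j
    by (rule sphere_source_fubini(2)[OF cTh Ji])
  have "(LINT d|sphere_measure. electric_field \<kappa> R J (\<rho> *\<^sub>R d) $ i * ?h d) =
     (LINT d|sphere_measure. (\<Sum>j\<in>UNIV. (LINT y|?N. ?T i j d y * ?h d * J y $ j)))"
  proof (rule Bochner_Integration.integral_cong)
    fix d assume "d \<in> space sphere_measure"
    then have d: "norm d = 1" by simp
    have "(LINT y|?N. ?T i j d y * J y $ j) * ?h d = (LINT y|?N. ?T i j d y * ?h d * J y $ j)" for j
      unfolding integral_mult_left_zero[symmetric] by (rule Bochner_Integration.integral_cong) (simp_all add: mult_ac)
    then show "electric_field \<kappa> R J (\<rho> *\<^sub>R d) $ i * ?h d = (\<Sum>j\<in>UNIV. LINT y|?N. ?T i j d y * ?h d * J y $ j)"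
      unfolding E[OF d] sum_distrib_right by (simp only:)
  qed simp
  also have "\<dots> = (\<Sum>j\<in>UNIV. LINT d|sphere_measure. LINT y|?N. ?T i j d y * ?h d * J y $ j)"
    by (rule Bochner_Integration.integral_sum) (intro integrable_sphere ch)
  also have "\<dots> = (\<Sum>j\<in>UNIV. LINT y|?N. (LINT d|sphere_measure. ?T i j d y * ?h d) * J y $ j)"
    by (intro sum.cong refl sphere_source_fubini(1)[OF cTh Ji])
  also have "\<dots> = (\<Sum>j\<in>UNIV. LINT y|?N. multipole_coeff \<kappa> n \<rho> * (dyadic \<kappa> (regular_wave \<kappa> s n k) y $ i $ j * J y $ j))"
  proof (intro sum.cong refl)
    fix j :: 3
    have ci: "continuous_on (cball 0 r) (\<lambda>y. dyadic \<kappa> (regular_wave \<kappa> s n k) y $ i $ j)"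
      by (rule continuous_on_dyadic[OF Cinf_regular_wave])
    show "(LINT y|?N. (LINT d|sphere_measure. ?T i j d y * ?h d) * J y $ j) =
          (LINT y|?N. multipole_coeff \<kappa> n \<rho> * (dyadic \<kappa> (regular_wave \<kappa> s n k) y $ i $ j * J y $ j))"
    proof (rule integral_cong_AE)
      have "AE y in lebesgue. y \<noteq> (0 :: real^3)"
        by (rule AE_I[of _ _ "{0}"]) auto
      then have "AE y in ?N. y \<noteq> 0"
        by (subst AE_restrict_space_iff) auto
      then show "AE y in ?N. (LINT d|sphere_measure. ?T i j d y * ?h d) * J y $ j =
          multipole_coeff \<kappa> n \<rho> * (dyadic \<kappa> (regular_wave \<kappa> s n k) y $ i $ j * J y $ j)"
        using AE_space
      proof eventually_elim
        case (elim y)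
        then have "norm y < \<rho>" "y \<noteq> 0" using \<rho>0 by (auto simp: space_restrict_space)
        then show ?case by (simp add: kernel_tensor_moment[OF \<kappa> s])
      qed
    qed (intro borel_measurable_integrable sphere_source_fubini(3)[OF cTh Ji] integrable_mult_compact_continuous[OF Ji] ci
           Bochner_Integration.integrable_mult_right compact_cball)+
  qed
  also have "\<dots> = multipole_coeff \<kappa> n \<rho> * (\<Sum>j\<in>UNIV. LINT y|?N. dyadic \<kappa> (regular_wave \<kappa> s n k) y $ i $ j * J y $ j)"
    by (simp add: sum_distrib_left)
  also have "(\<Sum>j\<in>UNIV. LINT y|?N. dyadic \<kappa> (regular_wave \<kappa> s n k) y $ i $ j * J y $ j) = wave_moment \<kappa> R J s n k $ i"
    unfolding wave_moment_def
    by (rule matrix_source_integral[OF J J0 r(2) continuous_on_dyadic[OF Cinf_regular_wave], symmetric])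
  finally show "(LINT d|sphere_measure. electric_field \<kappa> R J (\<rho> *\<^sub>R d) $ i * ?h d) = multipole_coeff \<kappa> n \<rho> * wave_moment \<kappa> R J s n k $ i" .
qed

lemma beta_eq_wave_moment:
  assumes J: "J \<in> L2 (ball 0 R)" and J0: "AE x in lebesgue. x \<notin> cball 0 r \<longrightarrow> J x = 0" and r: "r < R"
    and m: "m \<in> {- int n..int n}"
  shows "beta \<kappa> R J n m $ i = of_real (wave_coeff \<kappa> n (nat \<bar>m\<bar>)) * wave_moment \<kappa> R J (orientation m) n (n + nat \<bar>m\<bar>) $ i"
proof -
  let ?c = "complex_of_real (wave_coeff \<kappa> n (nat \<bar>m\<bar>))" and ?W = "regular_wave \<kappa> (orientation m) n (n + nat \<bar>m\<bar>)"
  have d: "dyadic \<kappa> (wave \<kappa> n m) y $ i $ j = ?c * dyadic \<kappa> ?W y $ i $ j" for y i j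
    unfolding wave_eq_regular_wave[OF m] by (rule dyadic_cmult[OF Cinf_regular_wave])
  have c: "continuous_on S (\<lambda>y. dyadic \<kappa> (wave \<kappa> n m) y $ i $ j)" for S i j
    unfolding d by (intro continuous_intros continuous_on_dyadic Cinf_regular_wave)
  show ?thesis
    unfolding beta_def wave_moment_def matrix_source_integral[OF J J0 r c]
      matrix_source_integral[OF J J0 r continuous_on_dyadic[OF Cinf_regular_wave]] d
    by (simp add: sum_distrib_left mult.assoc)
qed

text \<open>If the field vanishes, then so do its coefficients on a sphere so large that the multipole coefficient
  is invertible, and with them the moments. Conversely, if all moments vanish, then the field on any exterior
  sphere is continuous with vanishing coefficients, hence zero by completeness.\<close>

theorem nonradiating_iff_beta:
  assumes \<kappa>: "\<kappa> > 0" and J: "J \<in> L2 (ball 0 R)"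
    and J0: "AE x in lebesgue. x \<notin> cball 0 r \<longrightarrow> J x = 0" and r: "0 < r" "r < R"
  shows "nonradiating \<kappa> R J \<longleftrightarrow> (\<forall>n. \<forall>m\<in>{- int n..int n}. beta \<kappa> R J n m = 0)"
proof
  assume nr: "nonradiating \<kappa> R J"
  show "\<forall>n. \<forall>m\<in>{- int n..int n}. beta \<kappa> R J n m = 0"
  proof (intro allI ballI)
    fix n and m assume m: "m \<in> {- int n..int n}"
    have "eventually (\<lambda>\<rho>. multipole_coeff \<kappa> n \<rho> \<noteq> 0 \<and> R \<le> \<rho>) at_top"
      by (intro eventually_conj multipole_coeff_nonzero[OF \<kappa>] eventually_ge_at_top)
    then obtain \<rho> where \<rho>: "multipole_coeff \<kappa> n \<rho> \<noteq> 0" "R \<le> \<rho>"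
      using eventually_happens'[OF trivial_limit_at_top_linorder] by blast
    have "electric_field \<kappa> R J (\<rho> *\<^sub>R d) = 0" if "norm d = 1" for d
      using nr that \<rho>(2) r unfolding nonradiating_def by auto
    then have z: "(LINT d|sphere_measure. electric_field \<kappa> R J (\<rho> *\<^sub>R d) $ i * solid_harmonic (orientation m) n k d) = 0" for i k
      by (subst Bochner_Integration.integral_cong[where g="\<lambda>_. 0"]) auto
    have "wave_moment \<kappa> R J (orientation m) n k $ i = 0" for k i
    proof -
      have "multipole_coeff \<kappa> n \<rho> * wave_moment \<kappa> R J (orientation m) n k $ i = 0"
        unfolding field_moment(1)[OF \<kappa> orientation_square[of m] J J0 r \<rho>(2), symmetric] by (rule z)
      then show ?thesis using \<rho>(1) by simp
    qed
    then show "beta \<kappa> R J n m = 0"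
      by (simp add: vec_eq_iff beta_eq_wave_moment[OF J J0 r(2) m])
  qed
next
  assume b: "\<forall>n. \<forall>m\<in>{- int n..int n}. beta \<kappa> R J n m = 0"
  have wm: "wave_moment \<kappa> R J (orientation m) n (n + nat \<bar>m\<bar>) $ i = 0" if "m \<in> {- int n..int n}" for n m i
    using b that beta_eq_wave_moment[OF J J0 r(2) that, of \<kappa> i] wave_coeff_nonzero[OF \<kappa>, of n "nat \<bar>m\<bar>"] by auto
  show "nonradiating \<kappa> R J"
    unfolding nonradiating_def
  proof (intro allI impI)
    fix x :: "real^3" assume x: "x \<notin> ball 0 R"
    define \<rho> where "\<rho> = norm x"
    have \<rho>: "R \<le> \<rho>" "\<rho> > 0" using x r by (auto simp: \<rho>_def)
    have "electric_field \<kappa> R J (\<rho> *\<^sub>R sgn x) $ i = 0" for i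
    proof (rule sphere_harmonics_complete[where f="\<lambda>d. electric_field \<kappa> R J (\<rho> *\<^sub>R d) $ i"])
      show "continuous_on (sphere 0 1) (\<lambda>d. electric_field \<kappa> R J (\<rho> *\<^sub>R d) $ i)"
        by (rule field_moment(2)[OF \<kappa> orientation_square[of 0] J J0 r \<rho>(1)])
      show "norm (sgn x) = 1" using \<rho> by (auto simp: norm_sgn \<rho>_def)
      fix s :: real and n m :: nat assume s: "s\<^sup>2 = 1" and m: "m \<le> n"
      let ?I = "\<lambda>s. LINT d|sphere_measure. electric_field \<kappa> R J (\<rho> *\<^sub>R d) $ i * solid_harmonic s n (n + m) d"
      have neg: "?I (- 1) = 0"
        using field_moment(1)[OF \<kappa> orientation_square[of "int m"] J J0 r \<rho>(1)] wm[of "int m" n] m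
        by (simp add: orientation_def)
      have pos: "?I 1 = 0"
      proof (cases "m = 0")
        case True
        have "?I 1 = ?I (- 1)"
          by (rule Bochner_Integration.integral_cong) (simp_all add: True solid_harmonic_sphere[where m=0, simplified])
        then show ?thesis using neg by simp
      next
        case False
        then show ?thesis
          using field_moment(1)[OF \<kappa> orientation_square[of "- int m"] J J0 r \<rho>(1)] wm[of "- int m" n] m
          by (simp add: orientation_def)
      qed
      have "s = 1 \<or> s = - 1" using s by (simp add: power2_eq_1_iff)
      then show "?I s = 0" using neg pos by auto
    qed
    moreover have "\<rho> *\<^sub>R sgn x = x" using \<rho>(2) by (simp add: \<rho>_def sgn_div_norm)
    ultimately show "electric_field \<kappa> R J x = 0" by (simp add: vec_eq_iff)
  qed
qed

section \<open>Smooth cutoff functions\<close>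

text \<open>The functions \<open>p(1/x) e\<^bsup>-1/x\<^esup>\<close>, extended by zero, form a class that is closed under differentiation.\<close>

definition flat_exp :: "real poly \<Rightarrow> real \<Rightarrow> real" where
  "flat_exp p x = (if x > 0 then poly p (1 / x) * exp (- (1 / x)) else 0)"

definition flat_deriv :: "real poly \<Rightarrow> real poly" where
  "flat_deriv p = [:0, 0, 1:] * (p - pderiv p)"

lemma poly_exp_tendsto_0: "((\<lambda>u. poly p u * exp (- u)) \<longlongrightarrow> 0) (at_top :: real filter)"
proof -
  have k: "((\<lambda>u. coeff p k * (u ^ k / exp u)) \<longlongrightarrow> coeff p k * 0) (at_top :: real filter)" for k
    by (intro tendsto_intros tendsto_power_div_exp_0)
  have "((\<lambda>u. \<Sum>k\<le>degree p. coeff p k * (u ^ k / exp u)) \<longlongrightarrow> (\<Sum>k\<le>degree p. coeff p k * 0)) (at_top :: real filter)"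
    by (intro tendsto_sum k)
  then show ?thesis
    by (simp add: poly_altdef sum_distrib_right exp_minus field_simps sum_divide_distrib)
qed

lemma flat_exp_derivative: "(flat_exp p has_real_derivative flat_exp (flat_deriv p) x) (at x)"
proof -
  consider "x < 0" | "x = 0" | "x > 0" by linarith
  then show ?thesis
  proof cases
    case 1
    have "((\<lambda>x. 0) has_real_derivative 0) (at x)" by simp
    then have "(flat_exp p has_real_derivative 0) (at x)"
      by (rule DERIV_cong_ev[THEN iffD1, rotated 3])
         (use 1 in \<open>auto simp: flat_exp_def intro!: eventually_mono[OF eventually_nhds_in_open[of "{..<0}"]]\<close>)
    then show ?thesis using 1 by (simp add: flat_exp_def)
  next
    case 3
    have "((\<lambda>x. poly p (1 / x) * exp (- (1 / x))) has_real_derivative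
        poly p (1 / x) * (exp (- (1 / x)) * (1 / x\<^sup>2)) + poly (pderiv p) (1 / x) * (- (1 / x\<^sup>2)) * exp (- (1 / x))) (at x)"
    proof -
      have i: "((\<lambda>x. 1 / x) has_real_derivative - (1 / x\<^sup>2)) (at x)"
        using 3 by (auto intro!: derivative_eq_intros simp: power2_eq_square)
      have a: "((\<lambda>x. poly p (1 / x)) has_real_derivative poly (pderiv p) (1 / x) * (- (1 / x\<^sup>2))) (at x)"
        by (rule DERIV_chain2[OF poly_DERIV i])
      have b: "((\<lambda>x. exp (- (1 / x))) has_real_derivative exp (- (1 / x)) * (1 / x\<^sup>2)) (at x)"
        using DERIV_chain2[OF DERIV_exp DERIV_minus[OF i]] by simp
      from DERIV_mult'[OF a b] show ?thesis .
    qed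
    moreover have "poly p (1 / x) * (exp (- (1 / x)) * (1 / x\<^sup>2)) + poly (pderiv p) (1 / x) * (- (1 / x\<^sup>2)) * exp (- (1 / x))
        = flat_exp (flat_deriv p) x"
      using 3 by (simp add: flat_exp_def flat_deriv_def algebra_simps power2_eq_square)
    ultimately have d: "((\<lambda>x. poly p (1 / x) * exp (- (1 / x))) has_real_derivative flat_exp (flat_deriv p) x) (at x)"
      by (simp only:)
    show ?thesis
      by (rule DERIV_cong_ev[THEN iffD1, OF refl _ refl d])
         (use 3 in \<open>auto simp: flat_exp_def intro!: eventually_mono[OF eventually_nhds_in_open[of "{0<..}"]]\<close>)
  next
    case 2
    have "((\<lambda>h. flat_exp p h / h) \<longlongrightarrow> 0) (at 0)"
    proof (rule filterlim_split_at)
      show "((\<lambda>h. flat_exp p h / h) \<longlongrightarrow> 0) (at_left 0)"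
        by (rule tendsto_eventually) (auto simp: eventually_at_filter flat_exp_def)
      have "((\<lambda>h. poly ([:0, 1:] * p) (inverse h) * exp (- inverse h)) \<longlongrightarrow> 0) (at_right (0 :: real))"
        by (rule filterlim_compose[OF poly_exp_tendsto_0 filterlim_inverse_at_top_right])
      moreover have "eventually (\<lambda>h. poly ([:0, 1:] * p) (inverse h) * exp (- inverse h) = flat_exp p h / h) (at_right (0 :: real))"
        by (auto simp: eventually_at_filter flat_exp_def inverse_eq_divide)
      ultimately show "((\<lambda>h. flat_exp p h / h) \<longlongrightarrow> 0) (at_right 0)"
        by (rule Lim_transform_eventually)
    qed
    then show ?thesis using 2 by (simp add: DERIV_def flat_exp_def)
  qed
qed

lemma Cinf_flat_exp:
  assumes "(\<lambda>y. of_real (u y)) \<in> Cinf"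
  shows "(\<lambda>y. of_real (flat_exp 1 (u y))) \<in> Cinf"
proof -
  let ?F = "\<lambda>i s. complex_of_real (flat_exp ((flat_deriv ^^ i) 1) s)"
  have "(?F i has_vector_derivative ?F (Suc i) s) (at s)" for i s
    using flat_exp_derivative[of "(flat_deriv ^^ i) 1" s]
    by (intro has_vector_derivative_of_real) (simp add: has_real_derivative_iff_has_vector_derivative)
  from Cinf_compose_real[where F="?F" and i=0, OF this assms] show ?thesis by simp
qed

lemma flat_exp_1_mono: "x \<le> y \<Longrightarrow> flat_exp 1 x \<le> flat_exp 1 y"
  by (auto simp: flat_exp_def frac_le)

lemma flat_exp_1_nonneg: "flat_exp 1 x \<ge> 0" by (simp add: flat_exp_def)

text \<open>A smooth step without quotients of functions: the outer function sees \<open>\<delta> > 0\<close> exactly where the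
  inner one vanishes, and a non-positive argument where the inner one has reached \<open>\<delta>\<close>.\<close>

definition step_down :: "real \<Rightarrow> real \<Rightarrow> real \<Rightarrow> real" where
  "step_down a b x = flat_exp 1 (flat_exp 1 (b - a) - flat_exp 1 (x - a)) / flat_exp 1 (flat_exp 1 (b - a))"

lemma step_down:
  assumes "a < b"
  shows "x \<le> a \<Longrightarrow> step_down a b x = 1" "x \<ge> b \<Longrightarrow> step_down a b x = 0" "0 \<le> step_down a b x" "step_down a b x \<le> 1"
proof -
  have d: "flat_exp 1 (b - a) > 0" using assms by (simp add: flat_exp_def)
  then have d2: "flat_exp 1 (flat_exp 1 (b - a)) > 0" by (simp add: flat_exp_def[of 1 "flat_exp 1 (b - a)"])
  show "step_down a b x = 1" if "x \<le> a"
  proof -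
    have "flat_exp 1 (x - a) = 0" using that by (simp add: flat_exp_def)
    then show ?thesis using d2 by (simp add: step_down_def)
  qed
  show "step_down a b x = 0" if "x \<ge> b"
  proof -
    have "flat_exp 1 (b - a) - flat_exp 1 (x - a) \<le> 0" using flat_exp_1_mono[of "b - a" "x - a"] that by simp
    then have "flat_exp 1 (flat_exp 1 (b - a) - flat_exp 1 (x - a)) = 0" by (simp add: flat_exp_def[of 1 "_ - _ "])
    then show ?thesis by (simp add: step_down_def)
  qed
  show "0 \<le> step_down a b x" by (simp add: step_down_def flat_exp_1_nonneg)
  have "flat_exp 1 (flat_exp 1 (b - a) - flat_exp 1 (x - a)) \<le> flat_exp 1 (flat_exp 1 (b - a))"
    by (rule flat_exp_1_mono) (simp add: flat_exp_1_nonneg)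
  then show "step_down a b x \<le> 1" using d2 by (simp add: step_down_def)
qed

definition radial_cutoff :: "real \<Rightarrow> real \<Rightarrow> real^3 \<Rightarrow> complex" where
  "radial_cutoff s t y = of_real (step_down (s\<^sup>2) (t\<^sup>2) ((norm y)\<^sup>2))"

lemma Cinf_radial_cutoff: "radial_cutoff s t \<in> Cinf"
proof -
  have 1: "(\<lambda>y :: real^3. complex_of_real ((norm y)\<^sup>2 - s\<^sup>2)) \<in> Cinf"
    using Cinf_add[OF Cinf_norm_square Cinf_const[of "- of_real (s\<^sup>2)"]] by simp
  have 2: "(\<lambda>y :: real^3. complex_of_real (c - flat_exp 1 ((norm y)\<^sup>2 - s\<^sup>2))) \<in> Cinf" for c
    using Cinf_add[OF Cinf_const[of "of_real c"] Cinf_mult[OF Cinf_const[of "- 1"] Cinf_flat_exp[OF 1]]] by simp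
  let ?\<delta> = "flat_exp 1 (t\<^sup>2 - s\<^sup>2)"
  have "radial_cutoff s t = (\<lambda>y. of_real (1 / flat_exp 1 ?\<delta>) * of_real (flat_exp 1 (?\<delta> - flat_exp 1 ((norm y)\<^sup>2 - s\<^sup>2))))"
    by (simp add: fun_eq_iff radial_cutoff_def step_down_def)
  then show ?thesis by (simp only:) (intro Cinf_mult Cinf_const Cinf_flat_exp 2)
qed

lemma radial_cutoff:
  assumes "0 \<le> s" "s < t"
  shows "norm y \<le> s \<Longrightarrow> radial_cutoff s t y = 1" "norm y \<ge> t \<Longrightarrow> radial_cutoff s t y = 0" "norm (radial_cutoff s t y) \<le> 1"
proof -
  have st: "s\<^sup>2 < t\<^sup>2" using assms by (intro power_strict_mono) auto
  show "radial_cutoff s t y = 1" if "norm y \<le> s"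
    using step_down(1)[OF st, of "(norm y)\<^sup>2"] that by (simp add: radial_cutoff_def power_mono)
  show "radial_cutoff s t y = 0" if "norm y \<ge> t"
    using step_down(2)[OF st, of "(norm y)\<^sup>2"] that assms by (simp add: radial_cutoff_def power_mono)
  show "norm (radial_cutoff s t y) \<le> 1"
    using step_down(3,4)[OF st, of "(norm y)\<^sup>2"] by (simp add: radial_cutoff_def)
qed

lemma cutoff_test_function:
  assumes f: "f \<in> Cinf" and st: "0 \<le> s" "s < t" "t < R"
  shows "(\<lambda>y. radial_cutoff s t y * f y) \<in> test_functions R"
proof -
  have "closure {y. radial_cutoff s t y * f y \<noteq> 0} \<subseteq> cball 0 t"
  proof (rule closure_minimal)
    show "{y. radial_cutoff s t y * f y \<noteq> 0} \<subseteq> cball 0 t"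
      using radial_cutoff(2)[OF st(1,2)] by (force simp: not_le)
  qed simp
  also have "\<dots> \<subseteq> ball 0 R" using st by auto
  finally show ?thesis unfolding test_functions_def using Cinf_mult[OF Cinf_radial_cutoff f] by simp
qed

section \<open>The moments in weak form\<close>

lemma set_integral_ball_eq:
  "(LINT x:ball 0 R|lebesgue. F x) = (LINT x|lebesgue_on (ball 0 R). F (x :: real^3))"
  for F :: "real^3 \<Rightarrow> 'b :: euclidean_space"
  unfolding set_lebesgue_integral_def by (subst integral_restrict_space) auto

lemma AE_lebesgue_onI: "AE x in lebesgue. P x \<Longrightarrow> AE x in lebesgue_on (ball 0 R). P x"
  for P :: "real^3 \<Rightarrow> bool"
  by (subst AE_restrict_space_iff) (auto elim: eventually_mono)

lemma integrable_mult_ball_continuous: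
  fixes \<phi> g :: "real^3 \<Rightarrow> complex"
  assumes \<phi>: "integrable (lebesgue_on (ball 0 R)) \<phi>" and g: "continuous_on UNIV g"
  shows "integrable (lebesgue_on (ball 0 R)) (\<lambda>x. g x * \<phi> x)"
proof -
  have "bounded (g ` cball 0 R)"
    by (intro compact_imp_bounded compact_continuous_image continuous_on_subset[OF g]) auto
  then obtain B where "\<forall>x\<in>g ` cball 0 R. norm x \<le> B" unfolding bounded_iff by blast
  then show ?thesis
    by (intro integrable_mult_bounded_continuous[OF \<phi> _ continuous_on_subset[OF g], of B]) auto
qed

lemma integrable_L2_component:
  "J \<in> L2 (ball 0 R) \<Longrightarrow> integrable (lebesgue_on (ball 0 R)) (\<lambda>y. J y $ j)"
  for J :: "real^3 \<Rightarrow> complex^3"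
  by (rule integrable_bounded_linear[OF bounded_linear_vec_nth integrable_L2_ball])

lemma integrable_cdot_grad:
  fixes J :: "real^3 \<Rightarrow> complex^3"
  assumes J: "J \<in> L2 (ball 0 R)" and f: "f \<in> Cinf"
  shows "integrable (lebesgue_on (ball 0 R)) (\<lambda>x. cdot (J x) (grad f x))"
  unfolding cdot_def grad_def vec_lambda_beta mult.commute[of "J _ $ _"]
  by (intro Bochner_Integration.integrable_sum integrable_mult_ball_continuous integrable_L2_component[OF J] Cinf_continuous Cinf_pd f)

lemma Cinf_wave: "m \<in> {- int n..int n} \<Longrightarrow> wave \<kappa> n m \<in> Cinf"
  unfolding wave_eq_regular_wave by (intro Cinf_mult Cinf_const Cinf_regular_wave)

lemma hessian_wave_symmetric:
  assumes "\<kappa> > 0" "m \<in> {- int n..int n}" "y \<noteq> 0"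
  shows "pd i (pd j (wave \<kappa> n m)) y = pd j (pd i (wave \<kappa> n m)) y"
proof -
  let ?c = "complex_of_real (wave_coeff \<kappa> n (nat \<bar>m\<bar>))" and ?W = "regular_wave \<kappa> (orientation m) n (n + nat \<bar>m\<bar>)"
  have "pd i (\<lambda>y. ?c * ?W y) = (\<lambda>y. ?c * pd i ?W y)" for i
    by (intro ext pd_cmult Cinf_differentiable Cinf_regular_wave)
  moreover have "pd i (\<lambda>y. ?c * pd j ?W y) y = ?c * pd i (pd j ?W) y" for i j
    by (intro pd_cmult Cinf_differentiable Cinf_pd Cinf_regular_wave)
  ultimately show ?thesis
    unfolding wave_eq_regular_wave[OF assms(2)]
    using hessian_regular_wave_symmetric[OF assms(1) orientation_square assms(3), of i j m n "n + nat \<bar>m\<bar>"] by simp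
qed

text \<open>Interchanging the two derivatives of the wave, which is allowed away from the origin, turns the Hessian
  applied to \<open>J\<close> into the pairing of \<open>J\<close> with the gradient of \<open>\<partial>\<^sub>i\<close> of the wave, the form in which the weak
  derivatives of \<open>J\<close> are defined.\<close>

lemma gamma_component:
  fixes J :: "real^3 \<Rightarrow> complex^3"
  assumes \<kappa>: "\<kappa> > 0" and J: "J \<in> L2 (ball 0 R)" and m: "m \<in> {- int n..int n}"
  shows "gamma \<kappa> R J n m $ i = of_real (1 / \<kappa>\<^sup>2) * (LINT x|lebesgue_on (ball 0 R). cdot (J x) (grad (pd i (wave \<kappa> n m)) x))"
proof -
  let ?w = "wave \<kappa> n m"
  have w: "?w \<in> Cinf" by (rule Cinf_wave[OF m])
  have ci: "integrable (lebesgue_on (ball 0 R)) (\<lambda>y. (hessian ?w y *v J y) $ i)" for i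
    unfolding matrix_vector_mult_def hessian_def vec_lambda_beta
    by (intro Bochner_Integration.integrable_sum integrable_mult_ball_continuous integrable_L2_component[OF J] Cinf_continuous Cinf_pd w)
  have "(LINT y:ball 0 R|lebesgue. hessian ?w y *v J y) $ i = (LINT y|lebesgue_on (ball 0 R). (hessian ?w y *v J y) $ i)"
    unfolding set_integral_ball_eq by (rule integral_vec_component[OF ci])
  also have "\<dots> = (LINT x|lebesgue_on (ball 0 R). cdot (J x) (grad (pd i ?w) x))"
  proof (rule integral_cong_AE)
    have "AE y in lebesgue. y \<noteq> (0 :: real^3)" by (rule AE_I[of _ _ "{0}"]) auto
    then have "AE y in lebesgue_on (ball 0 R). y \<noteq> (0 :: real^3)" by (rule AE_lebesgue_onI)
    then show "AE y in lebesgue_on (ball 0 R). (hessian ?w y *v J y) $ i = cdot (J y) (grad (pd i ?w) y)"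
    proof eventually_elim
      case (elim y)
      show ?case
        unfolding matrix_vector_mult_def hessian_def cdot_def grad_def vec_lambda_beta hessian_wave_symmetric[OF \<kappa> m elim, of i]
        by (simp add: mult.commute)
    qed
  qed (intro borel_measurable_integrable ci integrable_cdot_grad J Cinf_pd w)+
  finally show ?thesis
    unfolding gamma_def vector_scaleR_component by (simp only: scaleR_conv_of_real)
qed

lemma beta_eq_alpha_gamma:
  fixes J :: "real^3 \<Rightarrow> complex^3"
  assumes J: "J \<in> L2 (ball 0 R)" and m: "m \<in> {- int n..int n}"
  shows "beta \<kappa> R J n m = alpha \<kappa> R J n m + gamma \<kappa> R J n m"
proof -
  let ?w = "wave \<kappa> n m"
  have w: "?w \<in> Cinf" by (rule Cinf_wave[OF m])
  have 1: "integrable (lebesgue_on (ball 0 R)) (\<lambda>y. ?w y *s J y)"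
    by (rule integrable_vecI) (simp, intro integrable_mult_ball_continuous integrable_L2_component[OF J] Cinf_continuous w)
  have 2: "integrable (lebesgue_on (ball 0 R)) (\<lambda>y. hessian ?w y *v J y)"
    by (rule integrable_vecI, unfold matrix_vector_mult_def hessian_def vec_lambda_beta,
        intro Bochner_Integration.integrable_sum integrable_mult_ball_continuous integrable_L2_component[OF J] Cinf_continuous Cinf_pd w)
  have "dyadic \<kappa> ?w y *v J y = ?w y *s J y + (1 / \<kappa>\<^sup>2) *\<^sub>R (hessian ?w y *v J y)" for y
  proof -
    have "mat c *v v = c *s v" for c :: complex and v :: "complex^3"
      by (simp add: vec_eq_iff matrix_vector_mult_def mat_def if_distrib[where f="\<lambda>x. x * _"] sum.delta cong: if_cong)
    moreover have "(c *\<^sub>R A) *v v = c *\<^sub>R (A *v v)" for c :: real and A :: "complex^3^3" and v :: "complex^3"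
      by (simp add: vec_eq_iff matrix_vector_mult_def scaleR_sum_right)
    ultimately show ?thesis unfolding dyadic_def by (simp only: matrix_vector_mult_add_rdistrib)
  qed
  then show ?thesis
    unfolding beta_def alpha_def gamma_def set_integral_ball_eq
    by (simp only: Bochner_Integration.integral_add[OF 1 Bochner_Integration.integrable_scaleR_right[OF 2]] integral_scaleR_right)
qed

lemma weak_div_spec:
  "J \<in> Hdiv R \<Longrightarrow> weak_div R J \<in> L2 (ball 0 R) \<and> is_weak_div R J (weak_div R J)"
proof -
  assume "J \<in> Hdiv R"
  then have "\<exists>d. d \<in> L2 (ball 0 R) \<and> is_weak_div R J d" by (auto simp: Hdiv_def)
  from someI_ex[OF this] show ?thesis unfolding weak_div_def .
qed

lemma weak_grad_div_spec:
  "J \<in> Hdivgrad R \<Longrightarrow> weak_grad_div R J \<in> L2 (ball 0 R) \<and> is_weak_grad_div R J (weak_grad_div R J)"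
proof -
  assume "J \<in> Hdivgrad R"
  then have "\<exists>g. g \<in> L2 (ball 0 R) \<and> is_weak_grad_div R J g" by (auto simp: Hdivgrad_def)
  from someI_ex[OF this] show ?thesis unfolding weak_grad_div_def .
qed

text \<open>Vanishing normal trace, tested with \<open>\<partial>\<^sub>i\<close> of the wave.\<close>

lemma gamma_eq_zeta:
  assumes \<kappa>: "\<kappa> > 0" and J: "J \<in> H0div R" and m: "m \<in> {- int n..int n}"
  shows "gamma \<kappa> R J n m = zeta \<kappa> R J n m"
proof -
  let ?w = "wave \<kappa> n m" and ?d = "weak_div R J"
  have w: "?w \<in> Cinf" by (rule Cinf_wave[OF m])
  have J2: "J \<in> L2 (ball 0 R)" and Jd: "J \<in> Hdiv R" using J by (auto simp: H0div_def Hdiv_def)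
  have di: "integrable (lebesgue_on (ball 0 R)) ?d" using weak_div_spec[OF Jd] by (intro integrable_L2_ball) auto
  have dp: "integrable (lebesgue_on (ball 0 R)) (\<lambda>y. ?d y * pd i ?w y)" for i
    unfolding mult.commute[of "?d _"] by (intro integrable_mult_ball_continuous di Cinf_continuous Cinf_pd w)
  have z: "(LINT y:ball 0 R|lebesgue. ?d y *s grad ?w y) $ i = (LINT y|lebesgue_on (ball 0 R). ?d y * pd i ?w y)" for i
    unfolding set_integral_ball_eq using integral_vec_component[of "lebesgue_on (ball 0 R)" "\<lambda>y. ?d y *s grad ?w y" i] dp
    by (simp add: grad_def)
  have "(LINT x|lebesgue_on (ball 0 R). cdot (J x) (grad (pd i ?w) x)) = - (LINT y|lebesgue_on (ball 0 R). ?d y * pd i ?w y)" for i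
  proof -
    have "normal_trace R J (pd i ?w) = 0" using J Cinf_pd[OF w] by (simp add: H0div_def)
    then have "(LINT x|lebesgue_on (ball 0 R). cdot (J x) (grad (pd i ?w) x) + ?d x * pd i ?w x) = 0"
      unfolding normal_trace_def set_integral_ball_eq .
    then show ?thesis
      unfolding Bochner_Integration.integral_add[OF integrable_cdot_grad[OF J2 Cinf_pd[OF w]] dp] by (simp add: add_eq_0_iff2)
  qed
  then show ?thesis
    unfolding vec_eq_iff gamma_component[OF \<kappa> J2 m] zeta_def vector_uminus_component vector_scaleR_component z
    by (simp add: scaleR_conv_of_real)
qed

text \<open>The waves do not have compact support in the ball, so they are multiplied by cutoffs that converge to
  \<open>1\<close>. All cutoffs are \<open>1\<close> near the support of \<open>J\<close>, so the side with \<open>J\<close> does not change, and dominated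
  convergence applies to the side with the weak derivative.\<close>

lemma gamma_eq_eta:
  assumes \<kappa>: "\<kappa> > 0" and J: "J \<in> Hdivgrad R" and m: "m \<in> {- int n..int n}"
    and J0: "AE x in lebesgue. x \<notin> cball 0 r \<longrightarrow> J x = 0" and r: "0 < r" "r < R"
  shows "gamma \<kappa> R J n m = eta \<kappa> R J n m"
proof -
  let ?w = "wave \<kappa> n m" and ?g = "weak_grad_div R J" and ?M = "lebesgue_on (ball (0 :: real^3) R)"
  have w: "?w \<in> Cinf" by (rule Cinf_wave[OF m])
  have J2: "J \<in> L2 (ball 0 R)" using J by (auto simp: Hdivgrad_def)
  have gi: "integrable ?M (\<lambda>y. ?g y $ i)" for i using weak_grad_div_spec[OF J] by (intro integrable_L2_component) auto
  have gp: "integrable ?M (\<lambda>y. ?w y * ?g y $ i)" for i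
    by (intro integrable_mult_ball_continuous gi Cinf_continuous w)
  have z: "(LINT y:ball 0 R|lebesgue. ?w y *s ?g y) $ i = (LINT y|?M. ?w y * ?g y $ i)" for i
    unfolding set_integral_ball_eq using integral_vec_component[of ?M "\<lambda>y. ?w y *s ?g y" i] gp by simp
  \<comment> \<open>The offset 3 makes already the first cutoff equal to 1 beyond the radius of the source.\<close>
  define e where "e k = (R - r) / (real k + 3)" for k :: nat
  have e: "0 < e k" "r < R - 2 * e k" for k
  proof -
    show "0 < e k" using r by (simp add: e_def)
    have "(R - r) * 2 < (R - r) * (real k + 3)" using r by (intro mult_strict_left_mono) auto
    then have "2 * e k < R - r" by (simp add: e_def field_simps)
    then show "r < R - 2 * e k" by simp
  qed
  define cut where "cut k = radial_cutoff (R - 2 * e k) (R - e k)" for k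
  have ek: "0 \<le> R - 2 * e k" "R - 2 * e k < R - e k" "R - e k < R" for k using e[of k] r by linarith+
  have "(LINT x|?M. cdot (J x) (grad (pd i ?w) x)) = (LINT y|?M. ?w y * ?g y $ i)" for i
  proof -
    let ?\<phi> = "\<lambda>k y. cut k y * ?w y"
    have tf: "?\<phi> k \<in> test_functions R" for k
      unfolding cut_def by (rule cutoff_test_function[OF w ek])
    then have cphi: "?\<phi> k \<in> Cinf" for k by (simp add: test_functions_def)
    \<comment> \<open>Near the support of the source the cutoff is invisible.\<close>
    have "(LINT x|?M. cdot (J x) (grad (pd i (?\<phi> k)) x)) = (LINT x|?M. cdot (J x) (grad (pd i ?w) x))" for k
    proof (rule integral_cong_AE)
      show "AE x in ?M. cdot (J x) (grad (pd i (?\<phi> k)) x) = cdot (J x) (grad (pd i ?w) x)"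
        using AE_lebesgue_onI[OF J0]
      proof eventually_elim
        case (elim x)
        show ?case
        proof (cases "x \<in> cball 0 r")
          case True
          let ?S = "ball (0 :: real^3) (R - 2 * e k)"
          have x: "x \<in> ?S" using True e(2)[of k] by auto
          have eq: "?\<phi> k z = ?w z" if "z \<in> ?S" for z
            using radial_cutoff(1)[OF ek(1,2), of z k] that by (simp add: cut_def)
          have "pd i (?\<phi> k) z = pd i ?w z" if "z \<in> ?S" for z
            by (rule pd_cong_open[OF open_ball that eq])
          then have "pd j (pd i (?\<phi> k)) x = pd j (pd i ?w) x" for j
            by (rule pd_cong_open[OF open_ball x])
          then show ?thesis by (simp add: grad_def)
        qed (use elim in \<open>simp add: cdot_def\<close>)
      qed
    qed (intro borel_measurable_integrable integrable_cdot_grad J2 Cinf_pd cphi w)+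
    moreover have "(LINT x|?M. cdot (J x) (grad (pd i (?\<phi> k)) x)) = (LINT y|?M. ?\<phi> k y * ?g y $ i)" for k
      using weak_grad_div_spec[OF J] tf[of k] unfolding is_weak_grad_div_def set_integral_ball_eq
      by (simp add: mult.commute[of _ "?g _ $ i"])
    ultimately have const: "(LINT y|?M. ?\<phi> k y * ?g y $ i) = (LINT x|?M. cdot (J x) (grad (pd i ?w) x))" for k by simp
    have "(\<lambda>k. LINT y|?M. ?\<phi> k y * ?g y $ i) \<longlonglongrightarrow> (LINT y|?M. ?w y * ?g y $ i)"
    proof (rule integral_dominated_convergence[where w="\<lambda>y. norm (?w y * ?g y $ i)"])
      show "(\<lambda>y. ?w y * ?g y $ i) \<in> borel_measurable ?M" by (intro borel_measurable_integrable gp)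
      show "(\<lambda>y. ?\<phi> k y * ?g y $ i) \<in> borel_measurable ?M" for k
        by (intro borel_measurable_integrable integrable_mult_ball_continuous gi Cinf_continuous cphi)
      show "integrable ?M (\<lambda>y. norm (?w y * ?g y $ i))" by (intro integrable_norm gp)
      show "AE y in ?M. norm (?\<phi> k y * ?g y $ i) \<le> norm (?w y * ?g y $ i)" for k
      proof (rule AE_I2)
        fix y
        have "norm (cut k y) * (norm (?w y) * norm (?g y $ i)) \<le> 1 * (norm (?w y) * norm (?g y $ i))"
          unfolding cut_def by (intro mult_right_mono radial_cutoff(3) ek) simp
        then show "norm (?\<phi> k y * ?g y $ i) \<le> norm (?w y * ?g y $ i)" by (simp add: norm_mult mult.assoc)
      qed
      show "AE y in ?M. (\<lambda>k. ?\<phi> k y * ?g y $ i) \<longlonglongrightarrow> ?w y * ?g y $ i"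
      proof (rule AE_I2)
        fix y assume "y \<in> space ?M"
        then have y: "norm y < R" by (simp add: space_restrict_space)
        have "(\<lambda>k. (R - r) * inverse (real (k + 3))) \<longlonglongrightarrow> (R - r) * 0"
          by (intro tendsto_intros LIMSEQ_ignore_initial_segment lim_inverse_n)
        then have "e \<longlonglongrightarrow> 0" by (simp add: e_def[abs_def] field_simps)
        then have "(\<lambda>k. R - 2 * e k) \<longlonglongrightarrow> R - 2 * 0" by (intro tendsto_intros)
        then have "eventually (\<lambda>k. norm y < R - 2 * e k) sequentially"
          using y by (intro order_tendstoD(1)) auto
        then have "eventually (\<lambda>k. ?\<phi> k y * ?g y $ i = ?w y * ?g y $ i) sequentially"
        proof eventually_elim
          case (elim k)
          then show ?case using radial_cutoff(1)[OF ek(1,2), of y k] by (simp add: cut_def)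
        qed
        then show "(\<lambda>k. ?\<phi> k y * ?g y $ i) \<longlonglongrightarrow> ?w y * ?g y $ i" by (rule tendsto_eventually)
      qed
    qed
    then show ?thesis unfolding const using LIMSEQ_unique tendsto_const by blast
  qed
  then show ?thesis
    unfolding vec_eq_iff gamma_component[OF \<kappa> J2 m] eta_def vector_scaleR_component z
    by (simp add: scaleR_conv_of_real)
qed

section \<open>Characterisation of nonradiating sources\<close>

theorem theorem3p1:
  fixes \<kappa> R :: real and J :: "real^3 \<Rightarrow> complex^3"
  assumes "\<kappa> > 0" and "R > 0"
    and "compact (ess_support J)" and "ess_support J \<subseteq> ball 0 R"
  shows "(J \<in> L2 (ball 0 R) \<longrightarrow>
            (\<forall>n. \<forall>m\<in>{- int n..int n}. beta \<kappa> R J n m = alpha \<kappa> R J n m + gamma \<kappa> R J n m) \<and>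
            (nonradiating \<kappa> R J \<longleftrightarrow> (\<forall>n. \<forall>m\<in>{- int n..int n}. beta \<kappa> R J n m = 0)))
       \<and> (J \<in> H0div R \<longrightarrow>
            (\<forall>n. \<forall>m\<in>{- int n..int n}. beta \<kappa> R J n m = alpha \<kappa> R J n m + zeta \<kappa> R J n m) \<and>
            (nonradiating \<kappa> R J \<longleftrightarrow> (\<forall>n. \<forall>m\<in>{- int n..int n}. beta \<kappa> R J n m = 0)))
       \<and> (J \<in> Hdivgrad R \<longrightarrow>
            (nonradiating \<kappa> R J \<longleftrightarrow>
               (\<forall>n. \<forall>m\<in>{- int n..int n}. alpha \<kappa> R J n m + eta \<kappa> R J n m = 0)))"
proof -
  obtain r where r: "0 < r" "r < R" and J0: "AE x in lebesgue. x \<notin> cball 0 r \<longrightarrow> J x = 0"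
    using support_radius[OF assms(2-4)] by blast
  have iff: "nonradiating \<kappa> R J \<longleftrightarrow> (\<forall>n. \<forall>m\<in>{- int n..int n}. beta \<kappa> R J n m = 0)" if "J \<in> L2 (ball 0 R)"
    by (rule nonradiating_iff_beta[OF assms(1) that J0 r])
  have L2: "J \<in> L2 (ball 0 R)" if "J \<in> H0div R \<or> J \<in> Hdivgrad R"
    using that by (auto simp: H0div_def Hdiv_def Hdivgrad_def)
  have "beta \<kappa> R J n m = alpha \<kappa> R J n m + zeta \<kappa> R J n m" if "J \<in> H0div R" "m \<in> {- int n..int n}" for n m
    using beta_eq_alpha_gamma[OF L2 that(2)] gamma_eq_zeta[OF assms(1) that] that(1) by simp
  moreover have "beta \<kappa> R J n m = alpha \<kappa> R J n m + eta \<kappa> R J n m" if "J \<in> Hdivgrad R" "m \<in> {- int n..int n}" for n m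
    using beta_eq_alpha_gamma[OF L2 that(2)] gamma_eq_eta[OF assms(1) that J0 r] that(1) by simp
  ultimately show ?thesis using iff L2 beta_eq_alpha_gamma by simp
qed

end
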